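(* Let $n\ge1$, let $\mu$ be a partition with exactly $p$ nonzero parts (and at most $n$ parts), and let $S$ be a ssyt of shape $\mu$ with entries in $[n]$. Let $\varphi\in\mathfrak S_n$ be the permutation associated to $S$ by the push-down procedure described in the context. Then: (1) the right key of $S$ is the key tableau of shape $\mu$ corresponding to the coset $\varphi\mathfrak S_\mu$; and (2) $\varphi$ is the unique minimal element, in the Bruhat order on $\mathfrak S_n$, of the coset $\varphi\mathfrak S_\mu$.
   Context: Tableaux use English convention; a ssyt has rows weakly increasing left to right and columns strictly increasing downward. $\mathfrak S_\mu$ is the stabiliser of $\mu$ in $\mathfrak S_n$ under $(wf)(i)=f(w^{-1}i)$ on compositions. A key tableau is a ssyt each of whose columns (other than the first) has entry set contained in that of the previous column. To $\sigma=\sigma_1\dots\sigma_n\in\mathfrak S_n$ is associated the key tableau of shape $\mu$ whose column with $j$ boxes has entries $\sigma_1,\dots,\sigma_j$ increasing downward; this gives a bijection between cosets $\sigma\mathfrak S_\mu$ and key tableaux of shape $\mu$. Right key (Lascoux–Schützenberger): if $S$ has nonempty columns of lengths $b(1)\ge\dots\ge b(c)$, the $j$-th column of the right key of $S$ is the last column of the unique ssyt jeu-de-taquin equivalent to $S$ whose skew shape has column lengths $b(1),\dots,b(j-1),b(j+1),\dots,b(c),b(j)$ (in order) and inner shape a rectangle of height $b(j)-b(c)$ and width $c-1$. Push-down procedure: a configuration is an arrangement of entries in boxes of a grid (positions matter; some boxes may be empty). Put $S_1:=S$, and let $\mathbf e_1$ be the rightmost entry of row 1; $\varphi_1$ is its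 value. For $i=2,\dots,p$: starting from $S_{i-1}$, let the temporarily exposed entry $\mathbf e'$ be the rightmost entry in row $i$. Repeat: look at the row immediately above that of $\mathbf e'$; if it contains an entry whose value is $\ge$ the value of $\mathbf e'$, let $\mathbf c$ be the leftmost such entry, move $\mathbf c$ and all entries to its right in its row one row down (same columns), and redesignate $\mathbf e'$ to be the entry immediately to the left of the former position of $\mathbf c$; otherwise (in particular if $\mathbf e'$ is in row 1) stop. The resulting configuration is $S_i$, the final $\mathbf e'$ is the exposed entry $\mathbf e_i$, and $\varphi_i$ is its value. Finally $\varphi_{p+1},\dots,\varphi_n$ are the elements of $[n]\setminus\{\varphi_1,\dots,\varphi_p\}$ in increasing order, and $\varphi=\varphi_1\dots\varphi_n$. *)

theory Defs
  imports "HOL-Algebra.Sym_Groups" "HOL-Algebra.Group_Action"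
begin

section \<open>Compositions and the symmetric group\<close>

text \<open>A composition is a function \<^term>\<open>f :: nat \<Rightarrow> nat\<close> whose parts are the values at
  \<open>1, 2, \<dots>\<close>; the value at \<open>0\<close> plays no role. The group \<open>sym_group n\<close> permutes \<open>{1..n}\<close> and fixes
  everything else.\<close>

definition is_partition :: "(nat \<Rightarrow> nat) \<Rightarrow> bool" where
  "is_partition \<mu> \<longleftrightarrow> (\<forall>i j. 1 \<le> i \<and> i \<le> j \<longrightarrow> \<mu> j \<le> \<mu> i) \<and> finite {i. 1 \<le> i \<and> \<mu> i \<noteq> 0}"

definition comp_act :: "(nat \<Rightarrow> nat) \<Rightarrow> (nat \<Rightarrow> nat) \<Rightarrow> nat \<Rightarrow> nat" where
  "comp_act w f = (\<lambda>i. f (inv' w i))"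

definition stab :: "nat \<Rightarrow> (nat \<Rightarrow> nat) \<Rightarrow> (nat \<Rightarrow> nat) set" where
  "stab n \<mu> = stabilizer (sym_group n) comp_act \<mu>"

definition perm_length :: "nat \<Rightarrow> (nat \<Rightarrow> nat) \<Rightarrow> nat" where
  "perm_length n w = card {(i, j). 1 \<le> i \<and> i < j \<and> j \<le> n \<and> w j < w i}"

definition bruhat_step :: "nat \<Rightarrow> (nat \<Rightarrow> nat) \<Rightarrow> (nat \<Rightarrow> nat) \<Rightarrow> bool" where
  "bruhat_step n u v \<longleftrightarrow> u \<in> carrier (sym_group n) \<and>
     (\<exists>i\<in>{1..n}. \<exists>j\<in>{1..n}. i \<noteq> j \<and> v = u \<circ> transpose i j) \<and> perm_length n u < perm_length n v"

definition bruhat_le :: "nat \<Rightarrow> (nat \<Rightarrow> nat) \<Rightarrow> (nat \<Rightarrow> nat) \<Rightarrow> bool" where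
  "bruhat_le n = (bruhat_step n)\<^sup>*\<^sup>*"

definition bruhat_minimal :: "nat \<Rightarrow> (nat \<Rightarrow> nat) set \<Rightarrow> (nat \<Rightarrow> nat) set" where
  "bruhat_minimal n C = {w \<in> C. \<forall>v\<in>C. bruhat_le n v w \<longrightarrow> v = w}"


section \<open>Tableaux\<close>

text \<open>Boxes are pairs (row, column), both numbered from \<open>1\<close>, in English convention. A configuration
  is a partial filling of the grid, and \<^term>\<open>dom T\<close> is its set of nonempty boxes.\<close>

type_synonym config = "nat \<times> nat \<rightharpoonup> nat"

definition diagram :: "(nat \<Rightarrow> nat) \<Rightarrow> (nat \<times> nat) set" where
  "diagram \<mu> = {(r, c). 1 \<le> r \<and> 1 \<le> c \<and> c \<le> \<mu> r}"

definition ssyt :: "(nat \<times> nat) set \<Rightarrow> config \<Rightarrow> bool" where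
  "ssyt D T \<longleftrightarrow> dom T = D \<and>
     (\<forall>r c c' x y. c < c' \<and> T (r, c) = Some x \<and> T (r, c') = Some y \<longrightarrow> x \<le> y) \<and>
     (\<forall>r r' c x y. r < r' \<and> T (r, c) = Some x \<and> T (r', c) = Some y \<longrightarrow> x < y)"

definition column_entries :: "config \<Rightarrow> nat \<Rightarrow> nat set" where
  "column_entries T c = {x. \<exists>r. T (r, c) = Some x}"

definition column_length :: "config \<Rightarrow> nat \<Rightarrow> nat" where
  "column_length T c = card {r. (r, c) \<in> dom T}"

definition num_columns :: "config \<Rightarrow> nat" where
  "num_columns T = card {c. \<exists>r. (r, c) \<in> dom T}"

definition is_key_tableau :: "(nat \<Rightarrow> nat) \<Rightarrow> config \<Rightarrow> bool" where
  "is_key_tableau \<mu> K \<longleftrightarrow> ssyt (diagram \<mu>) K \<and>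
     (\<forall>c\<ge>1. column_entries K (Suc c) \<subseteq> column_entries K c)"

text \<open>The column of length \<open>j\<close> holds \<open>\<sigma> 1, \<dots>, \<sigma> j\<close>, sorted.\<close>

definition key_tableau :: "(nat \<Rightarrow> nat) \<Rightarrow> (nat \<Rightarrow> nat) \<Rightarrow> config" where
  "key_tableau \<mu> \<sigma> = (\<lambda>(r, c).
     if (r, c) \<in> diagram \<mu>
     then Some (sorted_list_of_set (\<sigma> ` {1..card {i. 1 \<le> i \<and> c \<le> \<mu> i}}) ! (r - 1))
     else None)"


section \<open>Jeu de taquin and the right key\<close>

text \<open>\<open>slides_to T b T'\<close>: sliding entries of \<open>T\<close> into the empty box \<open>b\<close>, and then into the
  successive holes, ends in \<open>T'\<close>. When the entries to the right of and below the hole are equal,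
  the lower one moves.\<close>

inductive slides_to :: "config \<Rightarrow> nat \<times> nat \<Rightarrow> config \<Rightarrow> bool" where
  stop: "\<lbrakk>T (r, Suc c) = None; T (Suc r, c) = None\<rbrakk> \<Longrightarrow> slides_to T (r, c) T"
| left: "\<lbrakk>T (r, Suc c) = Some x; \<And>y. T (Suc r, c) = Some y \<Longrightarrow> x < y;
          slides_to (T((r, c) \<mapsto> x, (r, Suc c) := None)) (r, Suc c) T'\<rbrakk>
         \<Longrightarrow> slides_to T (r, c) T'"
| up: "\<lbrakk>T (Suc r, c) = Some y; \<And>x. T (r, Suc c) = Some x \<Longrightarrow> y \<le> x;
        slides_to (T((r, c) \<mapsto> y, (Suc r, c) := None)) (Suc r, c) T'\<rbrakk>
       \<Longrightarrow> slides_to T (r, c) T'"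

definition inside_corner :: "(nat \<Rightarrow> nat) \<Rightarrow> nat \<times> nat \<Rightarrow> bool" where
  "inside_corner \<nu> b \<longleftrightarrow> (case b of (r, c) \<Rightarrow>
     (r, c) \<in> diagram \<nu> \<and> (r, Suc c) \<notin> diagram \<nu> \<and> (Suc r, c) \<notin> diagram \<nu>)"

definition jdt_slide :: "config \<Rightarrow> config \<Rightarrow> bool" where
  "jdt_slide T T' \<longleftrightarrow> (\<exists>\<kappa> \<nu> b. is_partition \<kappa> \<and> is_partition \<nu> \<and> diagram \<nu> \<subseteq> diagram \<kappa> \<and>
     ssyt (diagram \<kappa> - diagram \<nu>) T \<and> inside_corner \<nu> b \<and> slides_to T b T')"

text \<open>Outward slides are the inverses of inward slides, so they are covered by the symmetric
  closure.\<close>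

definition jdt_equiv :: "config \<Rightarrow> config \<Rightarrow> bool" where
  "jdt_equiv = equivclp jdt_slide"

text \<open>The skew shape for the \<open>j\<close>-th column of the right key: its column lengths are those of \<open>S\<close>
  with \<open>b j\<close> moved to the end, and its inner shape is a rectangle of height \<open>b j - b m\<close> and width
  \<open>m - 1\<close>, where \<open>m\<close> is the number of columns. So the last column starts in row \<open>1\<close> and the
  others start just below the rectangle.\<close>

definition right_key_shape :: "config \<Rightarrow> nat \<Rightarrow> (nat \<times> nat) set" where
  "right_key_shape S j =
     (let m = num_columns S; b = column_length S;
          d = (\<lambda>k. if k = m then b j else if k < j then b k else b (Suc k));
          off = (\<lambda>k. if k < m then b j - b m else 0)
      in {(r, k). 1 \<le> k \<and> k \<le> m \<and> off k < r \<and> r \<le> off k + d k})"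

definition right_key :: "config \<Rightarrow> config" where
  "right_key S = (\<lambda>(r, j).
     if 1 \<le> j \<and> j \<le> num_columns S
     then (THE T. ssyt (right_key_shape S j) T \<and> jdt_equiv S T) (r, num_columns S)
     else None)"


section \<open>The push-down procedure\<close>

definition row_columns :: "config \<Rightarrow> nat \<Rightarrow> nat set" where
  "row_columns T r = {c. (r, c) \<in> dom T}"

definition move_down :: "config \<Rightarrow> nat \<Rightarrow> nat \<Rightarrow> config" where
  "move_down T r c = (\<lambda>(i, k).
     if c \<le> k \<and> i = Suc r \<and> (r, k) \<in> dom T then T (r, k)
     else if c \<le> k \<and> i = r then None
     else T (i, k))"

text \<open>\<open>push T r k\<close> runs the loop with exposed entry in box \<open>(r, k)\<close> of \<open>T\<close>; it returns the final
  configuration and the box of the final exposed entry. Row \<open>0\<close> is always empty, so the loop stops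
  when it reaches row \<open>1\<close>. The boxes of a configuration need not be contiguous, so the entry
  immediately to the left of \<open>c\<close> is the nearest one, with empty boxes skipped.\<close>

fun push :: "config \<Rightarrow> nat \<Rightarrow> nat \<Rightarrow> config \<times> nat \<times> nat" where
  "push T 0 k = (T, 0, k)"
| "push T (Suc r) k =
     (let C = {c \<in> row_columns T r. the (T (Suc r, k)) \<le> the (T (r, c))} in
      if C = {} then (T, Suc r, k)
      else let c = Min C in push (move_down T r c) r (Max {k' \<in> row_columns T r. k' < c}))"

definition push_row :: "config \<Rightarrow> nat \<Rightarrow> config \<times> nat \<times> nat" where
  "push_row T i = push T i (Max (row_columns T i))"

text \<open>Here \<open>push_config S 0 = S\<close>; since \<open>push_row\<close> changes nothing in row \<open>1\<close>, also
  \<open>push_config S 1 = S\<close>, which is the initial configuration of the procedure.\<close>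

primrec push_config :: "config \<Rightarrow> nat \<Rightarrow> config" where
  "push_config S 0 = S"
| "push_config S (Suc i) = fst (push_row (push_config S i) (Suc i))"

definition exposed_value :: "config \<Rightarrow> nat \<Rightarrow> nat" where
  "exposed_value S i = the (push_config S i (snd (push_row (push_config S (i - 1)) i)))"

definition push_down_perm :: "nat \<Rightarrow> nat \<Rightarrow> config \<Rightarrow> nat \<Rightarrow> nat" where
  "push_down_perm n p S = (\<lambda>i.
     if 1 \<le> i \<and> i \<le> p then exposed_value S i
     else if p < i \<and> i \<le> n
     then sorted_list_of_set ({1..n} - exposed_value S ` {1..p}) ! (i - p - 1)
     else i)"

end

(*
  A jeu de taquin slide does not change the Knuth class of the column reading word, and the rows of
  the row insertion tableau depend only on that class. Hence the tableau T that defines the j-th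
  column of the right key of S, being a straight tableau U followed by a column C, is determined by
  the fact that row insertion of C into U gives S: C and U arise from S by reverse bumping the last
  boxes of the rows k, ..., 1, where k is the length of the j-th column. Conversely the pair so
  obtained is a tableau, which rectifies to S.

  The exposed entries of one push-down stage follow a reverse bumping path, but the entries are
  pushed down instead of being replaced. Each push-down move leaves the set of entries reverse bumped
  out of the rows k, ..., 1 unchanged. After stage k the last entries of these rows increase
  strictly, so that they form this set; on the other hand they are the values phi_1, ..., phi_k.

  The exposed values of two consecutive rows of equal length increase, so phi is increasing on the
  blocks of equal parts of mu; this characterises the element of minimal length of the coset.
*)

theory Submission
  imports Defs "HOL-Library.Multiset"
begin

section \<open>Knuth equivalence and row insertion\<close>

text \<open>The prescribed skew tableau is never reached by outward slides. A candidate is written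
  down and slid inwards to some straight tableau, and the Knuth class forces that tableau to be
  \<open>S\<close>. This needs a workable form of insertion: a weakly increasing row is a multiset,
  a column is a set, and inserting a column into a row bumps the successors of its elements in the
  union of both (\<open>succs\<close>). Row sizes tell in which rows exactly one element bumps
  nothing; there \<open>preds\<close> inverts \<open>succs\<close>, which gives existence and
  uniqueness alike. The obstacle in the second half is that push-down configurations are not
  tableaux, so insertion says nothing about them. What survives a move is the composition of the
  maps \<open>preds\<close> over the rows, which depends only on the sets of row entries. If a row
  ends below everything that arrives from lower rows, \<open>preds\<close> merely adds its last
  entry; this is why increasing row ends are themselves the reverse bumped set. The Bruhat order
  enters through length: every step raises it, and a descent inside a block can be removed within
  the coset.\<close>

definition dlist :: "nat set \<Rightarrow> nat list" where
  "dlist A = rev (sorted_list_of_set A)"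

lemma dlist_empty [simp]: "dlist {} = []"
  by (simp add: dlist_def)

lemma set_dlist [simp]: "finite A \<Longrightarrow> set (dlist A) = A"
  by (simp add: dlist_def)

lemma sorted_dlist: "finite A \<Longrightarrow> sorted_wrt (>) (dlist A)"
  by (simp add: dlist_def sorted_wrt_rev flip: strict_sorted_iff)

lemma dlist_eqI:
  assumes "sorted_wrt (>) xs" "set xs = A"
  shows "dlist A = xs"
proof -
  have "sorted_wrt (<) (rev xs)" using assms(1) by (simp add: sorted_wrt_rev)
  then have "sorted_list_of_set (set (rev xs)) = rev xs"
    using sorted_list_of_set.idem_if_sorted_distinct strict_sorted_iff by blast
  then show ?thesis using assms(2) by (simp add: dlist_def)
qed

lemma dlist_Un:
  assumes "finite A" "finite B" "\<And>a b. a \<in> A \<Longrightarrow> b \<in> B \<Longrightarrow> b < a"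
  shows "dlist (A \<union> B) = dlist A @ dlist B"
  by (rule dlist_eqI) (use assms in \<open>auto simp: sorted_wrt_append sorted_dlist\<close>)

lemma dlist_single [simp]: "dlist {x} = [x]"
  by (simp add: dlist_def)

lemma dlist_insert_less:
  assumes "finite A" "\<And>a. a \<in> A \<Longrightarrow> b < a"
  shows "dlist (insert b A) = dlist A @ [b]"
  using dlist_Un[of A "{b}"] assms by simp

lemma dlist_insert_Un:
  assumes "finite A" "finite B" "\<And>a. a \<in> A \<Longrightarrow> x < a" "\<And>b. b \<in> B \<Longrightarrow> b < x"
  shows "dlist (insert x (A \<union> B)) = dlist A @ x # dlist B"
proof (rule dlist_eqI)
  show "sorted_wrt (>) (dlist A @ x # dlist B)"
    using assms by (auto simp: sorted_wrt_append sorted_dlist dest: less_trans)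
qed (use assms in auto)

lemma length_filter_dlist:
  assumes "finite A"
  shows "length (filter P (dlist A)) = card {a \<in> A. P a}"
proof -
  have "distinct (dlist A)" by (simp add: dlist_def)
  then show ?thesis
    using assms by (metis distinct_card distinct_filter set_dlist set_filter)
qed

inductive knuth :: "nat list \<Rightarrow> nat list \<Rightarrow> bool" where
  k1: "x < y \<Longrightarrow> y \<le> z \<Longrightarrow> knuth (u @ [y, z, x] @ v) (u @ [y, x, z] @ v)"
| k2: "x \<le> y \<Longrightarrow> y < z \<Longrightarrow> knuth (u @ [x, z, y] @ v) (u @ [z, x, y] @ v)"
| refl: "knuth w w"
| sym: "knuth w w' \<Longrightarrow> knuth w' w"
| trans: "knuth w w' \<Longrightarrow> knuth w' w'' \<Longrightarrow> knuth w w''"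

lemma knuth_append: "knuth w w' \<Longrightarrow> knuth (u @ w @ v) (u @ w' @ v)"
proof (induction arbitrary: u v rule: knuth.induct)
  case (k1 x y z u' v')
  then show ?case using knuth.k1[of x y z "u @ u'" "v' @ v"] by simp
next
  case (k2 x y z u' v')
  then show ?case using knuth.k2[of x y z "u @ u'" "v' @ v"] by simp
qed (blast intro: knuth.intros)+

lemmas knuth_appendL = knuth_append[of _ _ _ "[]", simplified]
lemmas knuth_appendR = knuth_append[of _ _ "[]", simplified]

section \<open>Insertion of a word into a single row\<close>

definition bumped :: "nat multiset \<Rightarrow> nat \<Rightarrow> nat list" where
  "bumped R x = (if \<exists>y\<in>#R. x < y then [Min {y. y \<in># R \<and> x < y}] else [])"

text \<open>Rows are multisets because a weakly increasing row is determined by its entries.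
  \<open>bumped\<close> yields a list of length at most one so that the outputs of successive
  insertions concatenate to the word entering the next row.\<close>

fun rins_row :: "nat multiset \<Rightarrow> nat list \<Rightarrow> nat multiset" where
  "rins_row R [] = R"
| "rins_row R (x # w) = rins_row (add_mset x (R - mset (bumped R x))) w"

fun rins_out :: "nat multiset \<Rightarrow> nat list \<Rightarrow> nat list" where
  "rins_out R [] = []"
| "rins_out R (x # w) = bumped R x @ rins_out (add_mset x (R - mset (bumped R x))) w"

lemma rins_row_append [simp]: "rins_row R (u @ v) = rins_row (rins_row R u) v"
  by (induction u arbitrary: R) auto

lemma rins_out_append [simp]:
  "rins_out R (u @ v) = rins_out R u @ rins_out (rins_row R u) v"
  by (induction u arbitrary: R) auto

lemma bumped_None: "(\<And>u. u \<in># R \<Longrightarrow> u \<le> x) \<Longrightarrow> bumped R x = []"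
  by (force simp: bumped_def)

lemma bumped_Some:
  assumes "y \<in># R" "x < y" "\<And>u. u \<in># R \<Longrightarrow> x < u \<Longrightarrow> y \<le> u"
  shows "bumped R x = [y]"
proof -
  have "Min {y. y \<in># R \<and> x < y} = y"
    by (rule Min_eqI) (use assms in auto)
  then show ?thesis using assms by (auto simp: bumped_def)
qed

lemma bumped_cases:
  fixes R :: "nat multiset" and x :: nat
  obtains (None) "\<And>u. u \<in># R \<Longrightarrow> u \<le> x"
  | (Some) y R' where "R = add_mset y R'" "x < y" "\<And>u. u \<in># R' \<Longrightarrow> x < u \<Longrightarrow> y \<le> u"
proof (cases "\<exists>y\<in>#R. x < y")
  case True
  let ?y = "Min {y. y \<in># R \<and> x < y}"
  have "?y \<in> {y. y \<in># R \<and> x < y}" by (rule Min_in) (use True in auto)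
  moreover have "?y \<le> u" if "u \<in># R" "x < u" for u using that by (auto intro: Min_le)
  ultimately show ?thesis using Some[of ?y "R - {#?y#}"]
    by (metis (no_types, lifting) in_diffD insert_DiffM mem_Collect_eq)
next
  case False then show ?thesis using None by force
qed

text \<open>Packages one insertion: a step is proved once by \<open>bumps_Some\<close> or
  \<open>bumps_None\<close> and then rewrites both \<open>rins_row\<close> and
  \<open>rins_out\<close>.\<close>

definition bumps :: "nat multiset \<Rightarrow> nat \<Rightarrow> nat multiset \<Rightarrow> nat list \<Rightarrow> bool" where
  "bumps R x R' ys \<longleftrightarrow> bumped R x = ys \<and> add_mset x (R - mset ys) = R'"

lemma bumps_Some:
  "\<lbrakk>y \<in># R; x < y; \<And>u. u \<in># R \<Longrightarrow> x < u \<Longrightarrow> y \<le> u; R' = add_mset x (R - {#y#})\<rbrakk> \<Longrightarrow> bumps R x R' [y]"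
  using bumped_Some[of y R x] by (auto simp: bumps_def)

lemma bumps_None: "\<lbrakk>\<And>u. u \<in># R \<Longrightarrow> u \<le> x; R' = add_mset x R\<rbrakk> \<Longrightarrow> bumps R x R' []"
  using bumped_None[of R x] by (simp add: bumps_def)

lemma rins_row_bumps: "bumps R x R' ys \<Longrightarrow> rins_row R (x # w) = rins_row R' w"
  by (auto simp: bumps_def)

lemma rins_out_bumps: "bumps R x R' ys \<Longrightarrow> rins_out R (x # w) = ys @ rins_out R' w"
  by (auto simp: bumps_def)

lemmas rins_bumps = rins_row_bumps rins_out_bumps

declare rins_row.simps(2) [simp del] rins_out.simps(2) [simp del]

text \<open>The entry \<open>y\<close>, larger than \<open>x\<close>, guarantees that
  \<open>x\<close> bumps some \<open>r \<le> y\<close>, while \<open>z\<close> can only bump an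
  entry above \<open>z \<ge> y\<close>. The two insertions touch different entries and therefore
  commute; the cases record whether \<open>z\<close> bumps anything.\<close>

lemma rins_k1_aux:
  assumes "x < y" "y \<le> z"
  obtains (no_bump) r where "x < r" "r \<le> y" "rins_row (add_mset y R) [z, x] = rins_row (add_mset y R) [x, z]"
      "rins_out (add_mset y R) [z, x] = [r]" "rins_out (add_mset y R) [x, z] = [r]"
  | (bump) r q where "x < r" "r \<le> y" "z < q" "q \<in># R"
      "rins_row (add_mset y R) [z, x] = rins_row (add_mset y R) [x, z]"
      "rins_out (add_mset y R) [z, x] = [q, r]" "rins_out (add_mset y R) [x, z] = [r, q]"
proof -
  obtain r R1 where r: "add_mset y R = add_mset r R1" "x < r"
      "\<And>u. u \<in># R1 \<Longrightarrow> x < u \<Longrightarrow> r \<le> u"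
    using assms by (cases "add_mset y R" x rule: bumped_cases) (auto simp: not_le dest: leD)
  have ry: "r \<le> y" using r assms by (metis insert_noteq_member union_single_eq_member nle_le)
  show ?thesis
  proof (cases R1 z rule: bumped_cases)
    case N: None
    have 1: "bumps (add_mset r R1) z (add_mset r (add_mset z R1)) []"
      by (rule bumps_None; use N ry assms in \<open>force simp: add_mset_commute\<close>)
    have 2: "bumps (add_mset r (add_mset z R1)) x (add_mset x (add_mset z R1)) [r]"
      by (rule bumps_Some; use r ry assms in \<open>force simp: add_mset_commute\<close>)
    have 3: "bumps (add_mset r R1) x (add_mset x R1) [r]"
      by (rule bumps_Some; use r ry assms in \<open>force simp: add_mset_commute\<close>)
    have 4: "bumps (add_mset x R1) z (add_mset x (add_mset z R1)) []"
      by (rule bumps_None; use N ry assms in \<open>force simp: add_mset_commute\<close>)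
    from 1 2 3 4 show ?thesis by (intro no_bump[OF r(2) ry]) (simp_all add: r(1) rins_bumps)
  next
    case S: (Some q R2)
    have 1: "bumps (add_mset q (add_mset r R2)) z (add_mset z (add_mset r R2)) [q]"
      by (rule bumps_Some; use S ry assms in \<open>force simp: add_mset_commute\<close>)
    have 2: "bumps (add_mset r (add_mset z R2)) x (add_mset x (add_mset z R2)) [r]"
      by (rule bumps_Some; use r ry assms S in \<open>force simp: add_mset_commute\<close>)
    have 3: "bumps (add_mset r (add_mset q R2)) x (add_mset x (add_mset q R2)) [r]"
      by (rule bumps_Some; use r ry assms S in \<open>force simp: add_mset_commute\<close>)
    have 4: "bumps (add_mset q (add_mset x R2)) z (add_mset z (add_mset x R2)) [q]"
      by (rule bumps_Some; use S ry assms in \<open>force simp: add_mset_commute\<close>)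
    have "q \<in># R" using S ry assms r(1)
      by (metis add_mset_commute insert_noteq_member leD le_less_trans union_single_eq_member)
    then show ?thesis
      using bump[OF r(2) ry S(2)] 1 2 3 4 r(1) S(1)
      by (simp add: rins_bumps add_mset_commute)
  qed
qed

text \<open>If \<open>y\<close> bumps \<open>p\<close>, then \<open>r \<le> y < p \<le> q\<close>,
  so the outputs \<open>p q r\<close> and \<open>p r q\<close> are again related by the first Knuth
  relation. If \<open>y\<close> bumps nothing, no entry exceeds \<open>z\<close> either and the
  outputs coincide.\<close>

lemma rins_k1:
  assumes "x < y" "y \<le> z"
  shows "rins_row R [y, z, x] = rins_row R [y, x, z] \<and>
    knuth (rins_out R [y, z, x]) (rins_out R [y, x, z])"
proof (cases R y rule: bumped_cases)
  case N: None
  show ?thesis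
  proof (cases rule: rins_k1_aux[OF assms, of R, case_names no_bump bump])
    case no_bump
    moreover have "bumps R y (add_mset y R) []" by (intro bumps_None N HOL.refl)
    ultimately show ?thesis by (simp add: rins_bumps knuth.refl)
  next
    case bump
    then show ?thesis using N assms by force
  qed
next
  case S: (Some p R')
  have e: "bumps (add_mset p R') y (add_mset y R') [p]" by (rule bumps_Some; use S in force)
  show ?thesis
  proof (cases rule: rins_k1_aux[OF assms, of R', case_names no_bump bump])
    case no_bump
    then show ?thesis using S(1) e by (simp add: rins_bumps knuth.refl)
  next
    case (bump r q)
    then have "p \<le> q" using S(3) assms by auto
    then have "knuth [p, q, r] [p, r, q]" using knuth.k1[of r p q "[]" "[]"] bump S(2) by auto
    then show ?thesis using bump S(1) e by (simp add: rins_bumps)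
  qed
qed

text \<open>The split is on the entry \<open>p\<close> bumped by \<open>x\<close>. If
  \<open>p \<le> z\<close>, inserting \<open>z\<close> beforehand leaves \<open>p\<close> for
  \<open>x\<close>. If \<open>z < p\<close>, then \<open>z\<close> inserted first bumps
  \<open>p\<close> and \<open>x\<close> bumps \<open>z\<close>; here the second Knuth relation on
  the input turns into the first one on the output.\<close>

lemma rins_k2:
  assumes "x \<le> y" "y < z"
  shows "rins_row R [x, z, y] = rins_row R [z, x, y] \<and>
    knuth (rins_out R [x, z, y]) (rins_out R [z, x, y])"
proof (cases R x rule: bumped_cases)
  case N: None
  have 1: "bumps R x (add_mset x R) []"
    by (rule bumps_None; use N in \<open>force simp: add_mset_commute\<close>)
  have 2: "bumps (add_mset x R) z (add_mset z (add_mset x R)) []"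
    by (rule bumps_None; use N assms in \<open>force simp: add_mset_commute\<close>)
  have 3: "bumps (add_mset z (add_mset x R)) y (add_mset y (add_mset x R)) [z]"
    by (rule bumps_Some; use N assms in \<open>force simp: add_mset_commute\<close>)
  have 4: "bumps R z (add_mset z R) []"
    by (rule bumps_None; use N assms in \<open>force simp: add_mset_commute\<close>)
  have 5: "bumps (add_mset z R) x (add_mset x R) [z]"
    by (rule bumps_Some; use N assms in \<open>force simp: add_mset_commute\<close>)
  have 6: "bumps (add_mset x R) y (add_mset y (add_mset x R)) []"
    by (rule bumps_None; use N assms in \<open>force simp: add_mset_commute\<close>)
  from 1 2 3 4 5 6 show ?thesis by (simp add: rins_bumps knuth.refl)
next
  case S: (Some p R1)
  have 1: "bumps (add_mset p R1) x (add_mset x R1) [p]"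
    by (rule bumps_Some; use S in \<open>force simp: add_mset_commute\<close>)
  show ?thesis
  proof (cases "p \<le> z")
    case pz: True
    have 3: "bumps (add_mset z (add_mset x Q)) y (add_mset y (add_mset x Q')) [s]"
      if "add_mset z Q = add_mset s Q'" "y < s" "\<And>u. u \<in># Q' \<Longrightarrow> y < u \<Longrightarrow> s \<le> u" for Q s Q'
    proof -
      have e: "add_mset z (add_mset x Q) = add_mset s (add_mset x Q')" using that(1) by (metis add_mset_commute)
      show ?thesis unfolding e by (rule bumps_Some; use that assms in force)
    qed
    show ?thesis
    proof (cases R1 z rule: bumped_cases)
      case N: None
      obtain s Q' where s: "add_mset z R1 = add_mset s Q'" "y < s" "\<And>u. u \<in># Q' \<Longrightarrow> y < u \<Longrightarrow> s \<le> u"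
        using assms by (cases "add_mset z R1" y rule: bumped_cases) (auto simp: not_le dest: leD)
      have 2: "bumps (add_mset x R1) z (add_mset z (add_mset x R1)) []"
        by (rule bumps_None; use N assms in \<open>force simp: add_mset_commute\<close>)
      have 4: "bumps (add_mset p R1) z (add_mset p (add_mset z R1)) []"
        by (rule bumps_None; use N assms pz in \<open>force simp: add_mset_commute\<close>)
      have 5: "bumps (add_mset p (add_mset z R1)) x (add_mset z (add_mset x R1)) [p]"
        by (rule bumps_Some; use S pz in \<open>force simp: add_mset_commute\<close>)
      from 1 2 3[OF s] 4 5 show ?thesis unfolding S(1) by (simp add: rins_bumps knuth.refl)
    next
      case S2: (Some q R2)
      obtain s Q' where s: "add_mset z R2 = add_mset s Q'" "y < s" "\<And>u. u \<in># Q' \<Longrightarrow> y < u \<Longrightarrow> s \<le> u"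
        using assms by (cases "add_mset z R2" y rule: bumped_cases) (auto simp: not_le dest: leD)
      have sz: "s \<le> z" using s assms by (metis insert_noteq_member union_single_eq_member nle_le)
      have "s \<in># add_mset z R2" using s(1) by simp
      then have ps: "p \<le> s" using S(3)[of s] s(2) assms pz S2(1) by auto
      have 2: "bumps (add_mset x R1) z (add_mset z (add_mset x R2)) [q]"
        by (rule bumps_Some; use S2 assms in \<open>force simp: add_mset_commute\<close>)
      have 4: "bumps (add_mset p R1) z (add_mset z (add_mset p R2)) [q]"
        by (rule bumps_Some; use S2 assms pz in \<open>force simp: add_mset_commute\<close>)
      have 5: "bumps (add_mset z (add_mset p R2)) x (add_mset z (add_mset x R2)) [p]"
        by (rule bumps_Some; use S pz S2(1) in \<open>force simp: add_mset_commute\<close>)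
      have "knuth [p, q, s] [q, p, s]" using knuth.k2[of p s q "[]" "[]"] ps sz S2 by auto
      with 1 2 3[OF s] 4 5 show ?thesis unfolding S(1) by (simp add: rins_bumps)
    qed
  next
    case pz: False
    have 4: "bumps (add_mset p R1) z (add_mset z R1) [p]"
      by (rule bumps_Some; use S pz assms in \<open>force simp: add_mset_commute\<close>)
    have 5: "bumps (add_mset z R1) x (add_mset x R1) [z]"
      by (rule bumps_Some; use S pz assms in \<open>force simp: add_mset_commute\<close>)
    show ?thesis
    proof (cases R1 z rule: bumped_cases)
      case N: None
      have 2: "bumps (add_mset x R1) z (add_mset z (add_mset x R1)) []"
        by (rule bumps_None; use N assms in \<open>force simp: add_mset_commute\<close>)
      have le: "u \<le> x" if "u \<in># R1" for u using S(3)[of u] N[of u] that pz by force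
      have 3: "bumps (add_mset z (add_mset x R1)) y (add_mset y (add_mset x R1)) [z]"
        by (rule bumps_Some; use le assms in \<open>force simp: add_mset_commute\<close>)
      have 6: "bumps (add_mset x R1) y (add_mset y (add_mset x R1)) []"
        by (rule bumps_None; use le assms in \<open>force simp: add_mset_commute\<close>)
      from 1 2 3 4 5 6 show ?thesis unfolding S(1) by (simp add: rins_bumps knuth.refl)
    next
      case S2: (Some q R2)
      have le: "u \<le> x \<or> z < u" if "u \<in># R1" for u using S(3)[of u] that pz by force
      have 2: "bumps (add_mset x R1) z (add_mset z (add_mset x R2)) [q]"
        by (rule bumps_Some; use S2 assms in \<open>force simp: add_mset_commute\<close>)
      have 3: "bumps (add_mset z (add_mset x R2)) y (add_mset y (add_mset x R2)) [z]"
        by (rule bumps_Some; use le S2(1) assms in \<open>force simp: add_mset_commute\<close>)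
      have 6: "bumps (add_mset x R1) y (add_mset y (add_mset x R2)) [q]"
        by (rule bumps_Some; use S2 le assms in \<open>force simp: add_mset_commute\<close>)
      have "knuth [p, q, z] [p, z, q]"
        using knuth.k1[of z p q "[]" "[]"] S(3)[of q] S2 pz assms by auto
      with 1 2 3 4 5 6 show ?thesis unfolding S(1) by (simp add: rins_bumps)
    qed
  qed
qed

text \<open>Equality of the rows alone would not iterate: the equivalence of the outputs is the
  hypothesis for the next row.\<close>

lemma rins_knuth:
  "knuth w w' \<Longrightarrow> rins_row R w = rins_row R w' \<and> knuth (rins_out R w) (rins_out R w')"
proof (induction arbitrary: R rule: knuth.induct)
  case (k1 x y z u v)
  then show ?case using rins_k1[OF k1, of "rins_row R u"]
    by (auto simp: simp del: append_Cons intro!: knuth_append)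
next
  case (k2 x y z u v)
  then show ?case using rins_k2[OF k2, of "rins_row R u"]
    by (auto simp: simp del: append_Cons intro!: knuth_append)
qed (auto intro: knuth.intros)

text \<open>Row \<open>Suc i\<close> of the insertion tableau of \<open>w\<close>.\<close>

definition prow :: "nat \<Rightarrow> nat list \<Rightarrow> nat multiset" where
  "prow i w = rins_row {#} ((rins_out {#} ^^ i) w)"

lemma prow_0: "prow 0 w = rins_row {#} w"
  by (simp add: prow_def)

lemma prow_Suc: "prow (Suc i) w = prow i (rins_out {#} w)"
  by (simp add: prow_def funpow_swap1)

lemma prow_knuth: "knuth w w' \<Longrightarrow> prow i w = prow i w'"
  by (induction i arbitrary: w w') (auto simp: prow_0 prow_Suc dest: rins_knuth)

section \<open>Jeu de taquin preserves the Knuth class\<close>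

definition dominated :: "nat list \<Rightarrow> nat list \<Rightarrow> bool" where
  "dominated xs ys \<longleftrightarrow> (\<forall>z. length (filter ((\<le>) z) xs) \<le> length (filter ((\<le>) z) ys))"

text \<open>For decreasing lists, both notions say that \<open>ys\<close> is at least as long as
  \<open>xs\<close> and compare entries rank by rank: \<open>dominated\<close> bounds the i-th
  largest entry of \<open>xs\<close> by that of \<open>ys\<close>, and \<open>codominated\<close>
  bounds the i-th smallest entry of \<open>ys\<close> by that of \<open>xs\<close>.\<close>

definition codominated :: "nat list \<Rightarrow> nat list \<Rightarrow> bool" where
  "codominated xs ys \<longleftrightarrow> (\<forall>z. length (filter (\<lambda>a. a \<le> z) xs) \<le> length (filter (\<lambda>a. a \<le> z) ys))"

lemma dominated_append: "dominated xs ys \<Longrightarrow> dominated xs (ds @ ys)"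
  unfolding dominated_def by (metis filter_append length_append trans_le_add2)

lemma dominated_Cons: "dominated xs ys \<Longrightarrow> dominated xs (d # ys)"
  using dominated_append[of xs ys "[d]"] by simp

lemma codominated_snoc: "codominated xs ys \<Longrightarrow> codominated xs (ys @ [d])"
  unfolding codominated_def by (metis filter_append length_append trans_le_add1)

lemma dominated_ConsE:
  assumes d: "dominated (a # xs) ys" and s: "sorted_wrt (>) (a # xs)" "sorted_wrt (>) ys"
  obtains g ys' where "ys = g # ys'" "a \<le> g" "dominated xs ys'"
proof -
  have "length (filter ((\<le>) a) ys) > 0"
    using d[unfolded dominated_def, rule_format, of a] by (cases "filter ((\<le>) a) ys") simp_all
  then obtain y where y: "y \<in> set ys" "a \<le> y" by (auto simp: filter_empty_conv)
  then obtain g ys' where g: "ys = g # ys'" by (cases ys) auto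
  have ag: "a \<le> g" using y g s(2) by auto
  have "dominated xs ys'" unfolding dominated_def
  proof
    fix z
    show "length (filter ((\<le>) z) xs) \<le> length (filter ((\<le>) z) ys')"
    proof (cases "z \<le> a")
      case True
      then show ?thesis using d[unfolded dominated_def, rule_format, of z] g ag by simp
    next
      case False
      then have "filter ((\<le>) z) xs = []" using s(1) by (auto simp: filter_empty_conv)
      then show ?thesis by simp
    qed
  qed
  with g ag that show ?thesis by blast
qed

lemma codominated_snocE:
  assumes d: "codominated (xs @ [a]) ys" and s: "sorted_wrt (>) (xs @ [a])" "sorted_wrt (>) ys"
  obtains g ys' where "ys = ys' @ [g]" "g \<le> a" "codominated xs ys'"
proof -
  have "length (filter (\<lambda>v. v \<le> a) ys) > 0"
    using d[unfolded codominated_def, rule_format, of a]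
    by (cases "filter (\<lambda>v. v \<le> a) ys") simp_all
  then obtain y where y: "y \<in> set ys" "y \<le> a" by (auto simp: filter_empty_conv)
  then obtain g ys' where g: "ys = ys' @ [g]" by (cases ys rule: rev_cases) auto
  have ag: "g \<le> a" using y g s(2) by (auto simp: sorted_wrt_append)
  have "codominated xs ys'" unfolding codominated_def
  proof
    fix z
    show "length (filter (\<lambda>v. v \<le> z) xs) \<le> length (filter (\<lambda>v. v \<le> z) ys')"
    proof (cases "a \<le> z")
      case True
      then show ?thesis using d[unfolded codominated_def, rule_format, of z] g ag by simp
    next
      case False
      then have "filter (\<lambda>v. v \<le> z) xs = []"
        using s(1) by (force simp: filter_empty_conv sorted_wrt_append)
      then show ?thesis by simp
    qed
  qed
  with g ag that show ?thesis by blast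
qed

text \<open>Dominance gives the head \<open>a\<close> a partner \<open>g\<close> with
  \<open>a \<le> g < x\<close>. Once \<open>g\<close> has been brought next to \<open>x\<close>, the
  second Knuth relation carries \<open>x\<close> past \<open>a\<close>, and \<open>g\<close> is put
  back.\<close>

lemma knuth_top:
  assumes "sorted_wrt (>) as" "sorted_wrt (>) (x # gs)" "dominated as gs"
  shows "knuth (as @ x # gs) (x # as @ gs)"
  using assms
proof (induction as arbitrary: x gs)
  case Nil
  then show ?case by (simp add: knuth.refl)
next
  case (Cons a as)
  obtain g gs' where g: "gs = g # gs'" "a \<le> g" "dominated as gs'"
    using dominated_ConsE[OF Cons.prems(3,1)] Cons.prems(2) by auto
  have gx: "g < x" using Cons.prems g by simp
  have 1: "knuth (a # as @ x # gs) (a # x # as @ g # gs')"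
    using knuth_appendL[OF Cons.IH[of x gs], of "[a]"] Cons.prems g by (simp add: dominated_Cons)
  have 2: "knuth (as @ g # gs') (g # as @ gs')"
    by (rule Cons.IH) (use Cons.prems g in auto)
  have 3: "knuth (a # x # as @ g # gs') (a # x # g # as @ gs')"
    using knuth_appendL[OF 2, of "[a, x]"] by simp
  have 4: "knuth (a # x # g # as @ gs') (x # a # g # as @ gs')"
    using knuth.k2[OF g(2) gx, of "[]"] by simp
  have 5: "knuth (x # a # g # as @ gs') (x # a # as @ g # gs')"
    using knuth_appendL[OF 2[THEN knuth.sym], of "[x, a]"] by simp
  show ?case using 1 3 4 5 by (auto simp: g intro: knuth.trans)
qed

lemma knuth_top_list:
  assumes "sorted_wrt (>) as" "sorted_wrt (>) (ds @ gs)" "dominated as gs"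
  shows "knuth (as @ ds @ gs) (ds @ as @ gs)"
  using assms
proof (induction ds)
  case Nil
  then show ?case by (simp add: knuth.refl)
next
  case (Cons d ds)
  have "knuth (as @ d # ds @ gs) (d # as @ ds @ gs)"
    by (rule knuth_top) (use Cons.prems dominated_append in auto)
  moreover have "knuth (d # as @ ds @ gs) (d # ds @ as @ gs)"
    using knuth_appendL[OF Cons.IH, of "[d]"] Cons.prems by simp
  ultimately show ?case by (auto intro: knuth.trans)
qed

text \<open>The mirror image of \<open>knuth_top\<close>: the last entry \<open>d\<close> has a
  partner \<open>b\<close> with \<open>x < b \<le> d\<close>, and the first Knuth relation exchanges
  \<open>d\<close> and \<open>x\<close>.\<close>

lemma knuth_bottom:
  assumes "sorted_wrt (>) (bs @ [x])" "sorted_wrt (>) ds" "codominated ds bs"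
  shows "knuth (bs @ ds @ [x]) (bs @ x # ds)"
  using assms
proof (induction ds arbitrary: x bs rule: rev_induct)
  case Nil
  then show ?case by (simp add: knuth.refl)
next
  case (snoc d ds)
  obtain b bs' where b: "bs = bs' @ [b]" "b \<le> d" "codominated ds bs'"
    by (rule codominated_snocE[OF snoc.prems(3,2)]) (use snoc.prems(1) in \<open>auto simp: sorted_wrt_append\<close>)
  have xb: "x < b" using snoc.prems b by (simp add: sorted_wrt_append)
  have 2: "knuth (bs' @ ds @ [b]) (bs' @ b # ds)"
    by (rule snoc.IH) (use snoc.prems b in \<open>auto simp: sorted_wrt_append\<close>)
  have 1: "knuth (bs' @ b # ds @ [d, x]) (bs' @ ds @ [b, d, x])"
    using knuth_appendR[OF 2[THEN knuth.sym], of "[d, x]"] by simp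
  have 3: "knuth (bs' @ ds @ [b, d, x]) (bs' @ ds @ [b, x, d])"
    using knuth.k1[OF xb b(2), of "bs' @ ds" "[]"] by simp
  have 4: "knuth (bs' @ ds @ [b, x, d]) (bs' @ b # ds @ [x, d])"
    using knuth_appendR[OF 2, of "[x, d]"] by simp
  have 5: "knuth ((bs' @ [b]) @ ds @ [x]) ((bs' @ [b]) @ x # ds)"
    by (rule snoc.IH) (use snoc.prems b in \<open>auto simp: sorted_wrt_append codominated_snoc\<close>)
  have 6: "knuth (bs' @ b # ds @ [x, d]) (bs' @ b # x # ds @ [d])"
    using knuth_appendR[OF 5, of "[d]"] by simp
  show ?case using 1 3 4 6 by (auto simp: b intro: knuth.trans)
qed

text \<open>Two adjacent columns, each read upwards, before and after the entry \<open>x\<close> of the right one moves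
  left into the hole; \<open>as\<close> and \<open>bs\<close> are the entries above and below the hole.\<close>

lemma knuth_column_slide:
  assumes "sorted_wrt (>) (bs @ x # as)" "sorted_wrt (>) (ds @ x # gs)"
    and "dominated as gs" "codominated ds bs"
  shows "knuth (bs @ as @ ds @ x # gs) (bs @ x # as @ ds @ gs)"
proof -
  \<comment> \<open>The route: \<open>as\<close> moves right past \<open>ds @ [x]\<close>, then
    \<open>x\<close> moves left past \<open>ds\<close>, then \<open>as\<close> moves back left past
    \<open>ds\<close>.\<close>
  have "knuth (as @ (ds @ [x]) @ gs) ((ds @ [x]) @ as @ gs)"
    by (rule knuth_top_list) (use assms in \<open>auto simp: sorted_wrt_append\<close>)
  from knuth_appendL[OF this, of bs]
  have 1: "knuth (bs @ as @ ds @ x # gs) (bs @ ds @ x # as @ gs)" by simp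
  have "knuth (bs @ ds @ [x]) (bs @ x # ds)"
    by (rule knuth_bottom) (use assms in \<open>auto simp: sorted_wrt_append\<close>)
  from knuth_appendR[OF this, of "as @ gs"]
  have 2: "knuth (bs @ ds @ x # as @ gs) (bs @ x # ds @ as @ gs)" by simp
  have "knuth (as @ ds @ gs) (ds @ as @ gs)"
    by (rule knuth_top_list) (use assms in \<open>auto simp: sorted_wrt_append\<close>)
  from knuth_appendL[OF knuth.sym[OF this], of "bs @ [x]"]
  have 3: "knuth (bs @ x # ds @ as @ gs) (bs @ x # as @ ds @ gs)" by simp
  from 1 2 3 show ?thesis by (blast intro: knuth.trans)
qed

text \<open>Columns are read from left to right, each from bottom to top. For a tableau,
  \<open>N\<close> only has to exceed the last column: column 0 and all columns beyond the shape are
  empty.\<close>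

definition word :: "nat \<Rightarrow> config \<Rightarrow> nat list" where
  "word N T = concat (map (\<lambda>c. dlist (column_entries T c)) [0..<N])"

lemma word_Suc: "word (Suc N) T = word N T @ dlist (column_entries T N)"
  by (simp add: word_def)

lemma word_cong:
  "(\<And>c. c < N \<Longrightarrow> column_entries T c = column_entries T' c) \<Longrightarrow> word N T = word N T'"
  unfolding word_def by (intro arg_cong[of _ _ concat] map_cong) auto

lemma word_knuth_two_columns:
  assumes "\<And>k. k \<noteq> c \<Longrightarrow> k \<noteq> Suc c \<Longrightarrow> column_entries T k = column_entries T' k"
    and "Suc c < N"
    and k: "knuth (dlist (column_entries T c) @ dlist (column_entries T (Suc c)))
               (dlist (column_entries T' c) @ dlist (column_entries T' (Suc c)))"
  shows "knuth (word N T) (word N T')"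
proof -
  have sp: "[0..<N] = [0..<c] @ [c, Suc c] @ [Suc (Suc c)..<N]"
    using assms(2) by (metis Suc_leI Suc_lessD append_Cons append_Nil less_imp_le upt_add_eq_append
        upt_conv_Cons zero_le add_diff_inverse_nat not_less)
  have m: "map (\<lambda>c. dlist (column_entries T c)) ks = map (\<lambda>c. dlist (column_entries T' c)) ks"
    if "c \<notin> set ks" "Suc c \<notin> set ks" for ks
    using that assms(1) by (intro map_cong) metis+
  have m1: "map (\<lambda>c. dlist (column_entries T c)) [0..<c] = map (\<lambda>c. dlist (column_entries T' c)) [0..<c]"
    by (rule m) auto
  have m2: "map (\<lambda>c. dlist (column_entries T c)) [Suc (Suc c)..<N] =
      map (\<lambda>c. dlist (column_entries T' c)) [Suc (Suc c)..<N]"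
    by (rule m) auto
  show ?thesis unfolding word_def sp map_append concat_append m1 m2
    by (rule knuth_append) (use k in simp)
qed

section \<open>Skew shapes and the invariant of a slide in progress\<close>

lemma is_partition_mono: "is_partition \<mu> \<Longrightarrow> 1 \<le> i \<Longrightarrow> i \<le> j \<Longrightarrow> \<mu> j \<le> \<mu> i"
  by (auto simp: is_partition_def)

lemma finite_diagram:
  assumes "is_partition \<mu>" shows "finite (diagram \<mu>)"
proof (rule finite_subset)
  show "diagram \<mu> \<subseteq> {i. 1 \<le> i \<and> \<mu> i \<noteq> 0} \<times> {..\<mu> 1}"
  proof
    fix b assume "b \<in> diagram \<mu>"
    then obtain r c where b: "b = (r, c)" "1 \<le> r" "1 \<le> c" "c \<le> \<mu> r" by (auto simp: diagram_def)
    then show "b \<in> {i. 1 \<le> i \<and> \<mu> i \<noteq> 0} \<times> {..\<mu> 1}"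
      using is_partition_mono[OF assms, of 1 r] by auto
  qed
  show "finite ({i. 1 \<le> i \<and> \<mu> i \<noteq> 0} \<times> {..\<mu> 1})"
    using assms by (auto simp: is_partition_def)
qed

lemma remove_corner:
  assumes "is_partition \<mu>" "(r, c) \<in> diagram \<mu>" "(r, Suc c) \<notin> diagram \<mu>" "(Suc r, c) \<notin> diagram \<mu>"
  shows "is_partition (\<mu>(r := c - 1))" "diagram (\<mu>(r := c - 1)) = diagram \<mu> - {(r, c)}"
proof -
  have r: "1 \<le> r" "1 \<le> c" "\<mu> r = c" "\<mu> (Suc r) < c" using assms(2-4) by (auto simp: diagram_def)
  then show "diagram (\<mu>(r := c - 1)) = diagram \<mu> - {(r, c)}"
    by (auto simp: diagram_def split: if_splits)
  have "\<mu> j \<le> c - 1" if "r < j" for j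
    using is_partition_mono[OF assms(1), of "Suc r" j] r that by simp
  moreover have "finite {i. 1 \<le> i \<and> (\<mu>(r := c - 1)) i \<noteq> 0}"
    by (rule finite_subset[of _ "{i. 1 \<le> i \<and> \<mu> i \<noteq> 0}"])
      (use assms r in \<open>auto simp: is_partition_def\<close>)
  moreover have "(\<mu>(r := c - 1)) j \<le> (\<mu>(r := c - 1)) i" if "1 \<le> i" "i \<le> j" for i j
    using is_partition_mono[OF assms(1) that] calculation(1)[of j] that r by auto
  ultimately show "is_partition (\<mu>(r := c - 1))" unfolding is_partition_def by blast
qed

definition skew :: "(nat \<Rightarrow> nat) \<Rightarrow> (nat \<Rightarrow> nat) \<Rightarrow> bool" where
  "skew \<kappa> \<nu> \<longleftrightarrow> is_partition \<kappa> \<and> is_partition \<nu> \<and> diagram \<nu> \<subseteq> diagram \<kappa>"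

lemma ssyt_row: "ssyt D T \<Longrightarrow> T (r, c) = Some x \<Longrightarrow> T (r, c') = Some y \<Longrightarrow> c \<le> c' \<Longrightarrow> x \<le> y"
  unfolding ssyt_def by (cases "c = c'", simp) (meson le_neq_implies_less)

lemma ssyt_col: "ssyt D T \<Longrightarrow> T (r, c) = Some x \<Longrightarrow> T (r', c) = Some y \<Longrightarrow> r < r' \<Longrightarrow> x < y"
  unfolding ssyt_def by blast

lemma ssyt_fill:
  assumes s: "ssyt (dom T) T"
    and "\<And>k a. k < c \<Longrightarrow> T (r, k) = Some a \<Longrightarrow> a \<le> x"
    and "\<And>k a. c < k \<Longrightarrow> T (r, k) = Some a \<Longrightarrow> x \<le> a"
    and "\<And>i a. i < r \<Longrightarrow> T (i, c) = Some a \<Longrightarrow> a < x"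
    and "\<And>i a. r < i \<Longrightarrow> T (i, c) = Some a \<Longrightarrow> x < a"
  shows "ssyt (dom (T((r, c) \<mapsto> x))) (T((r, c) \<mapsto> x))"
  unfolding ssyt_def
proof (intro conjI allI impI, goal_cases)
  case (2 i k k' a b)
  then show ?case
    using assms(2)[of k a] assms(3)[of k' b] ssyt_row[OF s, of i k a k' b] by (auto split: if_splits)
next
  case (3 i j k a b)
  then show ?case
    using assms(4)[of i a] assms(5)[of j b] ssyt_col[OF s, of i k a j b] by (auto split: if_splits)
qed simp

lemma ssyt_remove: "ssyt (dom T) T \<Longrightarrow> ssyt (dom (T(p := None))) (T(p := None))"
  unfolding ssyt_def by (simp split: if_splits)

text \<open>Holds throughout a slide: the filled boxes and the hole together form a skew shape. The
  inner shape \<open>\<nu>\<close> has already lost the corner at which the slide began.\<close>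

definition with_hole :: "(nat \<Rightarrow> nat) \<Rightarrow> (nat \<Rightarrow> nat) \<Rightarrow> config \<Rightarrow> nat \<times> nat \<Rightarrow> bool" where
  "with_hole \<kappa> \<nu> T b \<longleftrightarrow> skew \<kappa> \<nu> \<and> ssyt (dom T) T \<and> b \<notin> dom T \<and>
     insert b (dom T) = diagram \<kappa> - diagram \<nu>"

lemma with_hole_dom:
  "with_hole \<kappa> \<nu> T b \<Longrightarrow> p \<in> dom T \<longleftrightarrow> p \<in> diagram \<kappa> \<and> p \<notin> diagram \<nu> \<and> p \<noteq> b"
  unfolding with_hole_def by blast

lemma diagram_iff: "(r, c) \<in> diagram \<mu> \<longleftrightarrow> 1 \<le> r \<and> 1 \<le> c \<and> c \<le> \<mu> r"
  by (simp add: diagram_def)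

lemma diagram_mono:
  assumes "is_partition \<mu>" "(r, c) \<in> diagram \<mu>" "1 \<le> r'" "r' \<le> r" "1 \<le> c'" "c' \<le> c"
  shows "(r', c') \<in> diagram \<mu>"
  using is_partition_mono[OF assms(1,3,4)] assms by (simp add: diagram_iff)

text \<open>Two neighbour facts drive the proof. Since the shape is skew, each entry above the hole
  has a right neighbour (\<open>up\<close>), and each entry of the right column below the hole's row
  has a left neighbour (\<open>dn\<close>). They yield the two dominance conditions of
  \<open>knuth_column_slide\<close>, and \<open>up\<close> also shows that \<open>x\<close> exceeds
  everything above the hole.\<close>

lemma with_hole_left:
  assumes h: "with_hole \<kappa> \<nu> T (r, c)"
    and x: "T (r, Suc c) = Some x" and y: "\<And>y. T (Suc r, c) = Some y \<Longrightarrow> x < y"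
  defines "T' \<equiv> T((r, c) \<mapsto> x, (r, Suc c) := None)"
  shows "with_hole \<kappa> \<nu> T' (r, Suc c)"
    and "diagram \<kappa> \<subseteq> UNIV \<times> {..<N} \<Longrightarrow> knuth (word N T) (word N T')"
proof -
  have p: "is_partition \<kappa>" "is_partition \<nu>" and s: "ssyt (dom T) T"
    using h unfolding with_hole_def skew_def by blast+
  note d = with_hole_dom[OF h]
  have rc: "(r, c) \<in> diagram \<kappa>" "(r, c) \<notin> diagram \<nu>"
    using h unfolding with_hole_def by blast+
  have xd: "(r, Suc c) \<in> diagram \<kappa>" "(r, Suc c) \<notin> diagram \<nu>" using d[of "(r, Suc c)"] x by auto
  have cl: "1 \<le> r" "1 \<le> c" using rc by (auto simp: diagram_iff)
  have up: "\<exists>b. T (i, Suc c) = Some b \<and> a \<le> b" if "i < r" "T (i, c) = Some a" for i a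
  proof -
    have "(i, c) \<in> diagram \<kappa>" "(i, c) \<notin> diagram \<nu>" using d[of "(i, c)"] that by auto
    moreover from this have "1 \<le> i" by (simp add: diagram_iff)
    then have "(i, Suc c) \<in> diagram \<kappa>"
      using that diagram_mono[OF p(1) xd(1), of i "Suc c"] by auto
    ultimately have "(i, Suc c) \<in> dom T" unfolding d by (auto simp: diagram_iff)
    then obtain b where "T (i, Suc c) = Some b" by auto
    then show ?thesis using ssyt_row[OF s that(2)] by auto
  qed
  have dn: "\<exists>b. T (i, c) = Some b \<and> b \<le> a" if "r < i" "T (i, Suc c) = Some a" for i a
  proof -
    have "(i, Suc c) \<in> diagram \<kappa>" "(i, Suc c) \<notin> diagram \<nu>" using d[of "(i, Suc c)"] that by auto
    moreover from this have "(i, c) \<notin> diagram \<nu>"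
      using that cl rc(2) diagram_mono[OF p(2), of i c r c] by auto
    ultimately have "(i, c) \<in> dom T" unfolding d using cl that by (auto simp: diagram_iff)
    then obtain b where "T (i, c) = Some b" by auto
    then show ?thesis using ssyt_row[OF s _ that(2)] by auto
  qed
  have ux: "a < x" if "i < r" "T (i, c) = Some a" for i a
    using up[OF that] ssyt_col[OF s _ x that(1)] by (meson le_less_trans)
  have bx: "x < a" if "r < i" "T (i, c) = Some a" for i a
  proof -
    have "(i, c) \<in> diagram \<kappa>" "(i, c) \<notin> diagram \<nu>" using d[of "(i, c)"] that by auto
    moreover from this have "(Suc r, c) \<in> diagram \<kappa>"
      using that cl diagram_mono[OF p(1), of i c "Suc r" c] by auto
    moreover have "(Suc r, c) \<notin> diagram \<nu>"
      using cl rc(2) diagram_mono[OF p(2), of "Suc r" c r c] by auto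
    ultimately have "(Suc r, c) \<in> dom T" unfolding d by auto
    then obtain b where b: "T (Suc r, c) = Some b" by auto
    then have "x < b" using y by blast
    moreover have "b \<le> a" using b that ssyt_col[OF s b that(2)] by (cases "i = Suc r") auto
    ultimately show ?thesis by simp
  qed
  show "with_hole \<kappa> \<nu> T' (r, Suc c)"
  proof -
    have "insert (r, Suc c) (dom T') = insert (r, c) (dom T)" using x by (auto simp: T'_def)
    moreover have "(r, Suc c) \<notin> dom T'" by (simp add: T'_def)
    moreover have "ssyt (dom (T((r, c) \<mapsto> x))) (T((r, c) \<mapsto> x))"
      using s ux bx ssyt_row[OF s _ x] ssyt_row[OF s x] by (intro ssyt_fill) (auto simp: Suc_le_eq)
    then have "ssyt (dom T') T'" unfolding T'_def by (rule ssyt_remove)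
    ultimately show ?thesis using h unfolding with_hole_def by simp
  qed
  assume N: "diagram \<kappa> \<subseteq> UNIV \<times> {..<N}"
  define As where "As = {a. \<exists>i<r. T (i, c) = Some a}"
  define Bs where "Bs = {a. \<exists>i>r. T (i, c) = Some a}"
  define Gs where "Gs = {a. \<exists>i<r. T (i, Suc c) = Some a}"
  define Ds where "Ds = {a. \<exists>i>r. T (i, Suc c) = Some a}"
  have fd: "finite (dom T)" using h finite_diagram[OF p(1)]
    by (metis finite_Diff finite_insert with_hole_def)
  then have "finite (ran T)" by (rule finite_ran)
  then have fin: "finite As" "finite Bs" "finite Gs" "finite Ds"
    by (rule finite_subset[rotated]; auto simp: As_def Bs_def Gs_def Ds_def ran_def)+
  have "T (r, c) = None" using h unfolding with_hole_def by blast
  have gx: "a < x" if "a \<in> Gs" for a using that ssyt_col[OF s _ x] by (auto simp: Gs_def)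
  have dx: "x < a" if "a \<in> Ds" for a using that ssyt_col[OF s x] by (auto simp: Ds_def)
  have ux': "a < x" if "a \<in> As" for a using that ux by (auto simp: As_def)
  have bx': "x < a" if "a \<in> Bs" for a using that bx by (auto simp: Bs_def)
  have cases: "(\<exists>i. P i) \<longleftrightarrow> P r \<or> (\<exists>i>r. P i) \<or> (\<exists>i<r. P i)" for P
    by (metis linorder_neqE_nat)
  have "column_entries T c = Bs \<union> As" unfolding column_entries_def As_def Bs_def
    using \<open>T (r, c) = None\<close> by (subst cases) auto
  then have 1: "dlist (column_entries T c) = dlist Bs @ dlist As"
    using dlist_Un[OF fin(2,1)] ux' bx' by (metis less_trans)
  have "column_entries T' c = insert x (Bs \<union> As)" unfolding column_entries_def As_def Bs_def T'_def
    by (subst cases) auto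
  then have 2: "dlist (column_entries T' c) = dlist Bs @ x # dlist As"
    using fin ux' bx' by (simp add: dlist_insert_Un)
  have "column_entries T (Suc c) = insert x (Ds \<union> Gs)" unfolding column_entries_def Gs_def Ds_def
    using x by (subst cases) auto
  then have 3: "dlist (column_entries T (Suc c)) = dlist Ds @ x # dlist Gs"
    using fin gx dx by (simp add: dlist_insert_Un)
  have "column_entries T' (Suc c) = Ds \<union> Gs" unfolding column_entries_def Gs_def Ds_def T'_def
    by (subst cases) auto
  then have 4: "dlist (column_entries T' (Suc c)) = dlist Ds @ dlist Gs"
    using dlist_Un[OF fin(4,3)] gx dx by (metis less_trans)
  \<comment> \<open>Columns increase strictly, so counting rows equals counting entries; this turns
    the row-by-row comparisons \<open>up\<close> and \<open>dn\<close> into the counting form of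
    dominance.\<close>
  have card_eq: "card {i. P i \<and> (\<exists>a. T (i, k) = Some a \<and> Q a)} = card {a. Q a \<and> (\<exists>i. P i \<and> T (i, k) = Some a)}"
    for P Q k
  proof (rule bij_betw_same_card)
    let ?A = "{i. P i \<and> (\<exists>a. T (i, k) = Some a \<and> Q a)}"
    show "bij_betw (\<lambda>i. the (T (i, k))) ?A {a. Q a \<and> (\<exists>i. P i \<and> T (i, k) = Some a)}"
    proof (rule bij_betw_imageI)
      show "inj_on (\<lambda>i. the (T (i, k))) ?A"
      proof (rule inj_onI)
        fix i j assume "i \<in> ?A" "j \<in> ?A" and e: "the (T (i, k)) = the (T (j, k))"
        then obtain a b where "T (i, k) = Some a" "T (j, k) = Some b" by auto
        then show "i = j" using e ssyt_col[OF s, of i k a j b] ssyt_col[OF s, of j k b i a]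
          by (cases i j rule: linorder_cases) auto
      qed
      show "(\<lambda>i. the (T (i, k))) ` ?A = {a. Q a \<and> (\<exists>i. P i \<and> T (i, k) = Some a)}" by force
    qed
  qed
  have finr: "finite {i. (i, k) \<in> dom T}" for k
    using finite_imageI[OF fd, of fst] by (rule finite_subset[rotated]) force
  have "dominated (dlist As) (dlist Gs)" unfolding dominated_def
  proof
    fix z
    have "card {i. i < r \<and> (\<exists>a. T (i, c) = Some a \<and> z \<le> a)} \<le> card {i. i < r \<and> (\<exists>a. T (i, Suc c) = Some a \<and> z \<le> a)}"
      by (rule card_mono, simp, safe) (meson up order_trans)+
    then show "length (filter ((\<le>) z) (dlist As)) \<le> length (filter ((\<le>) z) (dlist Gs))"
      unfolding card_eq using fin by (simp add: length_filter_dlist As_def Gs_def conj_commute)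
  qed
  moreover have "codominated (dlist Ds) (dlist Bs)" unfolding codominated_def
  proof
    fix z
    have "card {i. r < i \<and> (\<exists>a. T (i, Suc c) = Some a \<and> a \<le> z)} \<le> card {i. r < i \<and> (\<exists>a. T (i, c) = Some a \<and> a \<le> z)}"
      by (rule card_mono, rule finite_subset[OF _ finr[of c]], force, safe) (meson dn order_trans)+
    then show "length (filter (\<lambda>a. a \<le> z) (dlist Ds)) \<le> length (filter (\<lambda>a. a \<le> z) (dlist Bs))"
      unfolding card_eq using fin by (simp add: length_filter_dlist Ds_def Bs_def conj_commute)
  qed
  moreover have "sorted_wrt (>) (dlist Bs @ x # dlist As)" "sorted_wrt (>) (dlist Ds @ x # dlist Gs)"
    using fin by (auto simp: sorted_wrt_append sorted_dlist gx dx ux' bx') (meson less_trans gx dx ux' bx')+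
  ultimately have "knuth (dlist Bs @ dlist As @ dlist Ds @ x # dlist Gs) (dlist Bs @ x # dlist As @ dlist Ds @ dlist Gs)"
    by (intro knuth_column_slide)
  then show "knuth (word N T) (word N T')"
  proof (intro word_knuth_two_columns[of c])
    show "Suc c < N" using N xd by auto
    show "column_entries T k = column_entries T' k" if "k \<noteq> c" "k \<noteq> Suc c" for k
      using that by (simp add: column_entries_def T'_def)
  qed (simp add: 1 2 3 4)
qed


text \<open>Every column keeps its set of entries, so the word is literally unchanged. The row
  condition to the left of the hole goes through the row below: an entry there is smaller than the
  one beneath it, which stands to the left of \<open>y\<close>.\<close>

lemma with_hole_up:
  assumes h: "with_hole \<kappa> \<nu> T (r, c)"
    and y: "T (Suc r, c) = Some y" and x: "\<And>x. T (r, Suc c) = Some x \<Longrightarrow> y \<le> x"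
  defines "T' \<equiv> T((r, c) \<mapsto> y, (Suc r, c) := None)"
  shows "with_hole \<kappa> \<nu> T' (Suc r, c)" and "word N T' = word N T"
proof -
  have p: "is_partition \<kappa>" "is_partition \<nu>" and s: "ssyt (dom T) T"
    using h unfolding with_hole_def skew_def by blast+
  note d = with_hole_dom[OF h]
  have rc: "(r, c) \<in> diagram \<kappa>" "(r, c) \<notin> diagram \<nu>"
    using h unfolding with_hole_def by blast+
  have yd: "(Suc r, c) \<in> diagram \<kappa>" "(Suc r, c) \<notin> diagram \<nu>" using d[of "(Suc r, c)"] y by auto
  have cl: "1 \<le> r" "1 \<le> c" using rc by (auto simp: diagram_iff)
  have lf: "a \<le> y" if "k < c" "T (r, k) = Some a" for k a
  proof -
    have k: "(r, k) \<in> diagram \<kappa>" "(r, k) \<notin> diagram \<nu>" using d[of "(r, k)"] that by auto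
    have "1 \<le> k" using k(1) by (simp add: diagram_iff)
    then have "(Suc r, k) \<in> diagram \<kappa>" "(Suc r, k) \<notin> diagram \<nu>"
      using that cl k(2) diagram_mono[OF p(1) yd(1), of "Suc r" k] diagram_mono[OF p(2), of "Suc r" k r k]
      by auto
    then have "(Suc r, k) \<in> dom T" unfolding d by simp
    then obtain b where b: "T (Suc r, k) = Some b" by auto
    then show ?thesis using ssyt_col[OF s that(2) b] ssyt_row[OF s b y] that by simp
  qed
  have rt: "y \<le> a" if "c < k" "T (r, k) = Some a" for k a
  proof -
    have k: "(r, k) \<in> diagram \<kappa>" using d[of "(r, k)"] that by auto
    then have "(r, Suc c) \<in> diagram \<kappa>"
      using that cl diagram_mono[OF p(1) k, of r "Suc c"] by auto
    moreover have "(r, Suc c) \<notin> diagram \<nu>" using rc by (auto simp: diagram_iff)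
    ultimately have "(r, Suc c) \<in> dom T" unfolding d by simp
    then obtain b where b: "T (r, Suc c) = Some b" by auto
    then show ?thesis using x[OF b] ssyt_row[OF s b that(2)] that by simp
  qed
  have dn: "y < a" if "Suc r < i" "T (i, c) = Some a" for i a
    using ssyt_col[OF s y that(2)] that(1) by simp
  have up: "a < y" if "i < r" "T (i, c) = Some a" for i a
    using ssyt_col[OF s that(2) y] that(1) by simp
  show "with_hole \<kappa> \<nu> T' (Suc r, c)"
  proof -
    have "insert (Suc r, c) (dom T') = insert (r, c) (dom T)" using y by (auto simp: T'_def)
    moreover have "(Suc r, c) \<notin> dom T'" by (simp add: T'_def)
    moreover have "ssyt (dom ((T((Suc r, c) := None))((r, c) \<mapsto> y))) ((T((Suc r, c) := None))((r, c) \<mapsto> y))"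
    proof (rule ssyt_fill[OF ssyt_remove[OF s]])
      fix i a assume "r < i" "(T((Suc r, c) := None)) (i, c) = Some a"
      then show "y < a" using dn[of i a] by (cases "i = Suc r") auto
    qed (auto intro: lf rt up)
    then have "ssyt (dom T') T'" unfolding T'_def by (simp add: fun_upd_twist)
    ultimately show ?thesis using h unfolding with_hole_def by simp
  qed
  have "T (r, c) = None" using h unfolding with_hole_def by blast
  have "column_entries T' k = column_entries T k" for k
  proof (cases "k = c")
    case True
    have "a \<in> column_entries T' c \<longleftrightarrow> a \<in> column_entries T c" for a
    proof
      assume "a \<in> column_entries T' c"
      then show "a \<in> column_entries T c" using y by (auto simp: column_entries_def T'_def split: if_splits)
    next
      assume "a \<in> column_entries T c"
      then obtain i where i: "T (i, c) = Some a" by (auto simp: column_entries_def)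
      then have "T' (if i = Suc r then r else i, c) = Some a"
        using y \<open>T (r, c) = None\<close> by (auto simp: T'_def)
      then show "a \<in> column_entries T' c" unfolding column_entries_def by blast
    qed
    then show ?thesis using True by blast
  next
    case False
    then show ?thesis by (simp add: column_entries_def T'_def)
  qed
  then show "word N T' = word N T" by (intro word_cong) simp
qed

text \<open>The inner shape is fixed during a slide, and the final hole is a removable corner of the
  outer shape. Keeping the resulting shape in the conclusion allows slides to be iterated.\<close>

lemma slides_to_with_hole:
  assumes "slides_to T b T'" "with_hole \<kappa> \<nu> T b"
  shows "(\<exists>\<kappa>'. skew \<kappa>' \<nu> \<and> ssyt (diagram \<kappa>' - diagram \<nu>) T') \<and>
    (\<forall>N. diagram \<kappa> \<subseteq> UNIV \<times> {..<N} \<longrightarrow> knuth (word N T) (word N T'))"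
  using assms
proof (induction rule: slides_to.induct)
  case (stop T r c)
  have sk: "skew \<kappa> \<nu>" and p: "is_partition \<kappa>" "is_partition \<nu>" and s: "ssyt (dom T) T"
    using stop(3) unfolding with_hole_def skew_def by blast+
  note d = with_hole_dom[OF stop(3)]
  have rc: "(r, c) \<in> diagram \<kappa>" "(r, c) \<notin> diagram \<nu>"
    using stop(3) unfolding with_hole_def by blast+
  have "(r, Suc c) \<notin> dom T" "(Suc r, c) \<notin> dom T" using stop(1,2) by auto
  moreover have "(r, Suc c) \<notin> diagram \<nu>" "(Suc r, c) \<notin> diagram \<nu>"
    using rc diagram_mono[OF p(2), of "Suc r" c r c] by (auto simp: diagram_iff)
  ultimately have "(r, Suc c) \<notin> diagram \<kappa>" "(Suc r, c) \<notin> diagram \<kappa>" unfolding d by auto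
  note rm = remove_corner[OF p(1) rc(1) this]
  have "skew (\<kappa>(r := c - 1)) \<nu>" using sk rm rc unfolding skew_def by blast
  moreover have "dom T = diagram (\<kappa>(r := c - 1)) - diagram \<nu>"
    unfolding rm using d by blast
  ultimately show ?case using s knuth.refl by metis
next
  case (left T r c x T')
  have "with_hole \<kappa> \<nu> (T((r, c) \<mapsto> x, (r, Suc c) := None)) (r, Suc c)"
    by (rule with_hole_left[OF left.prems]) (use left.hyps in auto)
  from left.IH[OF this] show ?case
    using with_hole_left(2)[OF left.prems left.hyps(1,2)] by (blast intro: knuth.trans)
next
  case (up T r c y T')
  have "with_hole \<kappa> \<nu> (T((r, c) \<mapsto> y, (Suc r, c) := None)) (Suc r, c)"
    by (rule with_hole_up[OF up.prems]) (use up.hyps in auto)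
  from up.IH[OF this] show ?case
    using with_hole_up(2)[OF up.prems up.hyps(1,2)] by metis
qed

lemma slides_to_total:
  assumes "finite (dom T)"
  shows "\<exists>T'. slides_to T (r, c) T'"
  using assms
proof (induction "card {(i, k). (i, k) \<in> dom T \<and> r \<le> i \<and> c \<le> k \<and> (i, k) \<noteq> (r, c)}"
    arbitrary: T r c rule: less_induct)
  case less
  \<comment> \<open>The measure counts the filled boxes weakly below and to the right of the hole. A
    move sends the hole to one of them and empties it.\<close>
  let ?M = "\<lambda>T r c. {(i, k). (i, k) \<in> dom T \<and> r \<le> i \<and> c \<le> k \<and> (i, k) \<noteq> (r, c)}"
  have step: "\<exists>T''. slides_to T' (r', c') T''"
    if "(r', c') \<in> ?M T r c" "T' = T((r, c) \<mapsto> x, (r', c') := None)" for T' r' c' x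
  proof (rule less.hyps)
    show "card (?M T' r' c') < card (?M T r c)"
    proof (rule psubset_card_mono)
      show "finite (?M T r c)" by (rule finite_subset[OF _ less.prems]) auto
      have "(i, k) \<in> ?M T r c" if "(i, k) \<in> ?M T' r' c'" for i k
        using that \<open>(r', c') \<in> ?M T r c\<close> \<open>T' = _\<close> by (cases "(i, k) = (r, c)") auto
      then show "?M T' r' c' \<subset> ?M T r c" using that(1) by blast
    qed
    show "finite (dom T')" using less.prems that(2) by simp
  qed
  consider (stop) "T (r, Suc c) = None" "T (Suc r, c) = None"
    | (left) x where "T (r, Suc c) = Some x" "\<And>y. T (Suc r, c) = Some y \<Longrightarrow> x < y"
    | (up) y where "T (Suc r, c) = Some y" "\<And>x. T (r, Suc c) = Some x \<Longrightarrow> y \<le> x"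
    by (cases "T (r, Suc c)"; cases "T (Suc r, c)") (auto, metis not_le)
  then show ?case
  proof cases
    case stop then show ?thesis using slides_to.stop by blast
  next
    case left
    then have "(r, Suc c) \<in> ?M T r c" by auto
    from step[OF this HOL.refl] show ?thesis using slides_to.left[of T r c x, OF left] by blast
  next
    case up
    then have "(Suc r, c) \<in> ?M T r c" by auto
    from step[OF this HOL.refl] show ?thesis using slides_to.up[of T r c y, OF up] by blast
  qed
qed

lemma inside_corner_with_hole:
  assumes sk: "skew \<kappa> \<nu>" and s: "ssyt (diagram \<kappa> - diagram \<nu>) T" and c: "inside_corner \<nu> (r, c)"
  shows "with_hole \<kappa> (\<nu>(r := c - 1)) T (r, c)"
    and "diagram (\<nu>(r := c - 1)) = diagram \<nu> - {(r, c)}"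
proof -
  have c': "(r, c) \<in> diagram \<nu>" "(r, Suc c) \<notin> diagram \<nu>" "(Suc r, c) \<notin> diagram \<nu>"
    using c by (auto simp: inside_corner_def)
  have p: "is_partition \<nu>" "diagram \<nu> \<subseteq> diagram \<kappa>" "is_partition \<kappa>" using sk unfolding skew_def by blast+
  note rm = remove_corner[OF p(1) c']
  show "diagram (\<nu>(r := c - 1)) = diagram \<nu> - {(r, c)}" by (rule rm(2))
  have dT: "dom T = diagram \<kappa> - diagram \<nu>" using s unfolding ssyt_def by blast
  have "insert (r, c) (dom T) = diagram \<kappa> - diagram (\<nu>(r := c - 1))"
    unfolding rm(2) dT using c' p(2) by blast
  moreover have "skew \<kappa> (\<nu>(r := c - 1))" using rm p unfolding skew_def by blast
  ultimately show "with_hole \<kappa> (\<nu>(r := c - 1)) T (r, c)"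
    unfolding with_hole_def using s c'(1) dT by simp
qed

text \<open>The bound is existential because a chain of slides passes through tableaux of different
  widths; transitivity takes the maximum of the bounds.\<close>

lemma jdt_slide_knuth:
  assumes "jdt_slide T T'"
  shows "\<exists>M. \<forall>N\<ge>M. knuth (word N T) (word N T')"
proof -
  obtain \<kappa> \<nu> r c where k: "skew \<kappa> \<nu>" "ssyt (diagram \<kappa> - diagram \<nu>) T" "inside_corner \<nu> (r, c)"
      "slides_to T (r, c) T'"
    using assms unfolding jdt_slide_def skew_def by (metis surj_pair)
  then have p: "is_partition \<kappa>" unfolding skew_def by blast
  have "diagram \<kappa> \<subseteq> UNIV \<times> {..<N}" if "Suc (\<kappa> 1) \<le> N" for N
  proof
    fix b assume "b \<in> diagram \<kappa>"
    then obtain r c where "b = (r, c)" "1 \<le> r" "c \<le> \<kappa> r" by (auto simp: diagram_def)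
    then show "b \<in> UNIV \<times> {..<N}"
      using is_partition_mono[OF p, of 1 r] that by auto
  qed
  then show ?thesis
    using slides_to_with_hole[OF k(4) inside_corner_with_hole(1)[OF k(1-3)]] by blast
qed

lemma jdt_equiv_knuth:
  assumes "jdt_equiv T T'"
  shows "\<exists>M. \<forall>N\<ge>M. knuth (word N T) (word N T')"
  using assms unfolding jdt_equiv_def
proof (induction rule: equivclp_induct)
  case base
  show ?case using knuth.refl by blast
next
  case (step y z)
  obtain M where M: "\<forall>N\<ge>M. knuth (word N T) (word N y)" using step.IH by blast
  obtain M' where M': "\<forall>N\<ge>M'. knuth (word N y) (word N z)"
    using step.hyps(2) jdt_slide_knuth knuth.sym by metis
  have "\<forall>N\<ge>max M M'. knuth (word N T) (word N z)"
    using M M' knuth.trans by (meson max.boundedE)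
  then show ?case by blast
qed

lemma inside_corner_exists:
  assumes p: "is_partition \<nu>" and ne: "diagram \<nu> \<noteq> {}"
  shows "\<exists>r c. inside_corner \<nu> (r, c)"
proof -
  let ?R = "{i. 1 \<le> i \<and> \<nu> i \<noteq> 0}"
  define r where "r = Max ?R"
  have fin: "finite ?R" using p by (simp add: is_partition_def)
  have "?R \<noteq> {}" using ne by (auto simp: diagram_def)
  then have r: "1 \<le> r" "\<nu> r \<noteq> 0" using Max_in[OF fin] unfolding r_def by simp_all
  have "\<nu> (Suc r) = 0" using Max_ge[OF fin, of "Suc r"] unfolding r_def by fastforce
  then have "inside_corner \<nu> (r, \<nu> r)" using r by (simp add: inside_corner_def diagram_iff)
  then show ?thesis by blast
qed

text \<open>The straight tableau is left unspecified: in \<open>jdt_TK\<close> its rows are read off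
  from the Knuth class.\<close>

lemma rectification:
  assumes "skew \<kappa> \<nu>" "ssyt (diagram \<kappa> - diagram \<nu>) T"
  shows "\<exists>\<mu> S. is_partition \<mu> \<and> ssyt (diagram \<mu>) S \<and> jdt_equiv T S"
  using assms
proof (induction "card (diagram \<nu>)" arbitrary: \<kappa> \<nu> T rule: less_induct)
  case less
  note sk = less.prems(1) and st = less.prems(2)
  have p: "is_partition \<nu>" "diagram \<nu> \<subseteq> diagram \<kappa>" "is_partition \<kappa>"
    using sk by (simp_all add: skew_def)
  show ?case
  proof (cases "diagram \<nu> = {}")
    case True
    then have "ssyt (diagram \<kappa>) T" using st by simp
    moreover have "jdt_equiv T T" unfolding jdt_equiv_def by (rule equivclp_refl)
    ultimately show ?thesis using p(3) by (intro exI conjI)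
  next
    case False
    obtain r c where rc: "inside_corner \<nu> (r, c)"
      using inside_corner_exists[OF p(1) False] by (elim exE)
    note h = inside_corner_with_hole[OF sk st rc]
    have "dom T = diagram \<kappa> - diagram \<nu>" using st unfolding ssyt_def by blast
    then have "finite (dom T)" using finite_diagram[OF p(3)] by simp
    then obtain T' where T': "slides_to T (r, c) T'" using slides_to_total[of T r c] by blast
    obtain \<kappa>' where k: "skew \<kappa>' (\<nu>(r := c - 1))" "ssyt (diagram \<kappa>' - diagram (\<nu>(r := c - 1))) T'"
      using conjunct1[OF slides_to_with_hole[OF T' h(1)]] by (elim exE conjE)
    have "(r, c) \<in> diagram \<nu>" using rc by (simp add: inside_corner_def)
    then have "card (diagram (\<nu>(r := c - 1))) < card (diagram \<nu>)"
      unfolding h(2) using finite_diagram[OF p(1)] by (meson card_Diff1_less)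
    from less.hyps[OF this k] obtain \<mu> S where S: "is_partition \<mu>" "ssyt (diagram \<mu>) S" "jdt_equiv T' S"
      by (elim exE conjE)
    have "jdt_slide T T'" unfolding jdt_slide_def
      by (intro exI conjI) (rule p(3) p(1) p(2) st rc T')+
    then have "jdt_equiv T T'" unfolding jdt_equiv_def using r_into_equivclp[of jdt_slide T T'] by simp
    then have "jdt_equiv T S" using S(3) unfolding jdt_equiv_def
      using equivclp_trans[of jdt_slide T T' S] by simp
    with S show ?thesis by (intro exI conjI)
  qed
qed

section \<open>Inserting a column\<close>

text \<open>The entries bumped out of a row by inserting the column \<open>C\<close> in decreasing order, where \<open>V\<close> is
  the set of all entries of the row and of \<open>C\<close>.\<close>

definition succs :: "nat set \<Rightarrow> nat set \<Rightarrow> nat set" where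
  "succs V C = {z \<in> V. \<exists>c\<in>C. c < z \<and> (\<forall>v\<in>V. c < v \<longrightarrow> z \<le> v)}"

lemma succs_subset: "succs V C \<subseteq> V"
  by (auto simp: succs_def)

lemma finite_succs: "finite V \<Longrightarrow> finite (succs V C)"
  using succs_subset finite_subset by blast

lemma next_exists:
  fixes V :: "nat set"
  assumes "v \<in> V" "x < v"
  obtains s where "s \<in> V" "x < s" "\<And>u. u \<in> V \<Longrightarrow> x < u \<Longrightarrow> s \<le> u"
proof -
  define s where "s = (LEAST z. z \<in> V \<and> x < z)"
  have "s \<in> V \<and> x < s" unfolding s_def by (rule LeastI[of _ v]) (use assms in simp)
  moreover have "s \<le> u" if "u \<in> V" "x < u" for u unfolding s_def by (rule Least_le) (use that in simp)
  ultimately show ?thesis using that by blast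
qed

lemma prev_exists:
  fixes V :: "nat set"
  assumes "finite V" "v \<in> V" "v < x"
  obtains s where "s \<in> V" "s < x" "\<And>u. u \<in> V \<Longrightarrow> u < x \<Longrightarrow> u \<le> s"
proof -
  let ?W = "{u \<in> V. u < x}"
  have "finite ?W" "?W \<noteq> {}" using assms by auto
  then show ?thesis using that[of "Max ?W"] Max_in[of ?W] Max_ge[of ?W] by blast
qed

text \<open>\<open>C\<close> enters from its largest element down, so the induction adds a new
  minimum \<open>b\<close> that is inserted last. Everything bumped before exceeds the successor
  \<open>s\<close> of \<open>b\<close> in \<open>V\<close>; hence \<open>s\<close> is still in the
  row and is what \<open>b\<close> bumps.\<close>

lemma rins_column:
  assumes "finite C"
  shows "rins_out U (dlist C) = dlist (succs (set_mset U \<union> C) C) \<and>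
    rins_row U (dlist C) = U + mset_set C - mset_set (succs (set_mset U \<union> C) C)"
  using assms
proof (induction C rule: finite_linorder_min_induct)
  case empty
  show ?case by (simp add: succs_def)
next
  case (insert b C)
  define V where "V = set_mset U \<union> C"
  define A where "A = succs V C"
  define R where "R = U + mset_set C - mset_set A"
  have finV: "finite V" using insert by (simp add: V_def)
  have finA: "finite A" using finite_succs[OF finV] by (simp add: A_def)
  have IH: "rins_out U (dlist C) = dlist A" "rins_row U (dlist C) = R"
    using insert.IH by (simp_all add: R_def A_def V_def)
  have dl: "dlist (insert b C) = dlist C @ [b]"
    using insert by (intro dlist_insert_less) auto
  have V': "set_mset U \<union> insert b C = insert b V" by (simp add: V_def)
  have bC: "b \<notin> C" using insert by auto
  have CV: "C \<subseteq> V" by (simp add: V_def)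
  have RV: "u \<in> V" if "u \<in># R" for u using that insert.hyps(1)
    unfolding R_def V_def by (metis Un_iff elem_mset_set in_diffD set_mset_union)
  have VA: "u \<in># R" if "u \<in> V" "u \<notin> A" for u
  proof -
    have "count (mset_set A) u = 0" using that by (simp add: not_in_iff[symmetric] finA)
    moreover have "count (U + mset_set C) u > 0"
      using that insert.hyps(1) by (auto simp: V_def)
    ultimately have "count R u > 0" unfolding R_def by simp
    then show ?thesis by simp
  qed
  have sV: "succs (insert b V) C = A"
    unfolding A_def succs_def using insert.hyps(2) by fastforce
  show ?case
  proof (cases "\<exists>v\<in>V. b < v")
    case False
    then have "C = {}" using insert.hyps(2) CV by auto
    then have "A = {}" "R = U" "mset_set C = {#}" by (auto simp: A_def succs_def R_def)
    moreover have "succs (insert b V) (insert b C) = {}"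
      using False \<open>C = {}\<close> by (auto simp: succs_def)
    moreover have "bumped R b = []" by (rule bumped_None) (use False RV in \<open>meson not_le\<close>)
    ultimately show ?thesis
      using bC insert.hyps(1) unfolding dl V' by (simp add: IH \<open>C = {}\<close> rins_out.simps(2) rins_row.simps(2))
  next
    case True
    then obtain s where s: "s \<in> V" "b < s" "\<And>u. u \<in> V \<Longrightarrow> b < u \<Longrightarrow> s \<le> u"
      using next_exists by metis
    have sA: "s < a" if "a \<in> A" for a
      using that s(3) insert.hyps(2) CV unfolding A_def succs_def by fastforce
    then have "s \<notin> A" by blast
    have bump: "bumped R b = [s]" by (rule bumped_Some) (use s RV VA \<open>s \<notin> A\<close> in auto)
    have "succs (insert b V) {b} = {s}" unfolding succs_def using s by fastforce
    moreover have "succs (insert b V) (insert b C) = succs (insert b V) {b} \<union> succs (insert b V) C"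
      unfolding succs_def by blast
    ultimately have new: "succs (insert b V) (insert b C) = insert s A" using sV by simp
    have "b \<notin> A" using sA s(2) by force
    have "add_mset b (R - {#s#}) = U + mset_set (insert b C) - mset_set (insert s A)"
    proof (rule multiset_eqI)
      fix x
      show "count (add_mset b (R - {#s#})) x = count (U + mset_set (insert b C) - mset_set (insert s A)) x"
        using insert.hyps(1) finA bC \<open>b \<notin> A\<close> s(2) \<open>s \<notin> A\<close> s(1)
        unfolding R_def V_def by (auto simp: count_mset_set')
    qed
    moreover have "dlist (insert s A) = dlist A @ [s]" using finA sA by (rule dlist_insert_less)
    ultimately show ?thesis
      unfolding dl V' new by (simp add: IH bump rins_out.simps(2) rins_row.simps(2))
  qed
qed

text \<open>The case of a column of a straight tableau reaching a row. Its entries arrive from the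
  largest down and each bumps the one before it, so that finally only the top entry \<open>x\<close>
  stays.\<close>

lemma succs_column:
  assumes "finite Y" "\<And>y. y \<in> Y \<Longrightarrow> x < y" "\<And>u. u \<in> U \<Longrightarrow> u \<le> x"
  shows "succs (U \<union> insert x Y) (insert x Y) = Y"
proof (intro equalityI subsetI)
  fix z assume "z \<in> succs (U \<union> insert x Y) (insert x Y)"
  then obtain c where "z \<in> U \<union> insert x Y" "c \<in> insert x Y" "c < z" unfolding succs_def by blast
  moreover have "x \<le> c" using calculation(2) assms(2) less_imp_le by blast
  ultimately show "z \<in> Y" using assms(3) by force
next
  fix z assume z: "z \<in> Y"
  obtain c where c: "c \<in> insert x Y" "c < z" "\<And>u. u \<in> insert x Y \<Longrightarrow> u < z \<Longrightarrow> u \<le> c"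
    using prev_exists[of "insert x Y" x z] assms z by blast
  have "x \<le> c" using c(1) assms(2) less_imp_le by blast
  then have "z \<le> v" if "v \<in> U \<union> insert x Y" "c < v" for v
    using that c(3)[of v] assms(3)[of v] by force
  then show "z \<in> succs (U \<union> insert x Y) (insert x Y)"
    unfolding succs_def using c z by blast
qed

section \<open>A straight tableau as its own insertion tableau, and a column inserted into
  it\<close>

definition row_mset :: "config \<Rightarrow> nat \<Rightarrow> nat multiset" where
  "row_mset T r = image_mset (\<lambda>c. the (T (r, c))) (mset_set (row_columns T r))"

definition row_mset_below :: "nat \<Rightarrow> config \<Rightarrow> nat \<Rightarrow> nat multiset" where
  "row_mset_below N T r = image_mset (\<lambda>c. the (T (r, c))) (mset_set {c \<in> row_columns T r. c < N})"

definition word_below :: "nat \<Rightarrow> nat \<Rightarrow> config \<Rightarrow> nat list" where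
  "word_below i N T = concat (map (\<lambda>c. dlist {x. \<exists>r>i. T (r, c) = Some x}) [0..<N])"

lemma ssyt_dom: "ssyt D T \<Longrightarrow> dom T = D"
  unfolding ssyt_def by blast

text \<open>Induction over the columns: the next column meets a row that holds only entries of
  earlier columns, none of them larger than its top entry, which is the situation of
  \<open>succs_column\<close>.\<close>

lemma straight_rins:
  assumes p: "is_partition \<mu>" and s: "ssyt (diagram \<mu>) S"
  shows "rins_out {#} (word_below i N S) = word_below (Suc i) N S \<and>
    rins_row {#} (word_below i N S) = row_mset_below N S (Suc i)"
proof (induction N)
  case 0
  show ?case by (simp add: word_below_def row_mset_below_def)
next
  case (Suc N)
  note dS = ssyt_dom[OF s]
  let ?U = "row_mset_below N S (Suc i)"
  let ?X = "\<lambda>i. {x. \<exists>r>i. S (r, N) = Some x}"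
  have w: "word_below i (Suc N) S = word_below i N S @ dlist (?X i)" for i
    by (simp add: word_below_def)
  have fin: "finite (ran S)" using dS finite_diagram[OF p] by (metis finite_ran)
  have finX: "finite (?X i)" for i by (rule finite_subset[OF _ fin]) (auto simp: ran_def)
  have finc: "finite {c \<in> row_columns S (Suc i). c < N}" by simp
  show ?case
  proof (cases "S (Suc i, N)")
    case None
    have "S (r, N) = None" if "i < r" for r
    proof (rule ccontr)
      assume "S (r, N) \<noteq> None"
      then have "(r, N) \<in> diagram \<mu>" using dS by auto
      then have "(Suc i, N) \<in> diagram \<mu>"
        using diagram_mono[OF p, of r N "Suc i" N] that by (simp add: diagram_iff)
      then show False using None dS by auto
    qed
    then have X: "?X i = {}" "?X (Suc i) = {}" by auto
    moreover have "{c \<in> row_columns S (Suc i). c < Suc N} = {c \<in> row_columns S (Suc i). c < N}"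
      using None by (auto simp: row_columns_def less_Suc_eq)
    ultimately show ?thesis using Suc by (simp only: w X) (simp add: row_mset_below_def)
  next
    case (Some x)
    have "(\<exists>r>i. P r) \<longleftrightarrow> P (Suc i) \<or> (\<exists>r>Suc i. P r)" for P
      by (metis Suc_lessD Suc_lessI lessI)
    then have Xi: "?X i = insert x (?X (Suc i))" using Some by auto
    have gt: "x < y" if "y \<in> ?X (Suc i)" for y using that ssyt_col[OF s Some] by blast
    have le: "u \<le> x" if "u \<in> set_mset ?U" for u
      using that ssyt_row[OF s _ Some] by (auto simp: row_mset_below_def row_columns_def)
    note sc = succs_column[OF finX gt le]
    have rc: "{c \<in> row_columns S (Suc i). c < Suc N} = insert N {c \<in> row_columns S (Suc i). c < N}"
      using Some by (auto simp: row_columns_def less_Suc_eq)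
    have "x \<notin> ?X (Suc i)" using gt by blast
    then have "?U + mset_set (insert x (?X (Suc i))) - mset_set (?X (Suc i)) = row_mset_below (Suc N) S (Suc i)"
      using finX[of "Suc i"] Some unfolding row_mset_below_def rc by simp
    then have "rins_out ?U (dlist (?X i)) = dlist (?X (Suc i)) \<and>
        rins_row ?U (dlist (?X i)) = row_mset_below (Suc N) S (Suc i)"
      using rins_column[OF finX[of i], of ?U] unfolding Xi by (simp only: sc)
    then show ?thesis using Suc unfolding w rins_row_append rins_out_append by simp
  qed
qed

lemma straight_rins_iter:
  assumes "is_partition \<mu>" "ssyt (diagram \<mu>) S"
  shows "(rins_out {#} ^^ i) (word_below 0 N S) = word_below i N S"
    and "prow i (word_below 0 N S) = row_mset_below N S (Suc i)"
proof -
  show "(rins_out {#} ^^ i) (word_below 0 N S) = word_below i N S"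
    by (induction i) (simp_all add: straight_rins[OF assms])
  then show "prow i (word_below 0 N S) = row_mset_below N S (Suc i)"
    using straight_rins[OF assms] by (simp add: prow_def)
qed

lemma word_straight:
  assumes "ssyt (diagram \<mu>) S"
  shows "word N S = word_below 0 N S"
proof -
  have "column_entries S c = {x. \<exists>r>0. S (r, c) = Some x}" for c
  proof -
    have "0 < r" if "S (r, c) = Some x" for r x
    proof -
      have "(r, c) \<in> diagram \<mu>" using that ssyt_dom[OF assms] by auto
      then show ?thesis by (simp add: diagram_iff)
    qed
    then show ?thesis unfolding column_entries_def by blast
  qed
  then show ?thesis by (simp add: word_def word_below_def)
qed

text \<open>\<open>col_seq U C i\<close> is the set that arrives at row \<open>Suc i\<close> when
  the column \<open>C\<close> is inserted into the straight tableau with rows \<open>U 1\<close>,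
  \<open>U 2\<close>, and so on.\<close>

primrec col_seq :: "(nat \<Rightarrow> nat multiset) \<Rightarrow> nat set \<Rightarrow> nat \<Rightarrow> nat set" where
  "col_seq U C 0 = C"
| "col_seq U C (Suc i) = succs (set_mset (U (Suc i)) \<union> col_seq U C i) (col_seq U C i)"

lemma finite_col_seq: "finite C \<Longrightarrow> finite (col_seq U C i)"
  by (induction i) (auto intro: finite_succs)

lemma straight_column_rins:
  fixes N :: nat
  assumes "is_partition \<mu>" "ssyt (diagram \<mu>) T" "finite C"
  defines "U \<equiv> row_mset_below N T"
  shows "(rins_out {#} ^^ i) (word_below 0 N T @ dlist C) = word_below i N T @ dlist (col_seq U C i)"
    and "prow i (word_below 0 N T @ dlist C) =
      U (Suc i) + mset_set (col_seq U C i) - mset_set (col_seq U C (Suc i))"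
proof -
  note 1 = straight_rins[OF assms(1,2)]
  note 2 = rins_column[OF finite_col_seq[OF assms(3)]]
  show e: "(rins_out {#} ^^ i) (word_below 0 N T @ dlist C) = word_below i N T @ dlist (col_seq U C i)" for i
    by (induction i) (simp_all add: 1 2 U_def)
  show "prow i (word_below 0 N T @ dlist C) =
      U (Suc i) + mset_set (col_seq U C i) - mset_set (col_seq U C (Suc i))"
    unfolding prow_def e using 1 2 by (simp add: U_def)
qed

text \<open>The reverse of \<^const>\<open>succs\<close>: the entries leaving the row \<open>R\<close> when its last entry is reverse
  bumped, after the entries of \<open>A\<close> were reverse bumped into \<open>R\<close> from the row below in increasing order.\<close>

definition preds :: "nat set \<Rightarrow> nat set \<Rightarrow> nat set" where
  "preds R A = {z \<in> R \<union> A. \<forall>r\<in>R. z < r \<longrightarrow> (\<exists>a\<in>A. z < a \<and> a \<le> r)}"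

lemma preds_subset: "preds R A \<subseteq> R \<union> A"
  by (auto simp: preds_def)

text \<open>Distinct elements of \<open>V\<close> have distinct successors in \<open>V\<close>, so
  the count drops only if the maximum of \<open>V\<close> lies in \<open>C\<close>.\<close>

lemma card_succs:
  assumes "finite V" "C \<subseteq> V"
  shows "card (succs V C) = card {c \<in> C. \<exists>v\<in>V. c < v}"
proof (rule bij_betw_same_card[symmetric])
  define f where "f c = Min {v \<in> V. c < v}" for c
  have f: "f c \<in> V" "c < f c" "\<And>v. v \<in> V \<Longrightarrow> c < v \<Longrightarrow> f c \<le> v" if "\<exists>v\<in>V. c < v" for c
  proof -
    have "finite {v \<in> V. c < v}" "{v \<in> V. c < v} \<noteq> {}" using assms that by auto
    then have "f c \<in> {v \<in> V. c < v}" "\<And>v. v \<in> {v \<in> V. c < v} \<Longrightarrow> f c \<le> v"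
      unfolding f_def using Min_in[of "{v \<in> V. c < v}"] Min_le[of "{v \<in> V. c < v}"] by blast+
    then show "f c \<in> V" "c < f c" "\<And>v. v \<in> V \<Longrightarrow> c < v \<Longrightarrow> f c \<le> v" by auto
  qed
  show "bij_betw f {c \<in> C. \<exists>v\<in>V. c < v} (succs V C)"
  proof (rule bij_betw_imageI)
    show "inj_on f {c \<in> C. \<exists>v\<in>V. c < v}"
    proof (rule inj_onI)
      fix c d assume "c \<in> {c \<in> C. \<exists>v\<in>V. c < v}" "d \<in> {c \<in> C. \<exists>v\<in>V. c < v}" and e: "f c = f d"
      then have cd: "\<exists>v\<in>V. c < v" "\<exists>v\<in>V. d < v" "c \<in> V" "d \<in> V" using assms(2) by auto
      show "c = d"
        using f(2,3)[OF cd(1)] f(2,3)[OF cd(2)] cd(3,4) e by (metis leD linorder_neqE_nat)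
    qed
    show "f ` {c \<in> C. \<exists>v\<in>V. c < v} = succs V C"
    proof (intro equalityI subsetI)
      fix z assume "z \<in> f ` {c \<in> C. \<exists>v\<in>V. c < v}"
      then obtain c where c: "z = f c" "c \<in> C" "\<exists>v\<in>V. c < v" by auto
      then show "z \<in> succs V C" using f[OF c(3)] unfolding succs_def c(1) by blast
    next
      fix z assume "z \<in> succs V C"
      then obtain c where c: "z \<in> V" "c \<in> C" "c < z" "\<forall>v\<in>V. c < v \<longrightarrow> z \<le> v"
        unfolding succs_def by blast
      then have ex: "\<exists>v\<in>V. c < v" by blast
      have "f c = z" using f[OF ex] c by (metis order_antisym)
      then show "z \<in> f ` {c \<in> C. \<exists>v\<in>V. c < v}" using c ex by blast
    qed
  qed
qed

lemma set_mset_exchange: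
  assumes "finite A" "finite C" "A \<subseteq> set_mset U \<union> C"
  shows "set_mset (U + mset_set C - mset_set A) \<union> A = set_mset U \<union> C"
proof (intro equalityI subsetI)
  fix x assume "x \<in> set_mset (U + mset_set C - mset_set A) \<union> A"
  then show "x \<in> set_mset U \<union> C" using assms
    by (metis Un_iff elem_mset_set in_diffD set_mset_union subsetD)
next
  fix x assume x: "x \<in> set_mset U \<union> C"
  show "x \<in> set_mset (U + mset_set C - mset_set A) \<union> A"
  proof (cases "x \<in> A")
    case False
    then have "count (mset_set A) x = 0" using assms by (simp add: count_mset_set')
    moreover have "count (U + mset_set C) x > 0" using x assms by auto
    ultimately show ?thesis unfolding Un_iff in_diff_count by simp
  qed simp
qed

text \<open>Multiset subtraction truncates; here nothing is truncated because
  \<open>mset_set A\<close> has no repetitions and \<open>A\<close> is contained in the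
  union.\<close>

lemma mset_exchange:
  assumes "finite A" "finite C" "A \<subseteq> set_mset U \<union> C"
  shows "U + mset_set C - mset_set A + mset_set A = U + mset_set C"
proof -
  have "mset_set A \<subseteq># U + mset_set C"
  proof (rule mset_subset_eqI)
    fix x show "count (mset_set A) x \<le> count (U + mset_set C) x"
    proof (cases "x \<in> A")
      case True
      then have "x \<in> set_mset U \<or> x \<in> C" using assms by blast
      then have "count (U + mset_set C) x \<ge> 1" using assms(2) by (auto simp: Suc_le_eq)
      then show ?thesis using assms True by (simp add: count_mset_set')
    qed (simp add: count_mset_set')
  qed
  then show ?thesis by simp
qed

text \<open>By \<open>card_succs\<close> the hypothesis on cardinalities says that one element of
  \<open>C\<close> bumps nothing, and it is the maximum of the union. So \<open>C\<close> consists
  of this maximum and of the elements whose next larger element lies in \<open>A\<close>, which is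
  what \<open>preds\<close> describes.\<close>

lemma preds_succs:
  fixes U :: "nat multiset"
  assumes C: "finite C" and A: "A = succs (set_mset U \<union> C) C"
    and R: "R = U + mset_set C - mset_set A" and card: "card C = Suc (card A)"
  shows "C = preds (set_mset R) A" "U = R + mset_set A - mset_set C"
proof -
  let ?V = "set_mset U \<union> C"
  have finV: "finite ?V" using C by simp
  have finA: "finite A" unfolding A by (rule finite_succs[OF finV])
  have AV: "A \<subseteq> ?V" unfolding A by (rule succs_subset)
  have V: "set_mset R \<union> A = ?V" unfolding R by (rule set_mset_exchange[OF finA C AV])
  have "R + mset_set A = U + mset_set C" unfolding R by (rule mset_exchange[OF finA C AV])
  then show "U = R + mset_set A - mset_set C" by simp
  have "{c \<in> C. \<exists>v\<in>?V. c < v} \<noteq> C"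
    using card_succs[OF finV, of C] card unfolding A[symmetric] by force
  then obtain m where m: "m \<in> C" "\<not> (\<exists>v\<in>?V. m < v)" by blast
  then have m: "m \<in> C" "\<And>v. v \<in> ?V \<Longrightarrow> v \<le> m" by (blast, meson not_less)
  show "C = preds (set_mset R) A"
  proof (intro equalityI subsetI)
    fix c assume c: "c \<in> C"
    have "\<exists>a\<in>A. c < a \<and> a \<le> r" if r: "r \<in># R" "c < r" for r
    proof -
      have rV: "r \<in> ?V" using r V by blast
      obtain s where s: "s \<in> ?V" "c < s" "\<And>u. u \<in> ?V \<Longrightarrow> c < u \<Longrightarrow> s \<le> u"
        by (rule next_exists[OF rV r(2)]) blast
      then have "s \<in> A" using c unfolding A succs_def by blast
      then show ?thesis using s r rV by blast
    qed
    then show "c \<in> preds (set_mset R) A" using c V unfolding preds_def by blast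
  next
    fix z assume z: "z \<in> preds (set_mset R) A"
    then have zV: "z \<in> ?V" using V preds_subset by blast
    show "z \<in> C"
    proof (cases "\<exists>v\<in>?V. z < v")
      case False
      then have "z = m" using m zV by (metis UnI2 le_neq_implies_less)
      then show ?thesis using m by simp
    next
      case True
      then obtain s where s: "s \<in> ?V" "z < s" "\<And>u. u \<in> ?V \<Longrightarrow> z < u \<Longrightarrow> s \<le> u"
        using next_exists by metis
      have "s \<in> A"
      proof (cases "s \<in># R")
        case True
        then obtain a where "a \<in> A" "z < a" "a \<le> s" using z s unfolding preds_def by blast
        then show ?thesis using s(3)[of a] AV by (metis order_antisym subsetD)
      qed (use s V in blast)
      then obtain c where c: "c \<in> C" "c < s" "\<forall>v\<in>?V. c < v \<longrightarrow> s \<le> v" unfolding A succs_def by blast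
      have "\<not> c < z" using c(3) zV s(2) by force
      moreover have "\<not> z < c" using s(3)[of c] c(1,2) by force
      ultimately show ?thesis using c(1) by (metis linorder_neqE_nat)
    qed
  qed
qed

text \<open>The entry \<open>r\<close> below all of \<open>A\<close> gives every element of
  \<open>A\<close> a predecessor; otherwise the least element of \<open>A\<close> might have nothing
  to replace.\<close>

lemma succs_preds:
  fixes R :: "nat multiset"
  assumes A: "finite A" and r: "r \<in># R" "\<forall>a\<in>A. r < a"
    and C: "C = preds (set_mset R) A" and U: "U = R + mset_set A - mset_set C"
  shows "finite C" "set_mset U \<union> C = set_mset R \<union> A" "succs (set_mset U \<union> C) C = A"
    "U + mset_set C = R + mset_set A" "card C = Suc (card A)"
proof -
  let ?V = "set_mset R \<union> A"
  have finV: "finite ?V" using A by simp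
  have CV: "C \<subseteq> ?V" unfolding C by (rule preds_subset)
  then show finC: "finite C" using finV finite_subset by blast
  show V: "set_mset U \<union> C = ?V" unfolding U by (rule set_mset_exchange[OF finC A CV])
  show "U + mset_set C = R + mset_set A" unfolding U by (rule mset_exchange[OF finC A CV])
  show sA: "succs (set_mset U \<union> C) C = A" unfolding V
  proof (intro equalityI subsetI)
    fix z assume "z \<in> succs ?V C"
    then obtain c where c: "z \<in> ?V" "c \<in> C" "c < z" "\<And>v. v \<in> ?V \<Longrightarrow> c < v \<Longrightarrow> z \<le> v"
      unfolding succs_def by blast
    show "z \<in> A"
    proof (cases "z \<in># R")
      case True
      then obtain a where "a \<in> A" "c < a" "a \<le> z" using c unfolding C preds_def by blast
      then show ?thesis using c(4)[of a] by (metis UnI2 order_antisym)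
    qed (use c in blast)
  next
    fix a assume a: "a \<in> A"
    obtain c where c: "c \<in> ?V" "c < a" "\<And>v. v \<in> ?V \<Longrightarrow> v < a \<Longrightarrow> v \<le> c"
      using prev_exists[OF finV, of r a] r a by blast
    have nx: "a \<le> v" if "v \<in> ?V" "c < v" for v using c(3)[OF that(1)] that(2) by force
    then have "c \<in> C" unfolding C preds_def using c a by blast
    then show "a \<in> succs ?V C" unfolding succs_def using nx c a by blast
  qed
  have ne: "?V \<noteq> {}" using r by blast
  define m where "m = Max ?V"
  have m: "m \<in> ?V" "\<And>v. v \<in> ?V \<Longrightarrow> v \<le> m" unfolding m_def using Max_in[OF finV ne] Max_ge[OF finV] by blast+
  have "m \<in> C" unfolding C preds_def using m by force
  have "{c \<in> C. \<exists>v\<in>?V. c < v} = C - {m}"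
  proof (intro equalityI subsetI)
    fix c assume "c \<in> C - {m}"
    then show "c \<in> {c \<in> C. \<exists>v\<in>?V. c < v}" using m CV by (metis (no_types, lifting) DiffE insertI1 le_neq_implies_less mem_Collect_eq subsetD)
  qed (use m in force)
  then have "card A = card (C - {m})" using card_succs[OF finV CV] sA V by simp
  then show "card C = Suc (card A)" using finC \<open>m \<in> C\<close> by (metis card.remove)
qed

text \<open>Some entry of \<open>R\<close> lies between \<open>x\<close> and the next entry of \<open>A\<close>; exactly then reverse bumping
  does not change the number of entries of the row below \<open>x\<close>.\<close>

definition gap :: "nat set \<Rightarrow> nat set \<Rightarrow> nat \<Rightarrow> bool" where
  "gap R A x \<longleftrightarrow> (\<exists>r\<in>R. x \<le> r \<and> (\<forall>a\<in>A. x \<le> a \<longrightarrow> r < a))"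

text \<open>Cutting everything at \<open>x\<close> leaves a column insertion again, whose successors
  are the elements of \<open>A\<close> below \<open>x\<close>. By \<open>card_succs\<close> the
  counts differ by one exactly if the largest element below \<open>x\<close> belongs to
  \<open>C\<close>, that is, if the next larger element lies in \<open>A\<close> or does not
  exist.\<close>

lemma card_preds_less:
  fixes R :: "nat multiset"
  assumes A: "finite A" and r: "r \<in># R" "\<forall>a\<in>A. r < a"
    and C: "C = preds (set_mset R) A"
  shows "card {c \<in> C. c < x} = card {a \<in> A. a < x} + (if gap (set_mset R) A x then 0 else 1)"
proof -
  let ?V = "set_mset R \<union> A"
  note sp = succs_preds[OF A r C HOL.refl]
  have finV: "finite ?V" using A by simp
  have CV: "C \<subseteq> ?V" unfolding C by (rule preds_subset)
  have sA: "succs ?V C = A" using sp(3) unfolding sp(2) .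
  define V' where "V' = {v \<in> ?V. v < x}"
  define C' where "C' = {c \<in> C. c < x}"
  have "finite V'" "C' \<subseteq> V'" using finV CV by (auto simp: V'_def C'_def)
  note 1 = card_succs[OF this]
  have 2: "succs V' C' = {a \<in> A. a < x}"
  proof (intro equalityI subsetI)
    fix z assume "z \<in> succs V' C'"
    then obtain c where c: "z \<in> V'" "c \<in> C'" "c < z" "\<forall>v\<in>V'. c < v \<longrightarrow> z \<le> v"
      unfolding succs_def by auto
    have zx: "z \<in> ?V" "z < x" and cC: "c \<in> C" using c(1,2) by (simp_all add: V'_def C'_def)
    have "z \<le> v" if "v \<in> ?V" "c < v" for v
    proof (cases "v < x")
      case True
      then show ?thesis using that c(4) by (simp add: V'_def)
    qed (use zx(2) in simp)
    then have "z \<in> succs ?V C" using zx(1) cC c(3) unfolding succs_def by auto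
    then show "z \<in> {a \<in> A. a < x}" using zx(2) by (simp add: sA)
  next
    fix z assume "z \<in> {a \<in> A. a < x}"
    then have zx: "z \<in> succs ?V C" "z < x" by (simp_all add: sA)
    then obtain c where c: "z \<in> ?V" "c \<in> C" "c < z" "\<forall>v\<in>?V. c < v \<longrightarrow> z \<le> v"
      unfolding succs_def by auto
    then have "c \<in> C'" "z \<in> V'" using zx(2) unfolding C'_def V'_def by simp_all
    moreover have "\<forall>v\<in>V'. c < v \<longrightarrow> z \<le> v" using c(4) by (simp add: V'_def)
    ultimately show "z \<in> succs V' C'" unfolding succs_def using c(3) by auto
  qed
  define D where "D = {c \<in> C'. \<not> (\<exists>v\<in>V'. c < v)}"
  have 3: "C' = {c \<in> C'. \<exists>v\<in>V'. c < v} \<union> D" "{c \<in> C'. \<exists>v\<in>V'. c < v} \<inter> D = {}"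
    unfolding D_def by blast+
  have finC': "finite C'" using sp(1) by (simp add: C'_def)
  have "finite {c \<in> C'. \<exists>v\<in>V'. c < v}" "finite D" using finC' unfolding D_def by simp_all
  from card_Un_disjoint[OF this 3(2)] have 4: "card C' = card {a \<in> A. a < x} + card D"
    unfolding 3(1)[symmetric] 1[symmetric] 2 .
  have "card D = (if gap (set_mset R) A x then 0 else 1)"
  proof (cases "gap (set_mset R) A x")
    case True
    then obtain s where s: "s \<in># R" "x \<le> s" "\<And>a. a \<in> A \<Longrightarrow> x \<le> a \<Longrightarrow> s < a" unfolding gap_def by blast
    have False if "c \<in> D" for c
    proof -
      have c: "c \<in> preds (set_mset R) A" "c < x" "\<not> (\<exists>v\<in>V'. c < v)"
        using that C by (simp_all add: D_def C'_def)
      have "c < s" using c(2) s(2) by simp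
      then obtain a where a: "a \<in> A" "c < a" "a \<le> s" using s(1) c(1) unfolding preds_def by auto
      then have "\<not> a < x" using c(3) unfolding V'_def by auto
      then show False using s(3)[OF a(1)] a(3) by simp
    qed
    then have "D = {}" by auto
    then show ?thesis using True by simp
  next
    case False
    have g: "\<exists>a\<in>A. x \<le> a \<and> a \<le> s" if "s \<in># R" "x \<le> s" for s
      using False that unfolding gap_def by (auto simp: not_less)
    have "r < x"
    proof (rule ccontr)
      assume "\<not> r < x"
      then obtain a where "a \<in> A" "a \<le> r" using g[OF r(1)] by auto
      then show False using r(2) by force
    qed
    then obtain z where z: "z \<in> ?V" "z < x" "\<And>v. v \<in> ?V \<Longrightarrow> v < x \<Longrightarrow> v \<le> z"
      using prev_exists[OF finV, of r x] r by blast
    have "z \<in> C" unfolding C preds_def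
    proof (intro CollectI conjI ballI impI z(1))
      fix s assume s: "s \<in># R" "z < s"
      then have "x \<le> s" using z(3)[of s] by force
      then obtain a where "a \<in> A" "x \<le> a" "a \<le> s" using g[OF s(1)] by auto
      then show "\<exists>a\<in>A. z < a \<and> a \<le> s" using z(2) by (meson less_le_trans)
    qed
    moreover have "c = z" if "c \<in> D" for c
    proof -
      have c: "c \<in> C" "c < x" "\<not> c < z"
        using that z(1,2) by (auto simp: D_def C'_def V'_def)
      then have "c \<in> ?V" using CV by blast
      then have "c \<le> z" using z(3) c(2) by blast
      then show ?thesis using c(3) by simp
    qed
    moreover have "z \<in> D"
      using z \<open>z \<in> C\<close> by (auto simp: D_def C'_def V'_def dest: leD)
    ultimately have "D = {z}" by blast
    then show ?thesis using False by simp
  qed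
  with 4 show ?thesis by (simp add: C'_def)
qed

definition less_count :: "nat multiset \<Rightarrow> nat \<Rightarrow> nat" where
  "less_count M x = size (filter_mset (\<lambda>v. v < x) M)"

lemma less_count_preds:
  fixes R :: "nat multiset"
  assumes A: "finite A" and r: "r \<in># R" "\<forall>a\<in>A. r < a"
    and C: "C = preds (set_mset R) A" and U: "U = R + mset_set A - mset_set C"
  shows "less_count R x = less_count U x + (if gap (set_mset R) A x then 0 else 1)"
proof -
  note sp = succs_preds[OF assms]
  have l: "less_count (M + mset_set B) x = less_count M x + card {b \<in> B. b < x}" if "finite B" for M B
    using that by (simp add: less_count_def)
  have "less_count (U + mset_set C) x = less_count (R + mset_set A) x" using sp(4) by simp
  then show ?thesis using l[OF sp(1)] l[OF A] card_preds_less[OF A r C, of x] by simp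
qed

section \<open>Straight tableaux\<close>

lemma sorted_nth_less_iff:
  fixes xs :: "nat list"
  assumes "sorted xs" "c < length xs"
  shows "xs ! c < x \<longleftrightarrow> c < length (filter (\<lambda>v. v < x) xs)"
  using assms
proof (induction xs arbitrary: c)
  case (Cons a xs)
  show ?case
  proof (cases "a < x")
    case True
    then show ?thesis using Cons by (cases c) auto
  next
    case False
    then have "x \<le> v" if "v \<in> set (a # xs)" for v using that Cons.prems(1) by auto
    moreover from this have "filter (\<lambda>v. v < x) (a # xs) = []" by (auto simp: filter_empty_conv not_less)
    ultimately show ?thesis using Cons.prems(2) by (metis leD length_0_conv less_zeroE nth_mem)
  qed
qed simp

lemma sorted_list_of_multiset_nth_less_iff:
  assumes "c < size M"
  shows "sorted_list_of_multiset M ! c < x \<longleftrightarrow> c < less_count M x"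
proof -
  have "length (filter (\<lambda>v. v < x) (sorted_list_of_multiset M)) = less_count M x"
    unfolding less_count_def by (metis mset_filter mset_sorted_list_of_multiset size_mset)
  then show ?thesis using sorted_nth_less_iff[of "sorted_list_of_multiset M" c x] assms
    by (metis mset_sorted_list_of_multiset size_mset sorted_sorted_list_of_multiset)
qed

lemma length_sorted_list_of_multiset [simp]: "length (sorted_list_of_multiset M) = size M"
  by (metis mset_sorted_list_of_multiset size_mset)

lemma less_count_le: "less_count M x \<le> size M"
  unfolding less_count_def by (rule size_filter_mset_lesseq)

lemma less_count_less: "v \<in># M \<Longrightarrow> x \<le> v \<Longrightarrow> less_count M x < size M"
proof -
  assume "v \<in># M" "x \<le> v"
  then obtain M' where "M = add_mset v M'" by (metis insert_DiffM)
  moreover from this have "less_count M x = less_count M' x"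
    using \<open>x \<le> v\<close> by (simp add: less_count_def)
  ultimately show ?thesis using less_count_le[of M' x] by simp
qed

lemma less_count_eq_size: "(\<And>v. v \<in># M \<Longrightarrow> v < x) \<Longrightarrow> less_count M x = size M"
proof -
  assume "\<And>v. v \<in># M \<Longrightarrow> v < x"
  then have "filter_mset (\<lambda>v. v < x) M = filter_mset (\<lambda>_. True) M" by (intro filter_mset_cong) auto
  then show ?thesis by (simp add: less_count_def)
qed

lemma less_count_less_size:
  assumes "less_count M x < size M"
  shows "\<exists>v\<in>#M. x \<le> v"
proof (rule ccontr)
  assume "\<not> (\<exists>v\<in>#M. x \<le> v)"
  then have "less_count M x = size M" by (intro less_count_eq_size) (simp add: not_le)
  then show False using assms by simp
qed

definition rows_config :: "(nat \<Rightarrow> nat) \<Rightarrow> (nat \<Rightarrow> nat multiset) \<Rightarrow> config" where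
  "rows_config \<mu> M = (\<lambda>(r, c). if (r, c) \<in> diagram \<mu> then Some (sorted_list_of_multiset (M r) ! (c - 1)) else None)"

lemma rows_config_Some:
  "rows_config \<mu> M (r, c) = Some x \<longleftrightarrow> (r, c) \<in> diagram \<mu> \<and> x = sorted_list_of_multiset (M r) ! (c - 1)"
  by (auto simp: rows_config_def)

text \<open>Hypothesis \<open>lc\<close> is column strictness in counting form: row
  \<open>Suc r\<close> has at most as many entries \<open>\<le> x\<close> as row \<open>r\<close>
  has entries \<open>< x\<close>. It can be checked on multisets before any boxes are assigned;
  \<open>less_count_straight\<close> is the converse.\<close>

lemma ssyt_rows_config:
  assumes p: "is_partition \<mu>" and sz: "\<And>r. 1 \<le> r \<Longrightarrow> size (M r) = \<mu> r"
    and lc: "\<And>r x. 1 \<le> r \<Longrightarrow> less_count (M (Suc r)) (Suc x) \<le> less_count (M r) x"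
  shows "ssyt (diagram \<mu>) (rows_config \<mu> M)"
proof -
  have rows: "sorted_list_of_multiset (M r) ! (c - 1) \<le> sorted_list_of_multiset (M r) ! (c' - 1)"
    if "c < c'" "(r, c') \<in> diagram \<mu>" for r c c'
    using that sz[of r] by (intro sorted_nth_mono) (auto simp: diagram_iff)
  have step: "sorted_list_of_multiset (M r) ! (c - 1) < sorted_list_of_multiset (M (Suc r)) ! (c - 1)"
    if "1 \<le> r" "(Suc r, c) \<in> diagram \<mu>" for r c
  proof -
    let ?y = "sorted_list_of_multiset (M (Suc r)) ! (c - 1)"
    have c: "c - 1 < size (M (Suc r))" using that sz[of "Suc r"] by (auto simp: diagram_iff)
    then have "c - 1 < less_count (M (Suc r)) (Suc ?y)"
      using sorted_list_of_multiset_nth_less_iff[OF c, of "Suc ?y"] by simp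
    also have "\<dots> \<le> less_count (M r) ?y" by (rule lc[OF that(1)])
    finally have "c - 1 < less_count (M r) ?y" .
    moreover from this have "c - 1 < size (M r)" using less_count_le[of "M r" ?y] by simp
    ultimately show ?thesis using sorted_list_of_multiset_nth_less_iff by blast
  qed
  have cols: "sorted_list_of_multiset (M r) ! (c - 1) < sorted_list_of_multiset (M r') ! (c - 1)"
    if "r < r'" "1 \<le> r" "(r', c) \<in> diagram \<mu>" for r r' c
    using that
  proof (induction r')
    case (Suc r')
    show ?case
    proof (cases "r = r'")
      case True
      then show ?thesis using step Suc.prems by simp
    next
      case False
      then have "(r', c) \<in> diagram \<mu>"
        using Suc.prems diagram_mono[OF p Suc.prems(3), of r' c] by (simp add: diagram_iff)
      then show ?thesis using Suc step[of r' c] False by simp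
    qed
  qed simp
  have "dom (rows_config \<mu> M) = diagram \<mu>" by (auto simp: rows_config_def split: if_splits)
  then show ?thesis
    unfolding ssyt_def rows_config_Some using rows cols by (auto simp: diagram_iff)
qed

lemma row_columns_straight:
  assumes "ssyt (diagram \<mu>) S" "1 \<le> r"
  shows "row_columns S r = {1..\<mu> r}"
  using ssyt_dom[OF assms(1)] assms(2) by (auto simp: row_columns_def diagram_iff)

lemma mset_map_interval: "image_mset f (mset_set {1..n}) = mset (map f [1..<Suc n])"
  by (metis atLeastLessThanSuc_atLeastAtMost mset_map mset_upt)

lemma row_mset_straight:
  assumes "ssyt (diagram \<mu>) S" "1 \<le> r"
  shows "row_mset S r = mset (map (\<lambda>c. the (S (r, c))) [1..<Suc (\<mu> r)])"
  unfolding row_mset_def row_columns_straight[OF assms] by (rule mset_map_interval)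

lemma size_row_mset:
  assumes "ssyt (diagram \<mu>) S" "1 \<le> r"
  shows "size (row_mset S r) = \<mu> r"
  unfolding row_mset_straight[OF assms] by simp

lemma straight_nth:
  assumes s: "ssyt (diagram \<mu>) S" and rc: "(r, c) \<in> diagram \<mu>"
  shows "S (r, c) = Some (sorted_list_of_multiset (row_mset S r) ! (c - 1))"
proof -
  have r: "1 \<le> r" "1 \<le> c" "c \<le> \<mu> r" using rc by (simp_all add: diagram_iff)
  let ?xs = "map (\<lambda>c. the (S (r, c))) [1..<Suc (\<mu> r)]"
  have some: "\<exists>x. S (r, c) = Some x" if "1 \<le> c" "c \<le> \<mu> r" for c
    using ssyt_dom[OF s] r(1) that by (metis diagram_iff domD)
  have "sorted ?xs"
  proof (rule sorted_iff_nth_mono[THEN iffD2], intro allI impI)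
    fix a b assume ab: "a \<le> b" "b < length ?xs"
    obtain x where "S (r, Suc a) = Some x" using some[of "Suc a"] ab by (auto simp del: upt_Suc)
    moreover obtain y where "S (r, Suc b) = Some y" using some[of "Suc b"] ab by (auto simp del: upt_Suc)
    moreover have "?xs ! a = the (S (r, Suc a))" "?xs ! b = the (S (r, Suc b))" using ab by (simp_all del: upt_Suc)
    ultimately show "?xs ! a \<le> ?xs ! b" using ssyt_row[OF s, of r "Suc a" x "Suc b" y] ab by simp
  qed
  then have "sorted_list_of_multiset (row_mset S r) = ?xs"
    unfolding row_mset_straight[OF s r(1)] sorted_list_of_multiset_mset by (rule sorted_sort_id)
  moreover have "[1..<Suc (\<mu> r)] ! (c - 1) = c" using r by (subst nth_upt) auto
  then have "?xs ! (c - 1) = the (S (r, c))" using r by (simp del: upt_Suc)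
  ultimately show ?thesis using some r by force
qed

text \<open>Row sizes determine the shape, so the two tableaux may come with different shapes; after
  a rectification the shape is only known to be some partition.\<close>

lemma straight_eqI:
  assumes s: "ssyt (diagram \<mu>) S" and s': "ssyt (diagram \<mu>') S'"
    and rows: "\<And>r. 1 \<le> r \<Longrightarrow> row_mset S r = row_mset S' r"
  shows "S = S'"
proof
  fix b :: "nat \<times> nat"
  obtain r c where b: "b = (r, c)" by fastforce
  have d: "(r, c) \<in> diagram \<mu> \<longleftrightarrow> (r, c) \<in> diagram \<mu>'"
    using size_row_mset[OF s, of r] size_row_mset[OF s', of r] rows[of r] by (auto simp: diagram_iff)
  show "S b = S' b"
  proof (cases "(r, c) \<in> diagram \<mu>")
    case True
    moreover from this have "1 \<le> r" by (simp add: diagram_iff)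
    ultimately show ?thesis using straight_nth[OF s, of r c] straight_nth[OF s', of r c] d rows[of r]
      unfolding b by simp
  next
    case False
    then have "b \<notin> dom S" "b \<notin> dom S'" using d ssyt_dom[OF s] ssyt_dom[OF s'] b by auto
    then show ?thesis by (metis domIff)
  qed
qed

lemma row_mset_rows_config:
  assumes "1 \<le> r" "size (M r) = \<mu> r"
  shows "row_mset (rows_config \<mu> M) r = M r"
proof -
  have "row_columns (rows_config \<mu> M) r = {1..\<mu> r}"
    using assms(1) by (auto simp: row_columns_def rows_config_def diagram_iff split: if_splits)
  then have "row_mset (rows_config \<mu> M) r = mset (map (\<lambda>c. the (rows_config \<mu> M (r, c))) [1..<Suc (\<mu> r)])"
    unfolding row_mset_def by (simp only: mset_map_interval)
  also have "map (\<lambda>c. the (rows_config \<mu> M (r, c))) [1..<Suc (\<mu> r)] = sorted_list_of_multiset (M r)"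
    by (rule nth_equalityI) (use assms in \<open>auto simp: rows_config_def diagram_iff simp del: upt_Suc\<close>)
  finally show ?thesis by simp
qed

lemma less_count_straight:
  assumes p: "is_partition \<mu>" and s: "ssyt (diagram \<mu>) S" and r: "1 \<le> r"
  shows "less_count (row_mset S (Suc r)) (Suc x) \<le> less_count (row_mset S r) x"
proof -
  have lc: "less_count (row_mset S r) x = card {c \<in> {1..\<mu> r}. the (S (r, c)) < x}" if "1 \<le> r" for r x
    unfolding less_count_def row_mset_def row_columns_straight[OF s that]
    by (simp add: filter_mset_image_mset)
  show ?thesis unfolding lc[OF r] lc[OF le_SucI[OF r]]
  proof (rule card_mono)
    show "{c \<in> {1..\<mu> (Suc r)}. the (S (Suc r, c)) < Suc x} \<subseteq> {c \<in> {1..\<mu> r}. the (S (r, c)) < x}"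
    proof
      fix c assume c: "c \<in> {c \<in> {1..\<mu> (Suc r)}. the (S (Suc r, c)) < Suc x}"
      then have 1: "(Suc r, c) \<in> diagram \<mu>" by (simp add: diagram_iff)
      then have 2: "(r, c) \<in> diagram \<mu>" using r c diagram_mono[OF p 1, of r c] by simp
      obtain a b where ab: "S (Suc r, c) = Some a" "S (r, c) = Some b"
        using 1 2 ssyt_dom[OF s] by (metis domD)
      then have "b < a" using ssyt_col[OF s ab(2,1)] by simp
      then show "c \<in> {c \<in> {1..\<mu> r}. the (S (r, c)) < x}" using ab c 2 by (simp add: diagram_iff)
    qed
  qed simp
qed

lemma row_mset_below_eq:
  assumes "\<And>c. c \<in> row_columns T r \<Longrightarrow> c < N"
  shows "row_mset_below N T r = row_mset T r"
proof -
  have "{c \<in> row_columns T r. c < N} = row_columns T r" using assms by blast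
  then show ?thesis by (simp add: row_mset_below_def row_mset_def)
qed

definition col_len :: "(nat \<Rightarrow> nat) \<Rightarrow> nat \<Rightarrow> nat" where
  "col_len \<mu> c = card {i. 1 \<le> i \<and> c \<le> \<mu> i}"

lemma col_len_set:
  assumes p: "is_partition \<mu>" and c: "1 \<le> c"
  shows "{i. 1 \<le> i \<and> c \<le> \<mu> i} = {1..col_len \<mu> c}"
proof -
  let ?A = "{i. 1 \<le> i \<and> c \<le> \<mu> i}"
  have fin: "finite ?A"
    by (rule finite_subset[of _ "{i. 1 \<le> i \<and> \<mu> i \<noteq> 0}"]) (use p c in \<open>auto simp: is_partition_def\<close>)
  have "\<exists>k. ?A = {1..k}"
  proof (cases "?A = {}")
    case True
    then show ?thesis by (intro exI[of _ 0]) simp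
  next
    case False
    have h: "i \<in> ?A \<longleftrightarrow> i \<in> {1..Max ?A}" for i
    proof
      assume "i \<in> {1..Max ?A}"
      moreover have "Max ?A \<in> ?A" using fin False by (rule Max_in)
      ultimately show "i \<in> ?A" using is_partition_mono[OF p, of i "Max ?A"] by simp
    next
      assume "i \<in> ?A"
      then show "i \<in> {1..Max ?A}" using Max_ge[OF fin, of i] by simp
    qed
    have "?A = {1..Max ?A}" by (intro Set.set_eqI h)
    then show ?thesis by (rule exI)
  qed
  then obtain k where k: "?A = {1..k}" by blast
  then show ?thesis unfolding col_len_def k by simp
qed

lemma col_len_iff: "is_partition \<mu> \<Longrightarrow> 1 \<le> c \<Longrightarrow> 1 \<le> r \<Longrightarrow> c \<le> \<mu> r \<longleftrightarrow> r \<le> col_len \<mu> c"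
proof -
  assume "is_partition \<mu>" "1 \<le> c" "1 \<le> r"
  then have "r \<in> {i. 1 \<le> i \<and> c \<le> \<mu> i} \<longleftrightarrow> r \<in> {1..col_len \<mu> c}" by (simp only: col_len_set)
  then show ?thesis using \<open>1 \<le> r\<close> by simp
qed

lemma num_columns_straight:
  assumes p: "is_partition \<mu>" and s: "ssyt (diagram \<mu>) S"
  shows "num_columns S = \<mu> 1"
proof -
  have "{c. \<exists>r. (r, c) \<in> dom S} = {1..\<mu> 1}"
  proof (intro equalityI subsetI)
    fix c assume "c \<in> {c. \<exists>r. (r, c) \<in> dom S}"
    then obtain r where "(r, c) \<in> diagram \<mu>" unfolding ssyt_dom[OF s] by blast
    then show "c \<in> {1..\<mu> 1}" using is_partition_mono[OF p, of 1 r] by (simp add: diagram_iff)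
  next
    fix c assume "c \<in> {1..\<mu> 1}"
    then have "(1, c) \<in> diagram \<mu>" by (simp add: diagram_iff)
    then show "c \<in> {c. \<exists>r. (r, c) \<in> dom S}" unfolding ssyt_dom[OF s] by blast
  qed
  then show ?thesis by (simp add: num_columns_def)
qed

lemma column_length_straight:
  assumes "ssyt (diagram \<mu>) S" "1 \<le> c"
  shows "column_length S c = col_len \<mu> c"
  unfolding column_length_def ssyt_dom[OF assms(1)] col_len_def using assms(2) by (simp add: diagram_iff)

text \<open>What has left the rows \<open>k\<close>, ..., \<open>k - d + 1\<close>, treated from the
  bottom up. Starting from the empty set means that row \<open>k\<close> gives up just its
  maximum.\<close>

primrec ejected :: "(nat \<Rightarrow> nat set) \<Rightarrow> nat \<Rightarrow> nat \<Rightarrow> nat set" where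
  "ejected rows k 0 = {}"
| "ejected rows k (Suc d) = preds (rows (k - d)) (ejected rows k d)"

section \<open>The tableaux that define the right key\<close>

lemma word_extend:
  assumes "\<And>c. M \<le> c \<Longrightarrow> column_entries T c = {}" "M \<le> N"
  shows "word N T = word M T"
  using assms(2)
proof (induction N rule: dec_induct)
  case (step n)
  then show ?case using assms(1)[of n] by (simp add: word_Suc)
qed simp

lemma card_preds_greater_eq:
  fixes R :: "nat multiset"
  assumes A: "finite A" and r: "r \<in># R" "\<forall>a\<in>A. r < a"
  shows "card {c \<in> preds (set_mset R) A. x \<le> c} = card {a \<in> A. x \<le> a} + (if gap (set_mset R) A x then 1 else 0)"
proof -
  let ?C = "preds (set_mset R) A"
  note sp = succs_preds[OF A r HOL.refl HOL.refl]
  have split: "card B = card {b \<in> B. b < x} + card {b \<in> B. x \<le> b}" if "finite B" for B :: "nat set"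
  proof -
    have "B = {b \<in> B. b < x} \<union> {b \<in> B. x \<le> b}" by auto
    moreover have "{b \<in> B. b < x} \<inter> {b \<in> B. x \<le> b} = {}" by auto
    ultimately show ?thesis using that card_Un_disjoint[of "{b \<in> B. b < x}" "{b \<in> B. x \<le> b}"] by simp
  qed
  show ?thesis
    using split[OF A] split[OF sp(1)] sp(5) card_preds_less[OF A r HOL.refl, of x]
    by (cases "gap (set_mset R) A x") simp_all
qed

lemma in_row_mset_straight:
  assumes s: "ssyt (diagram \<mu>) S" and r: "1 \<le> r"
  shows "v \<in># row_mset S r \<longleftrightarrow> (\<exists>c. (r, c) \<in> diagram \<mu> \<and> S (r, c) = Some v)"
proof -
  have "v \<in># row_mset S r \<longleftrightarrow> (\<exists>c. (r, c) \<in> diagram \<mu> \<and> v = the (S (r, c)))"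
    unfolding row_mset_def row_columns_straight[OF assms] using r by (auto simp: diagram_iff)
  moreover have "S (r, c) \<noteq> None" if "(r, c) \<in> diagram \<mu>" for c
    using that ssyt_dom[OF s] by (metis domIff)
  ultimately show ?thesis by auto
qed

lemma set_conv_nth_shift:
  assumes "length xs = n"
  shows "{x. \<exists>r. 1 \<le> r \<and> r \<le> n \<and> x = xs ! (r - 1)} = set xs"
proof (intro equalityI subsetI)
  fix x assume "x \<in> {x. \<exists>r. 1 \<le> r \<and> r \<le> n \<and> x = xs ! (r - 1)}"
  then obtain r where r: "1 \<le> r" "r \<le> n" "x = xs ! (r - 1)" by blast
  then have "r - 1 < length xs" using assms by simp
  then show "x \<in> set xs" unfolding r(3) by (rule nth_mem)
next
  fix x assume "x \<in> set xs"
  then obtain i where "i < n" "xs ! i = x" using assms by (auto simp: in_set_conv_nth)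
  then show "x \<in> {x. \<exists>r. 1 \<le> r \<and> r \<le> n \<and> x = xs ! (r - 1)}" by (auto intro!: exI[of _ "Suc i"])
qed

lemma sorted_list_of_set_eqI:
  assumes "sorted_wrt (<) xs" "set xs = A"
  shows "sorted_list_of_set A = xs"
  using assms sorted_list_of_set.idem_if_sorted_distinct strict_sorted_iff by blast

lemma sorted_list_of_set_nth_less_iff:
  assumes "finite A" "i < card A"
  shows "sorted_list_of_set A ! i < x \<longleftrightarrow> i < card {a \<in> A. a < (x::nat)}"
proof -
  let ?xs = "sorted_list_of_set A"
  have "length (filter (\<lambda>v. v < x) ?xs) = card {a \<in> A. a < x}"
    using length_filter_dlist[OF assms(1), of "\<lambda>v. v < x"] unfolding dlist_def
    by (simp only: rev_filter[symmetric] length_rev)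
  then show ?thesis using sorted_nth_less_iff[of ?xs i x] assms by simp
qed

text \<open>\<open>C (r - 1)\<close> is the set of entries that row \<open>r\<close> of \<open>S\<close> sends up when the last boxes of the rows
  \<open>k, \<dots>, 1\<close> are reverse bumped, and \<open>U r\<close> is what remains of row \<open>r\<close>. \<open>TK\<close> is the tableau that defines
  the \<open>j\<close>-th column of the right key.\<close>

locale right_key_column =
  fixes \<mu> :: "nat \<Rightarrow> nat" and S :: config and j :: nat
  assumes p: "is_partition \<mu>" and s: "ssyt (diagram \<mu>) S" and j: "1 \<le> j" "j \<le> \<mu> 1"
begin

definition k where "k = col_len \<mu> j"
definition m where "m = \<mu> 1"
definition q where "q = col_len \<mu> m"
text \<open>The height of the rectangular inner shape; \<open>q\<close> is the length of the last
  column of \<open>S\<close>.\<close>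

definition h where "h = k - q"
definition R where "R = row_mset S"
definition C where "C i = ejected (\<lambda>r. set_mset (R r)) k (k - i)"
definition U where "U r = R r + mset_set (C r) - mset_set (C (r - 1))"
definition \<mu>U where "\<mu>U r = (if r \<le> k then \<mu> r - 1 else \<mu> r)"
definition TU where "TU = rows_config \<mu>U U"
definition TK :: config where "TK = (\<lambda>(r, c).
   if c = m then if 1 \<le> r \<and> r \<le> k then Some (sorted_list_of_set (C 0) ! (r - 1)) else None
   else if c < m \<and> h < r then TU (r - h, c) else None)"

lemma m1: "1 \<le> m" using j by (simp add: m_def)

lemma le_k_iff: "1 \<le> r \<Longrightarrow> r \<le> k \<longleftrightarrow> j \<le> \<mu> r"
  using col_len_iff[OF p j(1)] by (simp add: k_def)

lemma le_q_iff: "1 \<le> r \<Longrightarrow> r \<le> q \<longleftrightarrow> \<mu> r = m"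
  using col_len_iff[OF p m1, of r] is_partition_mono[OF p, of 1 r] by (auto simp: q_def m_def)

lemma k1: "1 \<le> k" using le_k_iff[of 1] j by simp

lemma q1: "1 \<le> q" using le_q_iff[of 1] by (simp add: m_def)

lemma qk: "q \<le> k"
  using le_k_iff[of q] le_q_iff[of q] q1 j by (simp add: m_def)

lemma hqk: "h + q = k" using qk by (simp add: h_def)

lemma size_R: "1 \<le> r \<Longrightarrow> size (R r) = \<mu> r"
  unfolding R_def by (rule size_row_mset[OF s])

lemma C_k: "k \<le> i \<Longrightarrow> C i = {}" by (simp add: C_def)

lemma C_step: "i < k \<Longrightarrow> C i = preds (set_mset (R (Suc i))) (C (Suc i))"
proof -
  assume i: "i < k"
  then have "k - i = Suc (k - Suc i)" by simp
  moreover have "k - (k - Suc i) = Suc i" using i by simp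
  ultimately show ?thesis by (simp add: C_def)
qed

lemma finite_C: "finite (C i)"
proof -
  have "finite (ejected (\<lambda>r. set_mset (R r)) k d)" for d
    by (induction d) (auto intro: finite_subset[OF preds_subset])
  then show ?thesis by (simp add: C_def)
qed

lemma C_from_row: "a \<in> C i \<Longrightarrow> \<exists>r>i. a \<in># R r"
proof (induction "k - i" arbitrary: i)
  case 0
  then show ?case using C_k by simp
next
  case (Suc d)
  then have "a \<in> preds (set_mset (R (Suc i))) (C (Suc i))" using C_step[of i] by simp
  then have "a \<in> set_mset (R (Suc i)) \<union> C (Suc i)" using preds_subset by blast
  then show ?case
  proof
    assume "a \<in> C (Suc i)"
    then have "\<exists>r>Suc i. a \<in># R r" using Suc.hyps(1)[of "Suc i"] Suc.hyps(2) by simp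
    then show ?case by (meson Suc_lessD)
  qed blast
qed

text \<open>Supplies the hypothesis of \<open>succs_preds\<close>: the first entry of a row is
  smaller than everything arriving from the rows below.\<close>

lemma row_bound: "\<exists>r\<in>#R (Suc i). \<forall>a\<in>C (Suc i). r < a" if "i < k"
proof -
  have "1 \<le> \<mu> (Suc i)" using le_k_iff[of "Suc i"] that j by simp
  then have "(Suc i, 1) \<in> diagram \<mu>" by (simp add: diagram_iff)
  then obtain r where r: "S (Suc i, 1) = Some r" using ssyt_dom[OF s] by (metis domD)
  have 1: "r \<in># R (Suc i)"
    using r \<open>(Suc i, 1) \<in> diagram \<mu>\<close> in_row_mset_straight[OF s, of "Suc i" r] unfolding R_def by auto
  have "r < a" if aC: "a \<in> C (Suc i)" for a
  proof -
    obtain r' where r': "Suc i < r'" "a \<in># R r'" using C_from_row[OF aC] by blast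
    then obtain c where d: "(r', c) \<in> diagram \<mu>" and c: "S (r', c) = Some a"
      using in_row_mset_straight[OF s, of r' a] unfolding R_def by auto
    have "1 \<le> c" using d by (simp add: diagram_iff)
    have d1: "(r', 1) \<in> diagram \<mu>" using d by (auto simp: diagram_iff)
    obtain y where "S (r', 1) = Some y" using d1 ssyt_dom[OF s] by (metis domD)
    then show ?thesis
      using ssyt_row[OF s _ c, of 1 y] ssyt_col[OF s r, of r' y] r' \<open>1 \<le> c\<close> by simp
  qed
  with 1 show ?thesis by blast
qed

lemma
  assumes "i < k"
  shows U_C: "set_mset (U (Suc i)) \<union> C i = set_mset (R (Suc i)) \<union> C (Suc i)"
    and succs_C: "succs (set_mset (U (Suc i)) \<union> C i) (C i) = C (Suc i)"
    and U_plus: "U (Suc i) + mset_set (C i) = R (Suc i) + mset_set (C (Suc i))"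
    and card_C: "card (C i) = Suc (card (C (Suc i)))"
    and less_count_U: "less_count (R (Suc i)) x =
      less_count (U (Suc i)) x + (if gap (set_mset (R (Suc i))) (C (Suc i)) x then 0 else 1)"
    and card_C_ge: "card {c \<in> C i. y \<le> c} = card {a \<in> C (Suc i). y \<le> a} +
      (if gap (set_mset (R (Suc i))) (C (Suc i)) y then 1 else 0)"
proof -
  obtain r where r: "r \<in># R (Suc i)" "\<forall>a\<in>C (Suc i). r < a" using row_bound[OF assms] by blast
  have u: "U (Suc i) = R (Suc i) + mset_set (C (Suc i)) - mset_set (C i)" by (simp add: U_def)
  note sp = succs_preds[OF finite_C r C_step[OF assms] u]
  show "set_mset (U (Suc i)) \<union> C i = set_mset (R (Suc i)) \<union> C (Suc i)"
    "succs (set_mset (U (Suc i)) \<union> C i) (C i) = C (Suc i)"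
    "U (Suc i) + mset_set (C i) = R (Suc i) + mset_set (C (Suc i))"
    "card (C i) = Suc (card (C (Suc i)))"
    by (rule sp)+
  show "less_count (R (Suc i)) x =
      less_count (U (Suc i)) x + (if gap (set_mset (R (Suc i))) (C (Suc i)) x then 0 else 1)"
    by (rule less_count_preds[OF finite_C r C_step[OF assms] u])
  show "card {c \<in> C i. y \<le> c} = card {a \<in> C (Suc i). y \<le> a} +
      (if gap (set_mset (R (Suc i))) (C (Suc i)) y then 1 else 0)"
    unfolding C_step[OF assms] by (rule card_preds_greater_eq[OF finite_C r])
qed

lemma U_ge: "k \<le> i \<Longrightarrow> U (Suc i) = R (Suc i)"
  by (simp add: U_def C_k)

lemma card_C0: "i \<le> k \<Longrightarrow> card (C i) = k - i"
proof (induction "k - i" arbitrary: i)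
  case 0
  then show ?case by (simp add: C_k)
next
  case (Suc d)
  then show ?case using card_C[of i] by simp
qed

lemma size_U: "1 \<le> r \<Longrightarrow> size (U r) = \<mu>U r"
proof -
  assume "1 \<le> r"
  then obtain i where i: "r = Suc i" by (cases r) auto
  show ?thesis
  proof (cases "i < k")
    case True
    have "size (U (Suc i)) + card (C i) = size (R (Suc i)) + card (C (Suc i))"
      using arg_cong[OF U_plus[OF True], of size] by simp
    then show ?thesis using card_C[OF True] size_R[of "Suc i"] True by (simp add: i \<mu>U_def)
  next
    case False
    then show ?thesis using U_ge[of i] size_R[of r] by (simp add: i \<mu>U_def)
  qed
qed

lemma \<mu>U_partition: "is_partition \<mu>U"
  unfolding is_partition_def
proof (intro conjI allI impI)
  fix a b :: nat assume ab: "1 \<le> a \<and> a \<le> b"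
  then have "\<mu> b \<le> \<mu> a" using is_partition_mono[OF p] by blast
  then show "\<mu>U b \<le> \<mu>U a" using ab le_k_iff[of a] le_k_iff[of b] by (auto simp: \<mu>U_def)
next
  show "finite {i. 1 \<le> i \<and> \<mu>U i \<noteq> 0}"
    by (rule finite_subset[of _ "{i. 1 \<le> i \<and> \<mu> i \<noteq> 0}"])
      (use p in \<open>auto simp: is_partition_def \<mu>U_def split: if_splits\<close>)
qed

lemma \<mu>U_less: "1 \<le> r \<Longrightarrow> \<mu>U r < m"
  using le_k_iff[of r] is_partition_mono[OF p, of 1 r] j m1 by (auto simp: \<mu>U_def m_def)

text \<open>By \<open>less_count_U\<close> each count drops by at most one. For two rows that both
  lose a box, strictness could fail only if the count of the upper row drops, that of the lower row
  does not, and the two counts were equal before.\<close>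

lemma U_columns:
  assumes "1 \<le> r"
  shows "less_count (U (Suc r)) (Suc x) \<le> less_count (U r) x"
proof -
  obtain i where i: "r = Suc i" using assms by (cases r) auto
  have RR: "less_count (R (Suc r)) (Suc x) \<le> less_count (R r) x"
    unfolding R_def by (rule less_count_straight[OF p s assms])
  consider "k \<le> i" | "r = k" | "r < k" using i by linarith
  then show ?thesis
  proof cases
    case 1
    then show ?thesis using RR U_ge[of i] U_ge[of r] i by simp
  next
    case 2
    then have ik: "i < k" using i by simp
    have Ur: "U (Suc r) = R (Suc r)" using U_ge[of r] 2 by simp
    show ?thesis
    proof (cases "gap (set_mset (R r)) (C r) x")
      case True
      then show ?thesis using less_count_U[OF ik, of x] RR i Ur by simp
    next
      case False
      then have "v < x" if "v \<in># R r" for v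
        using that 2 C_k[of r] by (auto simp: gap_def not_le)
      then have "less_count (R r) x = \<mu> r" using less_count_eq_size size_R[OF assms] by metis
      then have "less_count (U r) x = \<mu> r - 1" using less_count_U[OF ik, of x] False i by simp
      \<comment> \<open>Column \<open>j\<close> ends in row \<open>k\<close>, so row
        \<open>k\<close> is strictly longer than the next one and can afford the loss.\<close>
      moreover have "\<mu> (Suc r) < \<mu> r" using le_k_iff[of r] le_k_iff[of "Suc r"] 2 assms by simp
      ultimately show ?thesis
        using less_count_le[of "R (Suc r)" "Suc x"] size_R[of "Suc r"] Ur by simp
    qed
  next
    case 3
    then have ik: "i < k" using i by simp
    note lr = less_count_U[OF ik, of x] and lr' = less_count_U[OF 3, of "Suc x"]
    show ?thesis
    proof (cases "gap (set_mset (R r)) (C r) x")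
      case True
      then show ?thesis using lr lr' RR i by simp
    next
      case g: False
      show ?thesis
      proof (cases "gap (set_mset (R (Suc r))) (C (Suc r)) (Suc x)")
        case False
        then show ?thesis using lr lr' RR i g by simp
      next
        case True
        then obtain r0 where r0: "r0 \<in># R (Suc r)" "Suc x \<le> r0"
            "\<And>a. a \<in> C (Suc r) \<Longrightarrow> Suc x \<le> a \<Longrightarrow> r0 < a" unfolding gap_def by blast
        \<comment> \<open>If both counts equal \<open>c\<close>, column \<open>Suc c\<close>
          contains the first entry \<open>z \<ge> x\<close> of row \<open>r\<close> and the first
          entry \<open>y > x\<close> of row \<open>Suc r\<close>. The missing gap at
          \<open>x\<close> gives \<open>a\<close> in \<open>C r\<close> with
          \<open>x \<le> a \<le> z\<close>, and membership of \<open>a\<close> gives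
          \<open>a'\<close> in \<open>C (Suc r)\<close> with \<open>a < a' \<le> y\<close>. The gap
          entry \<open>r0 > x\<close> lies below \<open>a'\<close>, hence below \<open>y\<close>,
          against the choice of \<open>y\<close>.\<close>
        have "less_count (R (Suc r)) (Suc x) \<noteq> less_count (R r) x"
        proof
          define c where "c = less_count (R r) x"
          assume eq: "less_count (R (Suc r)) (Suc x) = less_count (R r) x"
          have c: "c < \<mu> (Suc r)"
            using less_count_less[OF r0(1,2)] size_R[of "Suc r"] eq by (simp add: c_def)
          have d: "(Suc r, Suc c) \<in> diagram \<mu>" using c by (simp add: diagram_iff)
          have d': "(r, Suc c) \<in> diagram \<mu>"
            using diagram_mono[OF p d, of r "Suc c"] assms by simp
          define y where "y = sorted_list_of_multiset (R (Suc r)) ! c"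
          define z where "z = sorted_list_of_multiset (R r) ! c"
          have Sy: "S (Suc r, Suc c) = Some y" using straight_nth[OF s d] by (simp add: y_def R_def)
          have Sz: "S (r, Suc c) = Some z" using straight_nth[OF s d'] by (simp add: z_def R_def)
          have zy: "z < y" using ssyt_col[OF s Sz Sy] by simp
          have sz: "c < size (R (Suc r))" "c < size (R r)"
            using c size_R[of "Suc r"] size_R[OF assms] d' by (simp_all add: diagram_iff)
          have "\<not> z < x" using sorted_list_of_multiset_nth_less_iff[OF sz(2), of x] by (simp add: z_def c_def)
          moreover have "z \<in># R r" unfolding z_def using sz(2)
            by (metis length_sorted_list_of_multiset nth_mem set_sorted_list_of_multiset)
          ultimately obtain a where a: "a \<in> C r" "x \<le> a" "a \<le> z"
            using g unfolding gap_def by (auto simp: not_less)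
          have yR: "y \<in># R (Suc r)" unfolding y_def using sz(1)
            by (metis length_sorted_list_of_multiset nth_mem set_sorted_list_of_multiset)
          obtain a' where a': "a' \<in> C (Suc r)" "a < a'" "a' \<le> y"
            using a(1,3) yR zy unfolding C_step[OF 3] preds_def by auto
          have "r0 < a'" using r0(3)[OF a'(1)] a' a by simp
          then have "r0 < y" using a' by simp
          have "c < less_count (R (Suc r)) (Suc r0)"
          proof -
            obtain n where n: "n < size (R (Suc r))" "sorted_list_of_multiset (R (Suc r)) ! n = r0"
              using r0(1) by (metis in_set_conv_nth length_sorted_list_of_multiset set_sorted_list_of_multiset)
            have "\<not> n < c" using sorted_list_of_multiset_nth_less_iff[OF n(1), of "Suc x"] n(2) r0(2) eq
              by (simp add: c_def)
            then show ?thesis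
              using sorted_list_of_multiset_nth_less_iff[OF n(1), of "Suc r0"] n(2) by simp
          qed
          then have "y < Suc r0" using sorted_list_of_multiset_nth_less_iff[OF sz(1), of "Suc r0"]
            by (simp add: y_def)
          then show False using \<open>r0 < y\<close> by simp
        qed
        then show ?thesis using lr lr' RR i g by simp
      qed
    qed
  qed
qed

lemma ssyt_TU: "ssyt (diagram \<mu>U) TU"
  unfolding TU_def by (rule ssyt_rows_config[OF \<mu>U_partition size_U U_columns])

lemma row_mset_TU: "1 \<le> r \<Longrightarrow> row_mset TU r = U r"
  unfolding TU_def by (rule row_mset_rows_config[of r U \<mu>U, OF _ size_U])

text \<open>Prepares the row condition at the last column of \<open>TK\<close>. Row \<open>r\<close>
  of \<open>U\<close> stands in row \<open>r + h\<close>, and the entry of the last column there has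
  \<open>q - r + 1\<close> elements of \<open>C 0\<close> weakly above it. From row \<open>q\<close>
  upwards, a larger entry of the next row provides all but one of the required elements; the last
  one comes from a gap at \<open>u\<close> or from \<open>u\<close> itself.\<close>

lemma C_ge:
  assumes "r \<le> q" "1 \<le> r" "u \<in># U r"
  shows "Suc (q - r) \<le> card {c \<in> C (r - 1). u \<le> c}"
  using assms
proof (induction "q - r" arbitrary: r u)
  case d: 0
  then have r: "r = q" by simp
  obtain i where i: "r = Suc i" using d by (cases r) auto
  have ik: "i < k" and ri: "r - 1 = i" using i r qk by simp_all
  show ?case
  proof (cases "\<exists>a\<in>C r. u \<le> a")
    case True
    then have "{a \<in> C r. u \<le> a} \<noteq> {}" by blast
    then have "0 < card {a \<in> C r. u \<le> a}" using finite_C by (simp add: card_gt_0_iff)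
    then show ?thesis unfolding ri using card_C_ge[OF ik, of u] r i by simp
  next
    case False
    then have "u \<in># R r" using U_C[OF ik] d i by auto
    then have "gap (set_mset (R r)) (C r) u" using False unfolding gap_def by blast
    then show ?thesis unfolding ri using card_C_ge[OF ik, of u] r i by simp
  qed
next
  case (Suc d)
  obtain i where i: "r = Suc i" using Suc by (cases r) auto
  have ik: "i < k" "r < k" using i qk Suc by simp_all
  have "Suc r \<le> q" using Suc.hyps(2) by simp
  \<comment> \<open>The rows up to \<open>q\<close> have full length in \<open>S\<close>, so rows
    \<open>r\<close> and \<open>Suc r\<close> of \<open>U\<close> are equally long; this yields an
    entry of the next row larger than \<open>u\<close>.\<close>
  then have "\<mu>U r = m - 1" "\<mu>U (Suc r) = m - 1"
    using le_q_iff[of r] le_q_iff[of "Suc r"] Suc.prems qk by (simp_all add: \<mu>U_def)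
  then have "size (U (Suc r)) = size (U r)" using size_U[of r] size_U[of "Suc r"] Suc by simp
  moreover have "less_count (U r) u < size (U r)" using less_count_less[OF Suc.prems(3)] by simp
  ultimately have "less_count (U (Suc r)) (Suc u) < size (U (Suc r))"
    using U_columns[of r u] Suc.prems by simp
  then obtain v where v: "v \<in># U (Suc r)" "Suc u \<le> v" using less_count_less_size by blast
  have "Suc (q - Suc r) = q - r" using \<open>Suc r \<le> q\<close> by simp
  moreover have "Suc (q - Suc r) \<le> card {c \<in> C (Suc r - 1). v \<le> c}"
    by (rule Suc.hyps(1)) (use Suc.hyps(2) \<open>Suc r \<le> q\<close> v in simp_all)
  ultimately have IH: "q - r \<le> card {c \<in> C r. v \<le> c}" by simp
  have sub: "{c \<in> C r. v \<le> c} \<subseteq> {c \<in> C r. u \<le> c}" using v by auto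
  show ?case
  proof (cases "u \<in> C r")
    case True
    then have "insert u {c \<in> C r. v \<le> c} \<subseteq> {c \<in> C r. u \<le> c}" using sub by auto
    from card_mono[OF _ this] have "Suc (card {c \<in> C r. v \<le> c}) \<le> card {c \<in> C r. u \<le> c}"
      using finite_C v(2) by simp
    then show ?thesis using card_C_ge[OF ik(1), of u] IH i by simp
  next
    case False
    have le: "q - r \<le> card {c \<in> C r. u \<le> c}" using IH card_mono[OF _ sub] finite_C by simp
    have uR: "u \<in># R r" using U_C[OF ik(1)] Suc.prems(3) False i by auto
    show ?thesis
    proof (cases "gap (set_mset (R r)) (C r) u")
      case True
      then show ?thesis using card_C_ge[OF ik(1), of u] le i by simp
    next
      case g: False
      \<comment> \<open>An impossible case: as \<open>u\<close> lies in the row but not in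
        \<open>C r\<close>, it witnesses the gap at \<open>u\<close>.\<close>
      then show ?thesis using uR False unfolding gap_def by (metis le_neq_implies_less order_refl)
    qed
  qed
qed

lemma C_mono_card: "card {c \<in> C i. x \<le> c} \<le> card {c \<in> C 0. x \<le> c}"
proof (induction i)
  case (Suc i)
  show ?case
  proof (cases "i < k")
    case True
    then show ?thesis using Suc card_C_ge[OF True, of x] by simp
  qed (simp add: C_k)
qed simp

lemma \<mu>U_q: "1 \<le> r \<Longrightarrow> r \<le> q \<Longrightarrow> \<mu>U r = m - 1"
  using le_q_iff[of r] qk by (simp add: \<mu>U_def)

text \<open>Deleting column \<open>j\<close> of the diagram moves the later columns one step left,
  which shortens exactly the rows \<open>1\<close>, ..., \<open>k\<close> by one; this is the
  passage from \<open>\<mu>\<close> to \<open>\<mu>U\<close>.\<close>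

lemma right_key_shape_iff:
  "(r, c) \<in> right_key_shape S j \<longleftrightarrow>
    c = m \<and> 1 \<le> r \<and> r \<le> k \<or> c < m \<and> h < r \<and> (r - h, c) \<in> diagram \<mu>U"
proof -
  have nc: "num_columns S = m" using num_columns_straight[OF p s] by (simp add: m_def)
  have cl: "column_length S c = col_len \<mu> c" if "1 \<le> c" for c
    by (rule column_length_straight[OF s that])
  have d: "(r', c) \<in> diagram \<mu>U \<longleftrightarrow> r' \<le> (if c < j then column_length S c else column_length S (Suc c))"
    if "1 \<le> r'" "1 \<le> c" for r'
  proof (cases "r' \<le> k")
    case True
    then have "j \<le> \<mu> r'" using le_k_iff that by simp
    then have "c < j \<Longrightarrow> r' \<le> col_len \<mu> c" using col_len_iff[OF p that(2,1)] by simp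
    then show ?thesis
      using True that \<open>j \<le> \<mu> r'\<close> col_len_iff[OF p _ that(1), of "Suc c"] cl[of c] cl[of "Suc c"]
      by (auto simp: diagram_iff \<mu>U_def)
  next
    case False
    then have "\<mu> r' < j" using le_k_iff that by simp
    then show ?thesis
      using False that col_len_iff[OF p _ that(1), of "Suc c"] col_len_iff[OF p that(2,1)]
        cl[of c] cl[of "Suc c"]
      by (auto simp: diagram_iff \<mu>U_def)
  qed
  have b: "column_length S j = k" "column_length S m = q"
    using cl[OF j(1)] cl[OF m1] by (simp_all add: k_def q_def)
  have h: "h = k - q" by (rule h_def)
  have mem: "(r, c) \<in> right_key_shape S j \<longleftrightarrow>
    1 \<le> c \<and> c \<le> m \<and> (if c < m then h else 0) < r \<and>
    r \<le> (if c < m then h else 0) + (if c = m then k else if c < j then column_length S c else column_length S (Suc c))"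
    unfolding right_key_shape_def Let_def nc b h by simp
  show ?thesis
  proof (cases "c < m")
    case True
    have "(r - h, c) \<in> diagram \<mu>U \<longleftrightarrow> 1 \<le> c \<and>
        r - h \<le> (if c < j then column_length S c else column_length S (Suc c))" if "h < r"
      using d[of "r - h"] that by (cases "1 \<le> c") (auto simp: diagram_iff)
    then show ?thesis unfolding mem using True by auto
  next
    case False
    then show ?thesis unfolding mem using m1 by auto
  qed
qed

text \<open>The first \<open>k\<close> rows of the outer shape are full: the rectangle, and below it
  the first \<open>q\<close> rows of \<open>\<mu>U\<close>, are \<open>m - 1\<close> wide, and the
  last column adds one box.\<close>

definition \<kappa> where "\<kappa> r = (if r \<le> k then m else \<mu>U (r - h))"
definition \<nu> where "\<nu> r = (if r \<le> h then m - 1 else 0)"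

lemma skew_shape: "skew \<kappa> \<nu>" "right_key_shape S j = diagram \<kappa> - diagram \<nu>"
proof -
  have hk: "h \<le> k" using hqk by simp
  have "is_partition \<kappa>" unfolding is_partition_def
  proof (intro conjI allI impI)
    fix a b :: nat assume ab: "1 \<le> a \<and> a \<le> b"
    show "\<kappa> b \<le> \<kappa> a"
    proof (cases "a \<le> k")
      case True
      then show ?thesis using \<mu>U_less[of "b - h", THEN less_imp_le] hk ab by (auto simp: \<kappa>_def)
    next
      case False
      then show ?thesis
        using ab hk is_partition_mono[OF \<mu>U_partition, of "a - h" "b - h"] by (simp add: \<kappa>_def)
    qed
  next
    have "finite ((\<lambda>i. i + h) ` {i. 1 \<le> i \<and> \<mu>U i \<noteq> 0})"
      using \<mu>U_partition by (auto simp: is_partition_def)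
    moreover have "{i. 1 \<le> i \<and> \<kappa> i \<noteq> 0} \<subseteq> {..k} \<union> (\<lambda>i. i + h) ` {i. 1 \<le> i \<and> \<mu>U i \<noteq> 0}"
    proof
      fix i assume i: "i \<in> {i. 1 \<le> i \<and> \<kappa> i \<noteq> 0}"
      show "i \<in> {..k} \<union> (\<lambda>i. i + h) ` {i. 1 \<le> i \<and> \<mu>U i \<noteq> 0}"
      proof (cases "i \<le> k")
        case False
        then have "i = (i - h) + h" "i - h \<in> {i. 1 \<le> i \<and> \<mu>U i \<noteq> 0}"
          using i hk by (auto simp: \<kappa>_def)
        then show ?thesis by blast
      qed simp
    qed
    ultimately show "finite {i. 1 \<le> i \<and> \<kappa> i \<noteq> 0}" using finite_subset by blast
  qed
  moreover have "is_partition \<nu>" unfolding is_partition_def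
  proof (intro conjI allI impI)
    show "finite {i. 1 \<le> i \<and> \<nu> i \<noteq> 0}" by (rule finite_subset[of _ "{..h}"]) (auto simp: \<nu>_def split: if_splits)
  qed (auto simp: \<nu>_def)
  moreover have "diagram \<nu> \<subseteq> diagram \<kappa>"
    using hk by (auto simp: diagram_def \<nu>_def \<kappa>_def split: if_splits)
  ultimately show "skew \<kappa> \<nu>" by (simp add: skew_def)
  have "(r, c) \<in> right_key_shape S j \<longleftrightarrow> (r, c) \<in> diagram \<kappa> \<and> (r, c) \<notin> diagram \<nu>" for r c
  proof -
    consider "r \<le> h" | "h < r" "r \<le> k" | "k < r" by linarith
    then show ?thesis
    proof cases
      case 1
      then show ?thesis unfolding right_key_shape_iff using hk m1 by (auto simp: diagram_iff \<kappa>_def \<nu>_def)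
    next
      case 2
      then have "\<mu>U (r - h) = m - 1" using \<mu>U_q[of "r - h"] hqk by simp
      then show ?thesis unfolding right_key_shape_iff using 2 m1 by (auto simp: diagram_iff \<kappa>_def \<nu>_def)
    next
      case 3
      then have "\<mu>U (r - h) < m" using hk \<mu>U_less[of "r - h"] by simp
      then show ?thesis unfolding right_key_shape_iff
        using 3 hk by (auto simp: diagram_iff \<kappa>_def \<nu>_def)
    qed
  qed
  then show "right_key_shape S j = diagram \<kappa> - diagram \<nu>" by auto
qed

lemma nth_C_less_iff:
  assumes "i < k"
  shows "sorted_list_of_set (C 0) ! i < x \<longleftrightarrow> i < card {c \<in> C 0. c < x}"
  using sorted_list_of_set_nth_less_iff[OF finite_C, of i 0 x] assms card_C0[of 0] by simp

lemma TK_m: "TK (r, m) = Some x \<longleftrightarrow> 1 \<le> r \<and> r \<le> k \<and> x = sorted_list_of_set (C 0) ! (r - 1)"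
  by (auto simp: TK_def)

lemma TK_below: "c < m \<Longrightarrow> TK (r, c) = (if h < r then TU (r - h, c) else None)"
  by (simp add: TK_def)

lemma TK_above: "m < c \<Longrightarrow> TK (r, c) = None"
  by (simp add: TK_def)

lemma ssyt_TK: "ssyt (right_key_shape S j) TK"
proof -
  have "(r, c) \<in> dom TK \<longleftrightarrow> (r, c) \<in> right_key_shape S j" for r c
  proof -
    have "(r - h, c) \<in> dom TU \<longleftrightarrow> (r - h, c) \<in> diagram \<mu>U" using ssyt_dom[OF ssyt_TU] by simp
    then show ?thesis unfolding right_key_shape_iff by (auto simp: TK_def split: if_splits)
  qed
  then have dom: "dom TK = right_key_shape S j" by auto
  have last: "x \<le> y" if "c < m" "TK (r, c) = Some x" "TK (r, m) = Some y" for r c x y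
  proof -
    have r: "1 \<le> r" "r \<le> k" and y: "y = sorted_list_of_set (C 0) ! (r - 1)" using that(3) TK_m by auto
    have hr: "h < r" and x: "TU (r - h, c) = Some x" using that(1,2) by (auto simp: TK_below split: if_splits)
    have "(r - h, c) \<in> diagram \<mu>U" using x ssyt_dom[OF ssyt_TU] by blast
    then have "x \<in># U (r - h)"
      using in_row_mset_straight[OF ssyt_TU, of "r - h" x] row_mset_TU[of "r - h"] x hr by auto
    then have "Suc (q - (r - h)) \<le> card {c \<in> C (r - h - 1). x \<le> c}"
      using C_ge[of "r - h" x] hr r hqk by simp
    also have "\<dots> \<le> card {c \<in> C 0. x \<le> c}" by (rule C_mono_card)
    finally have ge: "Suc (q - (r - h)) \<le> card {c \<in> C 0. x \<le> c}" .
    have "C 0 = {c \<in> C 0. c < x} \<union> {c \<in> C 0. x \<le> c}" "{c \<in> C 0. c < x} \<inter> {c \<in> C 0. x \<le> c} = {}" by auto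
    then have "k = card {c \<in> C 0. c < x} + card {c \<in> C 0. x \<le> c}"
      using card_C0[of 0] finite_C[of 0] card_Un_disjoint[of "{c \<in> C 0. c < x}" "{c \<in> C 0. x \<le> c}"] by simp
    \<comment> \<open>Here \<open>q - (r - h) = k - r\<close>, so at most \<open>r - 1\<close>
      elements of \<open>C 0\<close> are smaller than \<open>x\<close>.\<close>
    then have "\<not> r - 1 < card {c \<in> C 0. c < x}" using ge hqk hr r by simp
    then have "\<not> y < x" using nth_C_less_iff[of "r - 1" x] r y by simp
    then show ?thesis by simp
  qed
  show ?thesis unfolding ssyt_def
  proof (intro conjI allI impI dom)
    fix r c c' x y assume a: "c < c' \<and> TK (r, c) = Some x \<and> TK (r, c') = Some y"
    consider "c' = m" | "c' < m" using TK_above[of c' r] a by fastforce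
    then show "x \<le> y"
    proof cases
      case 1
      then show ?thesis using last a by blast
    next
      case 2
      then show ?thesis using a TK_below[of c r] TK_below[of c' r] ssyt_row[OF ssyt_TU, of "r - h" c x c' y]
        by (simp split: if_splits)
    qed
  next
    fix r r' c x y assume a: "r < r' \<and> TK (r, c) = Some x \<and> TK (r', c) = Some y"
    consider "c = m" | "c < m" using TK_above[of c r] a by fastforce
    then show "x < y"
    proof cases
      case 1
      then have "x = sorted_list_of_set (C 0) ! (r - 1)" "y = sorted_list_of_set (C 0) ! (r' - 1)"
        "1 \<le> r" "r' \<le> k" using a TK_m by auto
      moreover have "sorted_wrt (<) (sorted_list_of_set (C 0))" by simp
      moreover from calculation have "r - 1 < r' - 1" "r' - 1 < k" using a by linarith+
      ultimately show ?thesis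
        using a card_C0[of 0] sorted_wrt_nth_less[of "(<)" "sorted_list_of_set (C 0)" "r - 1" "r' - 1"] by simp
    next
      case 2
      then have "h < r" "TU (r - h, c) = Some x" "TU (r' - h, c) = Some y"
        using a by (auto simp: TK_below split: if_splits)
      moreover from this have "r - h < r' - h" using a by linarith
      ultimately show ?thesis using ssyt_col[OF ssyt_TU] by blast
    qed
  qed
qed

text \<open>The columns before the last, moved up by the height of the rectangle. The column word
  does not see this shift, so a tableau of the prescribed shape reads as a straight tableau followed
  by one column.\<close>

definition UT :: "config \<Rightarrow> config" where
  "UT T = (\<lambda>(r, c). if 1 \<le> r \<and> c < m then T (r + h, c) else None)"

lemma ssyt_UT:
  assumes "ssyt (right_key_shape S j) T"
  shows "ssyt (diagram \<mu>U) (UT T)"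
proof -
  have "(r, c) \<in> dom (UT T) \<longleftrightarrow> (r, c) \<in> diagram \<mu>U" for r c
  proof -
    have "(r + h, c) \<in> dom T \<longleftrightarrow> (r + h, c) \<in> right_key_shape S j" using ssyt_dom[OF assms] by simp
    then show ?thesis unfolding right_key_shape_iff using \<mu>U_less[of r]
      by (auto simp: UT_def diagram_iff split: if_splits)
  qed
  then have "dom (UT T) = diagram \<mu>U" by auto
  then show ?thesis unfolding ssyt_def UT_def
    using ssyt_row[OF assms] ssyt_col[OF assms] by (auto split: if_splits)
qed

lemma last_column:
  assumes "ssyt (right_key_shape S j) T"
  shows "finite (column_entries T m)" "card (column_entries T m) = k"
    "1 \<le> r \<Longrightarrow> r \<le> k \<Longrightarrow> T (r, m) = Some (sorted_list_of_set (column_entries T m) ! (r - 1))"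
proof -
  let ?xs = "map (\<lambda>r. the (T (r, m))) [1..<Suc k]"
  have dm: "(r, m) \<in> dom T \<longleftrightarrow> 1 \<le> r \<and> r \<le> k" for r
    unfolding ssyt_dom[OF assms] right_key_shape_iff by simp
  have lt: "the (T (a, m)) < the (T (b, m))" if "a < b" "1 \<le> a" "b \<le> k" for a b
  proof -
    have "(a, m) \<in> dom T" "(b, m) \<in> dom T" unfolding dm using that by simp_all
    then obtain x y where "T (a, m) = Some x" "T (b, m) = Some y" by blast
    then show ?thesis using ssyt_col[OF assms, of a m x b y] that by simp
  qed
  have st: "sorted_wrt (<) ?xs"
    unfolding sorted_wrt_iff_nth_less by (auto simp del: upt_Suc intro!: lt)
  have set: "set ?xs = column_entries T m"
  proof (intro equalityI subsetI)
    fix x assume "x \<in> set ?xs"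
    then obtain r where r: "1 \<le> r" "r \<le> k" "x = the (T (r, m))" by (auto simp del: upt_Suc)
    then have "(r, m) \<in> dom T" unfolding dm by simp
    then show "x \<in> column_entries T m" using r(3) by (auto simp: column_entries_def)
  next
    fix x assume "x \<in> column_entries T m"
    then obtain r where r: "T (r, m) = Some x" by (auto simp: column_entries_def)
    then have "1 \<le> r \<and> r \<le> k" using dm[of r] by blast
    then have "x = the (T (r, m))" "r \<in> set [1..<Suc k]" using r by (simp_all del: upt_Suc)
    then show "x \<in> set ?xs" unfolding set_map by (rule image_eqI)
  qed
  note e = sorted_list_of_set_eqI[OF st set]
  show "finite (column_entries T m)" unfolding set[symmetric] by (rule List.finite_set)
  have "length (sorted_list_of_set (column_entries T m)) = k" unfolding e by (simp del: upt_Suc)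
  then show "card (column_entries T m) = k" by simp
  assume r: "1 \<le> r" "r \<le> k"
  then have "(r, m) \<in> dom T" unfolding dm by simp
  moreover have "[1..<Suc k] ! (r - 1) = r" using r by (subst nth_upt) auto
  then have "?xs ! (r - 1) = the (T (r, m))" using r by (simp del: upt_Suc)
  ultimately show "T (r, m) = Some (sorted_list_of_set (column_entries T m) ! (r - 1))"
    unfolding e by auto
qed

lemma word_right_key_shape:
  assumes "ssyt (right_key_shape S j) T" "Suc m \<le> N"
  shows "word N T = word_below 0 m (UT T) @ dlist (column_entries T m)"
proof -
  note d = ssyt_dom[OF assms(1)]
  have "column_entries T c = {}" if "Suc m \<le> c" for c
  proof -
    have "(r, c) \<notin> dom T" for r unfolding d right_key_shape_iff using that by simp
    then show ?thesis unfolding column_entries_def by blast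
  qed
  then have "word N T = word (Suc m) T" using assms(2) by (rule word_extend)
  moreover have "column_entries T c = column_entries (UT T) c" if "c < m" for c
  proof (intro equalityI subsetI)
    fix x assume "x \<in> column_entries T c"
    then obtain r where r: "T (r, c) = Some x" by (auto simp: column_entries_def)
    then have "(r, c) \<in> right_key_shape S j" using d by blast
    then have "h < r" unfolding right_key_shape_iff using that by simp
    then have "UT T (r - h, c) = Some x" using r that by (simp add: UT_def)
    then show "x \<in> column_entries (UT T) c" unfolding column_entries_def by blast
  next
    fix x assume "x \<in> column_entries (UT T) c"
    then show "x \<in> column_entries T c" by (auto simp: column_entries_def UT_def split: if_splits)
  qed
  then have "word m T = word m (UT T)" by (rule word_cong)
  ultimately show ?thesis using word_straight[OF ssyt_UT[OF assms(1)]] by (simp add: word_Suc)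
qed

lemma prow_right_key_shape:
  assumes "ssyt (right_key_shape S j) T" "Suc m \<le> N"
  defines "cs \<equiv> col_seq (row_mset (UT T)) (column_entries T m)"
  shows "prow i (word N T) = row_mset (UT T) (Suc i) + mset_set (cs i) - mset_set (cs (Suc i))"
proof -
  have "row_mset_below m (UT T) r = row_mset (UT T) r" for r
    by (rule row_mset_below_eq) (auto simp: row_columns_def UT_def split: if_splits)
  then have "row_mset_below m (UT T) = row_mset (UT T)" by (rule ext)
  then show ?thesis
    using straight_column_rins(2)[OF \<mu>U_partition ssyt_UT[OF assms(1)] last_column(1)[OF assms(1)], where N = m and i = i]
    unfolding word_right_key_shape[OF assms(1,2)] cs_def by simp
qed

lemma prow_S:
  assumes "Suc m \<le> N"
  shows "prow i (word N S) = R (Suc i)"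
proof -
  have "row_mset_below N S (Suc i) = row_mset S (Suc i)"
  proof (rule row_mset_below_eq)
    fix c assume "c \<in> row_columns S (Suc i)"
    then show "c < N"
      using row_columns_straight[OF s, of "Suc i"] is_partition_mono[OF p, of 1 "Suc i"] assms
      by (simp add: m_def)
  qed
  then show ?thesis
    using straight_rins_iter(2)[OF p s] unfolding word_straight[OF s] R_def by simp
qed

lemma UT_TK: "UT TK = TU"
proof
  fix b :: "nat \<times> nat"
  obtain r c where b: "b = (r, c)" by fastforce
  have "TU (r, c) = None" if "\<not> (1 \<le> r \<and> c < m)"
  proof -
    have "(r, c) \<notin> diagram \<mu>U" using that \<mu>U_less[of r] by (auto simp: diagram_iff)
    then show ?thesis using ssyt_dom[OF ssyt_TU] by blast
  qed
  then show "UT TK b = TU b" unfolding b by (auto simp: UT_def TK_below)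
qed

lemma TK_last_column: "column_entries TK m = C 0"
proof -
  have "column_entries TK m = set (sorted_list_of_set (C 0))"
    unfolding column_entries_def TK_m using card_C0[of 0] by (intro set_conv_nth_shift) simp
  then show ?thesis using finite_C by simp
qed

text \<open>\<open>TK\<close> rectifies to some straight \<open>S'\<close>. The insertion rows of
  the word of \<open>TK\<close>, computed by inserting \<open>C 0\<close> into \<open>TU\<close>,
  are the rows of \<open>S\<close>; as an invariant of the Knuth class they are also the rows of
  \<open>S'\<close>. Hence \<open>S' = S\<close>.\<close>

lemma jdt_TK: "jdt_equiv S TK"
proof -
  obtain \<mu>' S' where S': "is_partition \<mu>'" "ssyt (diagram \<mu>') S'" "jdt_equiv TK S'"
    using rectification[OF skew_shape(1)] ssyt_TK unfolding skew_shape(2) by blast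
  obtain M where M: "\<And>N. M \<le> N \<Longrightarrow> knuth (word N TK) (word N S')" using jdt_equiv_knuth[OF S'(3)] by blast
  define N where "N = max M (max (Suc m) (Suc (\<mu>' 1)))"
  define cs where "cs = col_seq (row_mset (UT TK)) (column_entries TK m)"
  have U: "row_mset (UT TK) (Suc i) = U (Suc i)" for i unfolding UT_TK by (rule row_mset_TU) simp
  have cs: "cs i = C i" for i
  proof (induction i)
    case 0
    show ?case by (simp add: cs_def TK_last_column)
  next
    case (Suc i)
    then have "cs (Suc i) = succs (set_mset (U (Suc i)) \<union> C i) (C i)" by (simp add: cs_def U)
    then show ?case
      using succs_C[of i] C_k[of i] C_k[of "Suc i"] by (cases "i < k") (simp_all add: succs_def)
  qed
  have "prow i (word N TK) = R (Suc i)" for i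
  proof -
    have "prow i (word N TK) = U (Suc i) + mset_set (C i) - mset_set (C (Suc i))"
      using prow_right_key_shape[OF ssyt_TK, of N i] unfolding cs_def[symmetric] cs U by (simp add: N_def)
    also have "\<dots> = R (Suc i)"
      using U_plus[of i] U_ge[of i] C_k[of i] C_k[of "Suc i"] by (cases "i < k") simp_all
    finally show ?thesis .
  qed
  moreover have "prow i (word N S') = row_mset S' (Suc i)" for i
  proof -
    have "row_mset_below N S' (Suc i) = row_mset S' (Suc i)"
    proof (rule row_mset_below_eq)
      fix c assume "c \<in> row_columns S' (Suc i)"
      then have "c \<le> \<mu>' 1"
        using row_columns_straight[OF S'(2), of "Suc i"] is_partition_mono[OF S'(1), of 1 "Suc i"] by simp
      moreover have "\<mu>' 1 < N" unfolding N_def by linarith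
      ultimately show "c < N" by linarith
    qed
    then show ?thesis
      using straight_rins_iter(2)[OF S'(1,2)] unfolding word_straight[OF S'(2)] by simp
  qed
  moreover have "prow i (word N TK) = prow i (word N S')" for i
    by (rule prow_knuth[OF M]) (simp add: N_def)
  ultimately have "row_mset S (Suc i) = row_mset S' (Suc i)" for i unfolding R_def by metis
  then have "row_mset S r = row_mset S' r" if "1 \<le> r" for r using that by (cases r) auto
  then have "S = S'" by (rule straight_eqI[OF s S'(2)])
  then show ?thesis using S'(3) unfolding jdt_equiv_def by (metis equivclp_sym)
qed

text \<open>The rows of \<open>S\<close> and of \<open>UT T\<close> differ in size by one exactly in
  rows \<open>1\<close>, ..., \<open>k\<close>, so in each of these the inserted set loses one
  element. Then \<open>preds_succs\<close> recovers the inserted sets from row \<open>k\<close>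
  upwards, and with them the rows of \<open>UT T\<close>.\<close>

lemma unique_TK:
  assumes T: "ssyt (right_key_shape S j) T" and eq: "jdt_equiv S T"
  shows "T = TK"
proof -
  obtain M where M: "\<And>N. M \<le> N \<Longrightarrow> knuth (word N S) (word N T)" using jdt_equiv_knuth[OF eq] by blast
  define N where "N = max M (Suc m)"
  define UM where "UM = row_mset (UT T)"
  define cs where "cs = col_seq UM (column_entries T m)"
  have R: "R (Suc i) = UM (Suc i) + mset_set (cs i) - mset_set (cs (Suc i))" for i
    using prow_knuth[OF M[of N], of i] prow_S[of N i] prow_right_key_shape[OF T, of N i]
    by (simp add: N_def UM_def cs_def)
  have fin: "finite (cs i)" for i
    unfolding cs_def by (rule finite_col_seq[OF last_column(1)[OF T]])
  have cs_Suc: "cs (Suc i) = succs (set_mset (UM (Suc i)) \<union> cs i) (cs i)" for i by (simp add: cs_def)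
  have sub: "cs (Suc i) \<subseteq> set_mset (UM (Suc i)) \<union> cs i" for i
    unfolding cs_Suc by (rule succs_subset)
  have size_UM: "size (UM (Suc i)) = \<mu>U (Suc i)" for i
    unfolding UM_def by (rule size_row_mset[OF ssyt_UT[OF T]]) simp
  have card_step: "card (cs i) = Suc (card (cs (Suc i)))" if "i < k" for i
  proof -
    have "R (Suc i) + mset_set (cs (Suc i)) = UM (Suc i) + mset_set (cs i)"
      unfolding R by (rule mset_exchange[OF fin fin sub])
    then have "size (R (Suc i)) + card (cs (Suc i)) = size (UM (Suc i)) + card (cs i)"
      by (metis size_mset_set size_union)
    moreover have "1 \<le> \<mu> (Suc i)" using le_k_iff[of "Suc i"] that j by simp
    ultimately show ?thesis using size_R[of "Suc i"] size_UM[of i] that by (simp add: \<mu>U_def)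
  qed
  have "card (cs i) = k - i" if "i \<le> k" for i
    using that
  proof (induction i)
    case 0
    show ?case using last_column(2)[OF T] by (simp add: cs_def)
  next
    case (Suc i)
    then show ?case using card_step[of i] by simp
  qed
  then have "card (cs k) = 0" by simp
  \<comment> \<open>The inserted set starts with \<open>k\<close> elements and loses one per row, so
    nothing leaves row \<open>k\<close>; this anchors the upward recovery.\<close>
  then have cs_k: "cs k = {}" using fin[of k] by simp
  have cs_ge: "cs (k + i) = {}" for i
    by (induction i) (simp_all add: cs_k cs_Suc succs_def)
  have cs_C: "cs (k - d) = C (k - d)" if "d \<le> k" for d
    using that
  proof (induction d)
    case 0
    show ?case by (simp add: cs_k C_k)
  next
    case (Suc d)
    define i where "i = k - Suc d"
    have i: "i < k" "Suc i = k - d" using Suc.prems by (simp_all add: i_def)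
    have "cs i = preds (set_mset (R (Suc i))) (cs (Suc i))"
      by (rule preds_succs(1)[OF fin cs_Suc R card_step[OF i(1)]])
    then show ?case using C_step[OF i(1)] Suc i unfolding i_def[symmetric] by simp
  qed
  have csC: "cs i = C i" for i
  proof (cases "i \<le> k")
    case True
    then show ?thesis using cs_C[of "k - i"] by simp
  next
    case False
    then show ?thesis using cs_ge[of "i - k"] C_k[of i] by simp
  qed
  have UMU: "UM (Suc i) = U (Suc i)" for i
  proof -
    have "R (Suc i) + mset_set (cs (Suc i)) = UM (Suc i) + mset_set (cs i)"
      unfolding R by (rule mset_exchange[OF fin fin sub])
    then show ?thesis by (simp add: U_def csC)
  qed
  have "row_mset (UT T) r = row_mset TU r" if "1 \<le> r" for r
    using that UMU row_mset_TU[OF that] by (cases r) (simp_all add: UM_def)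
  then have UT: "UT T = TU" by (rule straight_eqI[OF ssyt_UT[OF T] ssyt_TU])
  have last: "column_entries T m = C 0" using csC[of 0] by (simp add: cs_def)
  show "T = TK"
  proof
    fix b :: "nat \<times> nat"
    obtain r c where b: "b = (r, c)" by fastforce
    show "T b = TK b"
    proof (cases "(r, c) \<in> right_key_shape S j")
      case False
      then have "b \<notin> dom T" "b \<notin> dom TK" using ssyt_dom[OF T] ssyt_dom[OF ssyt_TK] b by auto
      then show ?thesis by (metis domIff)
    next
      case True
      then consider "c = m" "1 \<le> r" "r \<le> k" | "c < m" "h < r" unfolding right_key_shape_iff by blast
      then show ?thesis
      proof cases
        case 1
        then have "TK (r, m) = Some (sorted_list_of_set (C 0) ! (r - 1))" by (simp add: TK_m)
        then show ?thesis using last_column(3)[OF T 1(2,3)] last b 1(1) by simp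
      next
        case 2
        then have "1 \<le> r - h" "r - h + h = r" by simp_all
        then have "T (r, c) = UT T (r - h, c)" using 2(1) by (simp add: UT_def)
        then show ?thesis using 2 UT b by (simp add: TK_below)
      qed
    qed
  qed
qed

lemma right_key_column:
  "right_key S (r, j) = (if 1 \<le> r \<and> r \<le> k then Some (sorted_list_of_set (C 0) ! (r - 1)) else None)"
proof -
  have "(THE T. ssyt (right_key_shape S j) T \<and> jdt_equiv S T) = TK"
    by (rule the_equality) (use ssyt_TK jdt_TK unique_TK in blast)+
  moreover have "num_columns S = m" using num_columns_straight[OF p s] by (simp add: m_def)
  moreover have "j \<le> m" using j by (simp add: m_def)
  ultimately have "right_key S (r, j) = TK (r, m)" using j(1) by (simp add: right_key_def)
  then show ?thesis by (simp add: TK_def)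
qed

end

section \<open>The push-down procedure\<close>

text \<open>The reverse bumping of \<open>ejected\<close>, but with an arbitrary starting set; this
  form allows the lowest rows to be peeled off or exchanged in an induction.\<close>

primrec compose_preds :: "(nat \<Rightarrow> nat set) \<Rightarrow> nat \<Rightarrow> nat set \<Rightarrow> nat set" where
  "compose_preds R 0 A = A"
| "compose_preds R (Suc i) A = compose_preds R i (preds (R (Suc i)) A)"

lemma compose_preds_ejected: "ejected R k k = compose_preds R k {}"
proof -
  have "compose_preds R (k - d) (ejected R k d) = compose_preds R k {}" if "d \<le> k" for d
    using that
  proof (induction d)
    case (Suc d)
    then have "k - d = Suc (k - Suc d)" by simp
    then have "compose_preds R (k - d) (ejected R k d) = compose_preds R (k - Suc d) (ejected R k (Suc d))"
      by simp
    then show ?case using Suc by simp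
  qed simp
  from this[of k] show ?thesis by simp
qed

lemma compose_preds_cong:
  "(\<And>s. 1 \<le> s \<Longrightarrow> s \<le> i \<Longrightarrow> R s = R' s) \<Longrightarrow> compose_preds R i A = compose_preds R' i A"
  by (induction i arbitrary: A) auto

lemma compose_preds_subset: "compose_preds R i A \<subseteq> A \<union> (\<Union>s\<in>{1..i}. R s)"
proof (induction i arbitrary: A)
  case (Suc i)
  have "compose_preds R (Suc i) A \<subseteq> preds (R (Suc i)) A \<union> (\<Union>s\<in>{1..i}. R s)"
    using Suc[of "preds (R (Suc i)) A"] by simp
  also have "\<dots> \<subseteq> A \<union> R (Suc i) \<union> (\<Union>s\<in>{1..i}. R s)" using preds_subset by blast
  also have "\<dots> = A \<union> (\<Union>s\<in>{1..Suc i}. R s)" by (auto simp: atLeastAtMostSuc_conv)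
  finally show ?case .
qed simp

text \<open>A push-down move between the rows \<open>R\<close> and \<open>Q\<close> does not affect what is reverse bumped out of
  them.\<close>

lemma preds_push:
  assumes e: "e \<in> R" "\<And>r. r \<in> R \<Longrightarrow> r \<le> e"
  shows "preds Q (preds R A) = preds {q \<in> Q. q < e} (preds (R \<union> {q \<in> Q. e \<le> q}) A)"
proof (rule Set.set_eqI)
  fix z :: nat
  let ?B = "preds R A" and ?B' = "preds (R \<union> {q \<in> Q. e \<le> q}) A"
  \<comment> \<open>Below \<open>e\<close> the moved entries impose nothing new: they are at least
    \<open>e\<close>, and \<open>e\<close> in \<open>R\<close> already demands an element of
    \<open>A\<close> in a smaller interval.\<close>
  have low: "z \<in> ?B \<longleftrightarrow> z \<in> ?B'" if ze: "z < e" for z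
  proof
    assume z: "z \<in> ?B"
    show "z \<in> ?B'" unfolding preds_def
    proof (intro CollectI conjI ballI impI)
      show "z \<in> R \<union> {q \<in> Q. e \<le> q} \<union> A" using z by (auto simp: preds_def)
      fix r assume r: "r \<in> R \<union> {q \<in> Q. e \<le> q}" "z < r"
      have c: "\<exists>a\<in>A. z < a \<and> a \<le> s" if "s \<in> R" "z < s" for s using z that by (simp add: preds_def)
      show "\<exists>a\<in>A. z < a \<and> a \<le> r"
      proof (cases "r \<in> R")
        case True
        then show ?thesis using c r by simp
      next
        case False
        then show ?thesis using c[OF e(1) ze] r(1) by (auto intro: le_trans)
      qed
    qed
  next
    assume z: "z \<in> ?B'"
    then have "z \<in> R \<union> A" using ze by (auto simp: preds_def)
    then show "z \<in> ?B" using z by (simp add: preds_def)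
  qed
  \<comment> \<open>No entry of \<open>R\<close> exceeds such a \<open>z\<close>, so all of
    \<open>A\<close> from \<open>e\<close> upwards survives and \<open>e\<close> joins it.\<close>
  have high: "z \<in> ?B \<longleftrightarrow> z = e \<or> z \<in> A" if ze: "e \<le> z" for z
  proof -
    have "z < r \<Longrightarrow> r \<notin> R" for r using e(2)[of r] ze by auto
    moreover have "z \<in> R \<longleftrightarrow> z = e" using e ze by (auto intro: order_antisym)
    ultimately show ?thesis unfolding preds_def by auto
  qed
  \<comment> \<open>Above \<open>e\<close> the enlarged lower row imposes the very condition that
    \<open>Q\<close> imposed one row higher, and the shortened upper row lets everything
    \<open>\<ge> e\<close> pass.\<close>
  have high': "z \<in> ?B' \<longleftrightarrow> (z = e \<or> z \<in> A \<or> z \<in> Q) \<and> (\<forall>q\<in>Q. z < q \<longrightarrow> (\<exists>a\<in>A. z < a \<and> a \<le> q))"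
    if ze: "e \<le> z" for z
  proof -
    have "z < r \<Longrightarrow> r \<in> R \<union> {q \<in> Q. e \<le> q} \<longleftrightarrow> r \<in> Q" for r using e(2)[of r] ze by auto
    moreover have "z \<in> R \<union> {q \<in> Q. e \<le> q} \<union> A \<longleftrightarrow> z = e \<or> z \<in> A \<or> z \<in> Q"
      using e ze by (auto intro: order_antisym)
    ultimately show ?thesis unfolding preds_def mem_Collect_eq by (metis (no_types, lifting))
  qed
  show "z \<in> preds Q ?B \<longleftrightarrow> z \<in> preds {q \<in> Q. q < e} ?B'"
  proof (cases "z < e")
    case True
    have eB: "e \<in> ?B" using high[of e] by simp
    have lowq: "(\<exists>b\<in>?B. z < b \<and> b \<le> q) \<longleftrightarrow> (\<exists>b\<in>?B'. z < b \<and> b \<le> q)" if "q < e" for q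
      using low that by (meson le_less_trans)
    have "(\<forall>q\<in>Q. z < q \<longrightarrow> (\<exists>b\<in>?B. z < b \<and> b \<le> q)) \<longleftrightarrow>
      (\<forall>q\<in>{q \<in> Q. q < e}. z < q \<longrightarrow> (\<exists>b\<in>?B'. z < b \<and> b \<le> q))" (is "?l \<longleftrightarrow> ?r")
    proof
      assume l: ?l
      show ?r
      proof (intro ballI impI)
        fix q assume "q \<in> {q \<in> Q. q < e}" "z < q"
        then show "\<exists>b\<in>?B'. z < b \<and> b \<le> q" using l lowq[of q] by blast
      qed
    next
      assume r: ?r
      show ?l
      proof (intro ballI impI)
        fix q assume "q \<in> Q" "z < q"
        then show "\<exists>b\<in>?B. z < b \<and> b \<le> q"
          using r lowq[of q] eB True by (cases "q < e") auto
      qed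
    qed
    moreover have "z \<in> Q \<union> ?B \<longleftrightarrow> z \<in> {q \<in> Q. q < e} \<union> ?B'" using True low[OF True] by simp
    ultimately show ?thesis unfolding preds_def[of Q] preds_def[of "{q \<in> Q. q < e}"] mem_Collect_eq by simp
  next
    case False
    then have ez: "e \<le> z" by simp
    have "z \<in> preds {q \<in> Q. q < e} ?B' \<longleftrightarrow> z \<in> ?B'"
      using ez unfolding preds_def[of "{q \<in> Q. q < e}"] by auto
    moreover have "b \<in> ?B \<longleftrightarrow> b \<in> A" if "z < b" for b using high[of b] that ez by auto
    then have "z \<in> preds Q ?B \<longleftrightarrow> (z \<in> Q \<or> z \<in> ?B) \<and> (\<forall>q\<in>Q. z < q \<longrightarrow> (\<exists>a\<in>A. z < a \<and> a \<le> q))"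
      unfolding preds_def[of Q] mem_Collect_eq Un_iff by (metis (no_types, lifting))
    ultimately show ?thesis using high[OF ez] high'[OF ez] by (simp add: disj_commute disj_left_commute)
  qed
qed

text \<open>What remains of a configuration when columns are forgotten. The last clause ensures that
  a move never empties a row and that there is an entry to the left of the moved ones, which becomes
  the exposed entry.\<close>

definition stacked :: "nat \<Rightarrow> (nat \<Rightarrow> nat set) \<Rightarrow> bool" where
  "stacked p R \<longleftrightarrow> R 0 = {} \<and> (\<forall>r. finite (R r)) \<and> (\<forall>r. 1 \<le> r \<and> r \<le> p \<longrightarrow> R r \<noteq> {}) \<and>
     (\<forall>r. 1 \<le> r \<and> r < p \<longrightarrow> (\<exists>x\<in>R r. \<forall>y\<in>R (Suc r). x < y))"

definition move_rows :: "(nat \<Rightarrow> nat set) \<Rightarrow> nat \<Rightarrow> nat \<Rightarrow> nat \<Rightarrow> nat set" where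
  "move_rows R r e = R(r := {x \<in> R r. x < e}, Suc r := R (Suc r) \<union> {x \<in> R r. e \<le> x})"

fun push_rows :: "(nat \<Rightarrow> nat set) \<Rightarrow> nat \<Rightarrow> (nat \<Rightarrow> nat set) \<times> nat" where
  "push_rows R 0 = (R, 0)"
| "push_rows R (Suc r) =
    (if \<exists>q\<in>R r. Max (R (Suc r)) \<le> q then push_rows (move_rows R r (Max (R (Suc r)))) r else (R, Suc r))"

text \<open>Follows only the exposed value. It may read the original rows throughout, because a move
  changes the row just examined and the one below it, never a row still to be visited.\<close>

fun push_value :: "(nat \<Rightarrow> nat set) \<Rightarrow> nat \<Rightarrow> nat \<Rightarrow> nat" where
  "push_value R 0 f = f"
| "push_value R (Suc r) f = (if \<exists>q\<in>R r. f \<le> q then push_value R r (Max {q \<in> R r. q < f}) else f)"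

section \<open>The procedure on the sets of row entries\<close>

lemma stackedD:
  assumes "stacked p R"
  shows "R 0 = {}" "finite (R r)" "1 \<le> r \<Longrightarrow> r \<le> p \<Longrightarrow> R r \<noteq> {}"
    "1 \<le> r \<Longrightarrow> r < p \<Longrightarrow> \<exists>x\<in>R r. \<forall>y\<in>R (Suc r). x < y"
  using assms unfolding stacked_def by simp_all

lemma stacked_below:
  assumes "stacked p R" "1 \<le> r" "r < p" "y \<in> R (Suc r)" "y \<le> f"
  shows "\<exists>x\<in>R r. x < f"
  using stackedD(4)[OF assms(1-3)] assms(4,5) by (meson less_le_trans)

lemma
  assumes st: "stacked p R" and r: "1 \<le> r" "r < p"
  defines "e \<equiv> Max (R (Suc r))"
  shows stacked_move_rows: "stacked p (move_rows R r e)"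
    and Max_move_rows_lower: "Max (move_rows R r e r) < e"
    and compose_preds_move_rows: "r < i \<Longrightarrow> compose_preds (move_rows R r e) i A = compose_preds R i A"
proof -
  let ?R = "move_rows R r e"
  have eR: "e \<in> R (Suc r)" "\<And>x. x \<in> R (Suc r) \<Longrightarrow> x \<le> e"
    using stackedD(2,3)[OF st, of "Suc r"] r unfolding e_def by auto
  have R: "?R r = {x \<in> R r. x < e}" "?R (Suc r) = R (Suc r) \<union> {x \<in> R r. e \<le> x}"
    "\<And>s. s \<noteq> r \<Longrightarrow> s \<noteq> Suc r \<Longrightarrow> ?R s = R s" by (auto simp: move_rows_def)
  obtain x0 where x0: "x0 \<in> R r" "\<forall>y\<in>R (Suc r). x0 < y" using stackedD(4)[OF st r] by blast
  then have "x0 \<in> ?R r" using eR R by simp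
  moreover have fin: "finite (?R r)" using stackedD(2)[OF st] R by simp
  ultimately have "Max (?R r) \<in> ?R r" by (intro Max_in) auto
  then show "Max (?R r) < e" using R by auto
  show "stacked p ?R" unfolding stacked_def
  proof (intro conjI allI impI)
    show "?R 0 = {}" using stackedD(1)[OF st] r R(3)[of 0] by simp
    show "finite (?R s)" for s using stackedD(2)[OF st] by (simp add: move_rows_def)
    show "?R s \<noteq> {}" if "1 \<le> s \<and> s \<le> p" for s
      using stackedD(3)[OF st, of s] that \<open>x0 \<in> ?R r\<close> R by (cases "s = r"; cases "s = Suc r") auto
    show "\<exists>x\<in>?R s. \<forall>y\<in>?R (Suc s). x < y" if s: "1 \<le> s \<and> s < p" for s
    proof -
      obtain x where x: "x \<in> R s" "\<forall>y\<in>R (Suc s). x < y" using stackedD(4)[OF st, of s] s by blast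
      consider "s = r" | "s = Suc r" | "Suc s = r" | "s \<noteq> r" "s \<noteq> Suc r" "Suc s \<noteq> r" by blast
      then show ?thesis
      proof cases
        case 1
        then show ?thesis using x0 R \<open>x0 \<in> ?R r\<close> by (intro bexI[of _ x0]) auto
      next
        case 2
        then show ?thesis using x R by auto
      next
        case 3
        then have "?R s = R s" using R(3)[of s] by simp
        then show ?thesis using x R(1) 3 by auto
      next
        case 4
        then have "?R s = R s" "?R (Suc s) = R (Suc s)" using R(3) by simp_all
        then show ?thesis using x by auto
      qed
    qed
  qed
  show "compose_preds ?R i A = compose_preds R i A" if "r < i"
    using that
  proof (induction i arbitrary: A)
    case (Suc i)
    show ?case
    proof (cases "r < i")
      case True
      then show ?thesis using Suc R(3)[of "Suc i"] by simp
    next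
      case False
      then have i: "i = r" using Suc.prems by simp
      \<comment> \<open>Two levels are unfolded so that \<open>preds_push\<close> applies to the
        rows \<open>Suc r\<close> and \<open>r\<close>; the rows above them are unchanged.\<close>
      obtain r0 where r0: "r = Suc r0" using r(1) by (cases r) auto
      have "compose_preds ?R r0 B = compose_preds R r0 B" for B
        by (rule compose_preds_cong) (use R(3) r0 in simp)
      then show ?thesis
        using preds_push[OF eR, of "R r" A] unfolding i by (simp add: r0) (simp add: r0[symmetric] R)
    qed
  qed simp
qed

lemma push_value_cong: "(\<And>s. s < r \<Longrightarrow> R s = R' s) \<Longrightarrow> push_value R r f = push_value R' r f"
  by (induction r arbitrary: f) auto

lemma push_value_le:
  assumes "stacked p R" "r \<le> p" "x \<in> R r" "x \<le> f"
  shows "push_value R r f \<le> f"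
  using assms(2-)
proof (induction r arbitrary: f x)
  case (Suc r)
  show ?case
  proof (cases "\<exists>q\<in>R r. f \<le> q")
    case True
    then have r: "1 \<le> r" using stackedD(1)[OF assms(1)] by (cases r) auto
    let ?Q = "{q \<in> R r. q < f}"
    have "?Q \<noteq> {}" using stacked_below[OF assms(1) r _ Suc.prems(2,3)] Suc.prems(1) by auto
    moreover have "finite ?Q" using stackedD(2)[OF assms(1)] by simp
    ultimately have m: "Max ?Q \<in> ?Q" by (rule Max_in[rotated])
    then have "push_value R r (Max ?Q) \<le> Max ?Q" using Suc.IH[of "Max ?Q" "Max ?Q"] Suc.prems by auto
    also have "\<dots> < f" using m by simp
    finally show ?thesis using True by simp
  qed auto
qed simp

lemma push_rows_props:
  assumes "stacked p R" "1 \<le> r" "r \<le> p" "push_rows R r = (R', r')"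
  shows "stacked p R' \<and> 1 \<le> r' \<and> r' \<le> r \<and> (\<forall>s>r. R' s = R s) \<and> R r \<subseteq> R' r \<and>
    (\<forall>i\<ge>r. \<forall>A. compose_preds R' i A = compose_preds R i A) \<and>
    Max (R' r') = push_value R r (Max (R r))"
  using assms
proof (induction r arbitrary: R)
  case (Suc r)
  let ?e = "Max (R (Suc r))"
  show ?case
  proof (cases "\<exists>q\<in>R r. ?e \<le> q")
    case False
    then have "R' = R" "r' = Suc r" using Suc.prems by simp_all
    then show ?thesis using Suc.prems False by auto
  next
    case True
    then have r: "1 \<le> r" "r < p" using stackedD(1)[OF Suc.prems(1)] Suc.prems by (cases r; auto)+
    let ?R = "move_rows R r ?e"
    have "push_rows ?R r = (R', r')" using Suc.prems True by simp
    note IH = Suc.IH[OF stacked_move_rows[OF Suc.prems(1) r] r(1) less_imp_le[OF r(2)] this]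
    have "push_value ?R r (Max (?R r)) = push_value R (Suc r) ?e"
    proof -
      have "push_value ?R r (Max (?R r)) = push_value R r (Max (?R r))"
        by (rule push_value_cong) (simp add: move_rows_def)
      then show ?thesis using True by (simp add: move_rows_def)
    qed
    moreover have "\<forall>s>Suc r. R' s = R s"
      using IH by (simp add: move_rows_def)
    moreover have "R (Suc r) \<subseteq> R' (Suc r)" using IH by (auto simp: move_rows_def)
    moreover have "\<forall>i\<ge>Suc r. \<forall>A. compose_preds R' i A = compose_preds R i A"
      using IH compose_preds_move_rows[OF Suc.prems(1) r] by simp
    ultimately show ?thesis using IH by simp
  qed
qed simp

text \<open>The analogue of the row bumping lemma. The value \<open>?y\<close> exposed by the first
  run in row \<open>r\<close> is still there afterwards, and \<open>?y < f\<close>; so a second run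
  that goes on continues from a value at least \<open>?y\<close>, and one that stops does so at
  \<open>f\<close>. If the first run stops at once, so does the second.\<close>

lemma push_value_mono:
  assumes "stacked p R" "1 \<le> r" "r \<le> p" "Max (R r) \<le> f"
  shows "push_value R r (Max (R r)) \<le> push_value (fst (push_rows R r)) r f"
  using assms
proof (induction r arbitrary: R f)
  case (Suc r)
  let ?e = "Max (R (Suc r))"
  show ?case
  proof (cases "\<exists>q\<in>R r. ?e \<le> q")
    case False
    then have "\<not> (\<exists>q\<in>R r. f \<le> q)" using Suc.prems(4) by (meson le_trans)
    then show ?thesis using False Suc.prems(4) by simp
  next
    case True
    then have r: "1 \<le> r" "r < p" using stackedD(1)[OF Suc.prems(1)] Suc.prems by (cases r; auto)+
    let ?R = "move_rows R r ?e"
    let ?R' = "fst (push_rows ?R r)"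
    let ?y = "Max (?R r)"
    have st: "stacked p ?R" by (rule stacked_move_rows[OF Suc.prems(1) r])
    have ye: "?y < ?e" by (rule Max_move_rows_lower[OF Suc.prems(1) r])
    have yR: "?y \<in> ?R r" using stackedD(2,3)[OF st, of r] r by simp
    obtain R'' r'' where "push_rows ?R r = (R'', r'')" by fastforce
    from push_rows_props[OF st r(1) _ this] this
    have sub: "?R r \<subseteq> ?R' r" and st': "stacked p ?R'" using r(2) by simp_all
    have "push_value R (Suc r) ?e = push_value R r ?y" using True by (simp add: move_rows_def)
    also have "\<dots> = push_value ?R r ?y" by (rule push_value_cong) (simp add: move_rows_def)
    finally have eq: "push_value R (Suc r) ?e = push_value ?R r ?y" .
    have "push_value ?R r ?y \<le> push_value ?R' (Suc r) f"
    proof (cases "\<exists>q\<in>?R' r. f \<le> q")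
      case t: True
      have "?y \<in> {q \<in> ?R' r. q < f}" using yR sub ye Suc.prems(4) by auto
      then have "?y \<le> Max {q \<in> ?R' r. q < f}" using stackedD(2)[OF st'] by (intro Max_ge) auto
      then show ?thesis using Suc.IH[OF st r(1)] r(2) t by simp
    next
      case False
      have "push_value ?R r ?y \<le> ?y" by (rule push_value_le[OF st _ yR]) (use r in simp_all)
      then show ?thesis using False ye Suc.prems(4) by simp
    qed
    then show ?thesis using eq True by simp
  qed
qed simp

text \<open>Throughout the loop, the rows other than the exposed one have maxima that increase
  downwards. A move gives row \<open>Suc r\<close> the old maximum of row \<open>r\<close> and
  exposes row \<open>r\<close>, so these maxima remain the same set. When the loop stops, the
  exposed value exceeds the maxima above it and completes the increasing sequence.\<close>

lemma push_rows_ends: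
  assumes "stacked p R" "1 \<le> r" "r \<le> i" "i \<le> p" "push_rows R r = (R', r')"
    and "\<And>s s'. 1 \<le> s \<Longrightarrow> s < s' \<Longrightarrow> s' \<le> i \<Longrightarrow> s \<noteq> r \<Longrightarrow> s' \<noteq> r \<Longrightarrow> Max (R s) < Max (R s')"
    and "\<And>s. r < s \<Longrightarrow> s \<le> i \<Longrightarrow> Max (R r) < Max (R s)"
  shows "(\<forall>s s'. 1 \<le> s \<and> s < s' \<and> s' \<le> i \<longrightarrow> Max (R' s) < Max (R' s')) \<and>
    (\<lambda>s. Max (R' s)) ` {1..i} = insert (Max (R' r')) ((\<lambda>s. Max (R s)) ` ({1..i} - {r}))"
  using assms
proof (induction r arbitrary: R)
  case (Suc r)
  note st = Suc.prems(1)
  let ?e = "Max (R (Suc r))"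
  show ?case
  proof (cases "\<exists>q\<in>R r. ?e \<le> q")
    case False
    then have R': "R' = R" "r' = Suc r" using Suc.prems by simp_all
    have lt: "Max (R s) < ?e" if s: "1 \<le> s" "s < Suc r" for s
    proof -
      have "1 \<le> r" using s by simp
      then have "Max (R r) \<in> R r" using stackedD(2,3)[OF st, of r] Suc.prems by simp
      then have "Max (R r) < ?e" using False by (meson not_le)
      moreover have "Max (R s) \<le> Max (R r)"
        using Suc.prems(6)[of s r] s Suc.prems(3) by (cases "s = r") auto
      ultimately show ?thesis by simp
    qed
    have "Max (R s) < Max (R s')" if "1 \<le> s \<and> s < s' \<and> s' \<le> i" for s s'
      using that lt[of s] Suc.prems(6)[of s s'] Suc.prems(7)[of s'] by (cases "s = Suc r"; cases "s' = Suc r") auto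
    moreover have "{1..i} = insert (Suc r) ({1..i} - {Suc r})" using Suc.prems by auto
    then have "(\<lambda>s. Max (R s)) ` {1..i} = insert ?e ((\<lambda>s. Max (R s)) ` ({1..i} - {Suc r}))"
      by (metis image_insert)
    ultimately show ?thesis unfolding R' by blast
  next
    case True
    then have r: "1 \<le> r" "r < p" using stackedD(1)[OF st] Suc.prems by (cases r; auto)+
    let ?R = "move_rows R r ?e"
    note st' = stacked_move_rows[OF st r]
    have step: "push_rows ?R r = (R', r')" using Suc.prems True by simp
    have ye: "Max (?R r) < ?e" by (rule Max_move_rows_lower[OF st r])
    have fin: "finite (R s)" for s using stackedD(2)[OF st] .
    obtain q where q: "q \<in> R r" "?e \<le> q" using True by blast
    have eM: "?e \<le> Max (R r)" using q Max_ge[OF fin q(1)] by simp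
    have R: "?R (Suc r) = R (Suc r) \<union> {x \<in> R r. ?e \<le> x}" "\<And>s. s \<noteq> r \<Longrightarrow> s \<noteq> Suc r \<Longrightarrow> ?R s = R s"
      by (auto simp: move_rows_def)
    have M: "Max (?R (Suc r)) = Max (R r)"
    proof (rule Max_eqI)
      show "finite (?R (Suc r))" using stackedD(2)[OF st'] .
      have "Max (R r) \<in> R r" using q fin by (intro Max_in) auto
      then show "Max (R r) \<in> ?R (Suc r)" using eM unfolding R by simp
      fix y assume "y \<in> ?R (Suc r)"
      then show "y \<le> Max (R r)" unfolding R using le_trans[OF Max_ge[OF fin] eM] Max_ge[OF fin, of y r] by auto
    qed
    have "(\<forall>s s'. 1 \<le> s \<and> s < s' \<and> s' \<le> i \<longrightarrow> Max (R' s) < Max (R' s')) \<and>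
      (\<lambda>s. Max (R' s)) ` {1..i} = insert (Max (R' r')) ((\<lambda>s. Max (?R s)) ` ({1..i} - {r}))"
    proof (rule Suc.IH[OF st' r(1) _ Suc.prems(4) step])
      show "r \<le> i" using Suc.prems(3) by simp
      fix s s' :: nat assume s: "1 \<le> s" "s < s'" "s' \<le> i" "s \<noteq> r" "s' \<noteq> r"
      show "Max (?R s) < Max (?R s')"
      proof (cases "s = Suc r")
        case t: True
        then have "Max (R r) < Max (R s')" using Suc.prems(6)[of r s'] s r by simp
        then show ?thesis using t s M R(2)[of s'] by simp
      next
        case f: False
        show ?thesis
        proof (cases "s' = Suc r")
          case True
          then have "Max (R s) < Max (R r)" using Suc.prems(6)[of s r] s r by simp
          then show ?thesis using True s M R(2)[of s] by simp
        next
          case False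
          then show ?thesis using f s Suc.prems(6)[of s s'] R(2) by simp
        qed
      qed
    next
      fix s assume s: "r < s" "s \<le> i"
      show "Max (?R r) < Max (?R s)"
      proof (cases "s = Suc r")
        case True
        then show ?thesis using M ye eM by simp
      next
        case False
        then have "?e < Max (R s)" using Suc.prems(7)[of s] s by simp
        then show ?thesis using ye False s R(2)[of s] by simp
      qed
    qed
    moreover have "(\<lambda>s. Max (?R s)) ` ({1..i} - {r}) = (\<lambda>s. Max (R s)) ` ({1..i} - {Suc r})"
    proof -
      have 1: "{1..i} - {r} = insert (Suc r) ({1..i} - {r, Suc r})" using Suc.prems r by auto
      have 2: "{1..i} - {Suc r} = insert r ({1..i} - {r, Suc r})" using Suc.prems r by auto
      have "(\<lambda>s. Max (?R s)) ` ({1..i} - {r, Suc r}) = (\<lambda>s. Max (R s)) ` ({1..i} - {r, Suc r})"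
        by (rule image_cong) (use R(2) in auto)
      then show ?thesis unfolding 1 2 using M by simp
    qed
    ultimately show ?thesis by simp
  qed
qed simp

lemma preds_above:
  assumes "finite R" "R \<noteq> {}" "\<And>a. a \<in> A \<Longrightarrow> Max R < a"
  shows "preds R A = insert (Max R) A"
proof (intro equalityI subsetI)
  fix z assume z: "z \<in> preds R A"
  show "z \<in> insert (Max R) A"
  proof (rule ccontr)
    assume "z \<notin> insert (Max R) A"
    then have "z \<in> R" "z \<noteq> Max R" using z preds_subset by blast+
    then have "z < Max R" using Max_ge[OF assms(1)] by (metis le_neq_implies_less)
    then obtain a where "a \<in> A" "a \<le> Max R" using z Max_in[OF assms(1,2)] unfolding preds_def by blast
    then show False using assms(3)[of a] by simp
  qed
next
  fix z assume "z \<in> insert (Max R) A"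
  then have "Max R \<le> z" "z \<in> R \<union> A"
    using assms(3)[of z] Max_in[OF assms(1,2)] by (cases "z = Max R"; simp)+
  moreover from this have "\<not> z < r" if "r \<in> R" for r using Max_ge[OF assms(1) that] by simp
  ultimately show "z \<in> preds R A" unfolding preds_def by blast
qed

text \<open>If \<open>A\<close> lies above the whole row, nothing is replaced and only the row's
  maximum joins \<open>A\<close>; since the maxima increase downwards, the enlarged set lies above
  the rows still to come.\<close>

lemma compose_preds_ends:
  assumes "stacked p R" "i \<le> p"
    and "\<And>s s'. 1 \<le> s \<Longrightarrow> s < s' \<Longrightarrow> s' \<le> i \<Longrightarrow> Max (R s) < Max (R s')"
    and "\<And>a s. a \<in> A \<Longrightarrow> 1 \<le> s \<Longrightarrow> s \<le> i \<Longrightarrow> Max (R s) < a"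
  shows "compose_preds R i A = A \<union> (\<lambda>s. Max (R s)) ` {1..i}"
  using assms(2-)
proof (induction i arbitrary: A)
  case (Suc i)
  have "preds (R (Suc i)) A = insert (Max (R (Suc i))) A"
  proof (rule preds_above)
    show "finite (R (Suc i))" "R (Suc i) \<noteq> {}"
      using stackedD(2,3)[OF assms(1), of "Suc i"] Suc.prems(1) by simp_all
    show "Max (R (Suc i)) < a" if "a \<in> A" for a by (rule Suc.prems(3)[OF that]) simp_all
  qed
  moreover have "compose_preds R i (insert (Max (R (Suc i))) A) =
      insert (Max (R (Suc i))) A \<union> (\<lambda>s. Max (R s)) ` {1..i}"
    by (rule Suc.IH) (use Suc.prems in auto)
  moreover have "{1..Suc i} = insert (Suc i) {1..i}" by auto
  ultimately show ?case by simp
qed simp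


section \<open>From configurations to sets of row entries\<close>

definition row_set :: "config \<Rightarrow> nat \<Rightarrow> nat set" where
  "row_set T r = {x. \<exists>c. T (r, c) = Some x}"

text \<open>The second condition replaces column strictness: it survives the push-down moves although the
  rows acquire gaps.\<close>

definition pushable :: "nat \<Rightarrow> config \<Rightarrow> bool" where
  "pushable p T \<longleftrightarrow>
     (\<forall>r c c' x y. c < c' \<and> T (r, c) = Some x \<and> T (r, c') = Some y \<longrightarrow> x \<le> y) \<and>
     (\<forall>r r' c c' x y. r < r' \<and> c \<le> c' \<and> T (r, c) = Some x \<and> T (r', c') = Some y \<longrightarrow> x < y) \<and>
     finite (dom T) \<and> (\<forall>r c. (r, c) \<in> dom T \<longrightarrow> 1 \<le> r \<and> 1 \<le> c) \<and>
     (\<forall>r. 1 \<le> r \<and> r \<le> p \<longrightarrow> (r, 1) \<in> dom T)"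

lemma pushable_row:
  "pushable p T \<Longrightarrow> c \<le> c' \<Longrightarrow> T (r, c) = Some x \<Longrightarrow> T (r, c') = Some y \<Longrightarrow> x \<le> y"
  unfolding pushable_def by (cases "c = c'", simp) (meson le_neq_implies_less)

lemma pushable_cross:
  "pushable p T \<Longrightarrow> r < r' \<Longrightarrow> c \<le> c' \<Longrightarrow> T (r, c) = Some x \<Longrightarrow> T (r', c') = Some y \<Longrightarrow> x < y"
  unfolding pushable_def by blast

lemma pushable_dom: "pushable p T \<Longrightarrow> T (r, c) = Some x \<Longrightarrow> 1 \<le> r \<and> 1 \<le> c"
  unfolding pushable_def by blast

lemma pushable_first: "pushable p T \<Longrightarrow> 1 \<le> r \<Longrightarrow> r \<le> p \<Longrightarrow> \<exists>x. T (r, 1) = Some x"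
  unfolding pushable_def by blast

lemma pushable_finite:
  assumes "pushable p T"
  shows "finite (row_columns T r)" "finite (row_set T r)"
proof -
  have f: "finite (dom T)" using assms unfolding pushable_def by blast
  have "row_columns T r \<subseteq> snd ` dom T" by (force simp: row_columns_def)
  then show "finite (row_columns T r)" using f finite_subset by blast
  have "row_set T r \<subseteq> ran T" by (auto simp: row_set_def ran_def)
  then show "finite (row_set T r)" using finite_ran[OF f] finite_subset by blast
qed

lemma pushable_stacked:
  assumes "pushable p T"
  shows "stacked p (row_set T)"
  unfolding stacked_def
proof (intro conjI allI impI)
  show "row_set T 0 = {}" using pushable_dom[OF assms, of 0] by (auto simp: row_set_def)
  show "finite (row_set T r)" for r by (rule pushable_finite[OF assms])
  show "row_set T r \<noteq> {}" if "1 \<le> r \<and> r \<le> p" for r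
    using pushable_first[OF assms, of r] that by (auto simp: row_set_def)
  show "\<exists>x\<in>row_set T r. \<forall>y\<in>row_set T (Suc r). x < y" if rp: "1 \<le> r \<and> r < p" for r
  proof -
    obtain x where x: "T (r, 1) = Some x" using pushable_first[OF assms, of r] rp by auto
    have "x < y" if yr: "y \<in> row_set T (Suc r)" for y
    proof -
      obtain c where c: "T (Suc r, c) = Some y" using yr by (auto simp: row_set_def)
      then have "1 \<le> c" using pushable_dom[OF assms] by blast
      then show ?thesis using pushable_cross[OF assms _ _ x c] by simp
    qed
    moreover have "x \<in> row_set T r" using x by (auto simp: row_set_def)
    ultimately show ?thesis by blast
  qed
qed

lemma pushable_last:
  assumes pd: "pushable p T" and r: "1 \<le> r" "r \<le> p"
  defines "k \<equiv> Max (row_columns T r)"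
  shows "T (r, k) = Some (Max (row_set T r))"
proof -
  have "1 \<in> row_columns T r" using pushable_first[OF pd r] by (auto simp: row_columns_def)
  then have "k \<in> row_columns T r" unfolding k_def using pushable_finite(1)[OF pd] by (intro Max_in) auto
  then obtain e where e: "T (r, k) = Some e" by (auto simp: row_columns_def)
  have "Max (row_set T r) = e"
  proof (rule Max_eqI)
    show "finite (row_set T r)" by (rule pushable_finite[OF pd])
    show "e \<in> row_set T r" using e by (auto simp: row_set_def)
    fix y assume "y \<in> row_set T r"
    then obtain c where c: "T (r, c) = Some y" by (auto simp: row_set_def)
    then have "c \<in> row_columns T r" by (auto simp: row_columns_def)
    then have "c \<le> k" unfolding k_def using pushable_finite(1)[OF pd] by (rule Max_ge[rotated])
    then show "y \<le> e" using pushable_row[OF pd _ c e] by simp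
  qed
  then show ?thesis using e by simp
qed

text \<open>All boxes of row \<open>Suc r\<close> lie to the left of column \<open>c\<close>: an
  entry at or to the right of \<open>c\<close> would exceed the entry above it at \<open>c\<close>,
  hence exceed the maximum \<open>e\<close> of its own row. So the move lands on empty boxes, and on
  row sets it is \<open>move_rows\<close>.\<close>

lemma move_down_pushable:
  assumes pd: "pushable p T" and r: "1 \<le> r" "r < p"
  defines "e \<equiv> Max (row_set T (Suc r))"
  defines "C \<equiv> {c \<in> row_columns T r. e \<le> the (T (r, c))}"
  assumes ne: "C \<noteq> {}"
  defines "c \<equiv> Min C"
  defines "T' \<equiv> move_down T r c"
  shows "pushable p T'" "row_set T' = move_rows (row_set T) r e"
    "row_columns T' r = {k \<in> row_columns T r. k < c}"
proof -
  let ?k = "Max (row_columns T (Suc r))"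
  have k: "T (Suc r, ?k) = Some e" using pushable_last[OF pd, of "Suc r"] r unfolding e_def by simp
  have finC: "finite C" unfolding C_def using pushable_finite(1)[OF pd] by simp
  have "c \<in> C" unfolding c_def using finC ne by (rule Min_in)
  then obtain xc where xc: "T (r, c) = Some xc" "e \<le> xc" by (auto simp: C_def row_columns_def)
  have left: "x < e" if "T (r, i) = Some x" "i < c" for i x
  proof (rule ccontr)
    assume "\<not> x < e"
    then have "i \<in> C" using that by (auto simp: C_def row_columns_def)
    then show False using Min_le[OF finC, of i] that(2) unfolding c_def by simp
  qed
  have right: "e \<le> x" if "T (r, i) = Some x" "c \<le> i" for i x
    using pushable_row[OF pd that(2) xc(1) that(1)] xc(2) by simp
  have end_row: "x \<le> e" if "T (Suc r, i) = Some x" for i x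
  proof -
    have "x \<in> row_set T (Suc r)" using that by (auto simp: row_set_def)
    then show ?thesis unfolding e_def using pushable_finite(2)[OF pd] by (rule Max_ge[rotated])
  qed
  have below: "i < c" if "T (Suc r, i) = Some x" for i x
  proof (rule ccontr)
    assume "\<not> i < c"
    then have "xc < x" using pushable_cross[OF pd _ _ xc(1) that] by simp
    then show False using end_row[OF that] xc(2) by simp
  qed
  have T': "T' (i, j) = (if i = Suc r \<and> c \<le> j then T (r, j) else if i = r \<and> c \<le> j then None else T (i, j))"
    for i j
  proof (cases "i = Suc r \<and> c \<le> j")
    case True
    then show ?thesis using below[of j] unfolding T'_def move_down_def
      by (cases "T (r, j)"; cases "T (Suc r, j)") auto
  next
    case False
    then show ?thesis unfolding T'_def move_down_def by auto
  qed
  show "row_columns T' r = {k \<in> row_columns T r. k < c}"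
    unfolding row_columns_def by (auto simp: T' dom_def)
  \<comment> \<open>The first entry of row \<open>r\<close> is smaller than \<open>e\<close>, so
    column 1 is never moved and stays filled.\<close>
  have c1: "1 < c"
  proof -
    obtain x where x: "T (r, 1) = Some x" using pushable_first[OF pd, of r] r by auto
    have "1 \<le> ?k" using pushable_dom[OF pd k] by blast
    then have "x < e" using pushable_cross[OF pd _ _ x k] by simp
    then have "\<not> c \<le> 1" using right[OF x] by auto
    then show ?thesis by simp
  qed
  have dom: "1 \<le> i \<and> 1 \<le> j" if "T' (i, j) = Some x" for i j x
    using that pushable_dom[OF pd, of i j x] pushable_dom[OF pd, of r j x] by (auto simp: T' split: if_splits)
  have orig: "T (i, j) = Some x \<and> \<not> (i = r \<and> c \<le> j) \<or> i = Suc r \<and> c \<le> j \<and> T (r, j) = Some x"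
    if "T' (i, j) = Some x" for i j x
    using that by (auto simp: T' split: if_splits)
  show "pushable p T'" unfolding pushable_def
  proof (intro conjI allI impI)
    fix i j j' x y assume a: "j < j' \<and> T' (i, j) = Some x \<and> T' (i, j') = Some y"
    from orig[of i j x] orig[of i j' y] a show "x \<le> y"
      using pushable_row[OF pd, of j j' i x y] pushable_row[OF pd, of j j' r x y]
        end_row[of j x] right[of j' y] below[of j' y] by auto
  next
    fix i i' j j' x y assume a: "i < i' \<and> j \<le> j' \<and> T' (i, j) = Some x \<and> T' (i', j') = Some y"
    consider "T (i, j) = Some x" "T (i', j') = Some y"
      | "i = Suc r" "T (r, j) = Some x" "T (i', j') = Some y"
      | "T (i, j) = Some x" "\<not> (i = r \<and> c \<le> j)" "i' = Suc r" "c \<le> j'" "T (r, j') = Some y"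
      using orig[of i j x] orig[of i' j' y] a by auto
    then show "x < y"
    proof cases
      case 1
      then show ?thesis using pushable_cross[OF pd] a by blast
    next
      case 2
      then show ?thesis using pushable_cross[OF pd, of r i' j j' x y] a by simp
    next
      case 3
      show ?thesis
      proof (cases "i = r")
        case True
        then have "x < e" using left[of j x] 3 by auto
        then show ?thesis using right[OF 3(5,4)] by simp
      next
        case False
        then show ?thesis using pushable_cross[OF pd, of i r j j' x y] a 3 by simp
      qed
    qed
  next
    have "T' p \<noteq> None \<Longrightarrow> p \<in> dom T \<union> (\<lambda>(i, j). (Suc i, j)) ` dom T" for p
    proof -
      obtain i j where p: "p = (i, j)" by fastforce
      assume "T' p \<noteq> None"
      then consider "T (i, j) \<noteq> None" | "i = Suc r" "T (r, j) \<noteq> None" unfolding p T' by (auto split: if_splits)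
      then show ?thesis unfolding p by cases force+
    qed
    then have "dom T' \<subseteq> dom T \<union> (\<lambda>(i, j). (Suc i, j)) ` dom T" by blast
    moreover have "finite (dom T)" using pd unfolding pushable_def by blast
    ultimately show "finite (dom T')" by (meson finite_UnI finite_imageI finite_subset)
  next
    fix i j assume "(i, j) \<in> dom T'"
    then show "1 \<le> i" "1 \<le> j" using dom by blast+
  next
    fix i assume "1 \<le> i \<and> i \<le> p"
    then obtain x where "T (i, 1) = Some x" using pushable_first[OF pd] by blast
    then show "(i, 1) \<in> dom T'" using c1 by (auto simp: T' dom_def)
  qed
  show "row_set T' = move_rows (row_set T) r e"
  proof
    fix i
    consider "i = r" | "i = Suc r" | "i \<noteq> r" "i \<noteq> Suc r" by blast
    then show "row_set T' i = move_rows (row_set T) r e i"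
    proof cases
      case 1
      have "x \<in> row_set T' r \<longleftrightarrow> x \<in> row_set T r \<and> x < e" for x
      proof
        assume "x \<in> row_set T' r"
        then obtain j where "T' (r, j) = Some x" by (auto simp: row_set_def)
        then have "T (r, j) = Some x" "j < c" by (auto simp: T' split: if_splits)
        then show "x \<in> row_set T r \<and> x < e" using left unfolding row_set_def by blast
      next
        assume x: "x \<in> row_set T r \<and> x < e"
        then obtain j where j: "T (r, j) = Some x" by (auto simp: row_set_def)
        then have "\<not> c \<le> j" using right[of j x] x by auto
        then have "T' (r, j) = Some x" using j by (simp add: T')
        then show "x \<in> row_set T' r" unfolding row_set_def by blast
      qed
      then show ?thesis using 1 by (auto simp: move_rows_def)
    next
      case 2
      have "x \<in> row_set T' (Suc r) \<longleftrightarrow> x \<in> row_set T (Suc r) \<or> x \<in> row_set T r \<and> e \<le> x" for x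
      proof
        assume "x \<in> row_set T' (Suc r)"
        then obtain j where "T' (Suc r, j) = Some x" by (auto simp: row_set_def)
        then consider "c \<le> j" "T (r, j) = Some x" | "T (Suc r, j) = Some x" by (auto simp: T' split: if_splits)
        then show "x \<in> row_set T (Suc r) \<or> x \<in> row_set T r \<and> e \<le> x"
          using right unfolding row_set_def by cases blast+
      next
        assume "x \<in> row_set T (Suc r) \<or> x \<in> row_set T r \<and> e \<le> x"
        then consider j where "T (Suc r, j) = Some x" | j where "T (r, j) = Some x" "e \<le> x"
          unfolding row_set_def by blast
        then show "x \<in> row_set T' (Suc r)"
        proof cases
          case (1 j)
          then have "T' (Suc r, j) = Some x" using below[of j x] by (simp add: T')
          then show ?thesis unfolding row_set_def by blast
        next
          case (2 j)
          then have "c \<le> j" using left[of j x] by (meson not_le)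
          then have "T' (Suc r, j) = Some x" using 2 by (simp add: T')
          then show ?thesis unfolding row_set_def by blast
        qed
      qed
      then show ?thesis using 2 by (auto simp: move_rows_def)
    next
      case 3
      then show ?thesis by (auto simp: move_rows_def row_set_def T')
    qed
  qed
qed

text \<open>The entry to the left of \<open>c\<close> is the last one remaining in its row. Thus the
  exposed entry is always the maximum of its row, and the run can be followed on sets without
  positions.\<close>

lemma push_push_rows:
  assumes "pushable p T" "1 \<le> r" "r \<le> p" "push T r (Max (row_columns T r)) = (T', r', k')"
  shows "pushable p T' \<and> push_rows (row_set T) r = (row_set T', r') \<and> k' = Max (row_columns T' r')"
  using assms
proof (induction r arbitrary: T)
  case (Suc r)
  note pd = Suc.prems(1)
  let ?e = "Max (row_set T (Suc r))"
  let ?C = "{c \<in> row_columns T r. ?e \<le> the (T (r, c))}"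
  have e: "the (T (Suc r, Max (row_columns T (Suc r)))) = ?e"
    using pushable_last[OF pd Suc.prems(2,3)] by simp
  have C: "?C \<noteq> {} \<longleftrightarrow> (\<exists>q\<in>row_set T r. ?e \<le> q)"
  proof
    assume "?C \<noteq> {}"
    then obtain c x where "T (r, c) = Some x" "?e \<le> x" by (auto simp: row_columns_def)
    then show "\<exists>q\<in>row_set T r. ?e \<le> q" unfolding row_set_def by blast
  next
    assume "\<exists>q\<in>row_set T r. ?e \<le> q"
    then obtain c x where "T (r, c) = Some x" "?e \<le> x" unfolding row_set_def by blast
    then have "c \<in> ?C" by (auto simp: row_columns_def)
    then show "?C \<noteq> {}" by blast
  qed
  show ?case
  proof (cases "?C = {}")
    case True
    then have "T' = T" "r' = Suc r" "k' = Max (row_columns T (Suc r))"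
      using Suc.prems(4) e by (auto simp: Let_def)
    moreover have "push_rows (row_set T) (Suc r) = (row_set T, Suc r)"
      using True C by simp
    ultimately show ?thesis using pd by simp
  next
    case False
    then have ex: "\<exists>q\<in>row_set T r. ?e \<le> q" using C by blast
    then have r: "1 \<le> r" "r < p"
      using stackedD(1)[OF pushable_stacked[OF pd]] Suc.prems by (cases r; auto)+
    let ?T = "move_down T r (Min ?C)"
    note md = move_down_pushable[OF pd r False]
    have "push ?T r (Max (row_columns ?T r)) = (T', r', k')"
      using Suc.prems(4) False by (simp only: push.simps Let_def e md(3) if_False)
    from Suc.IH[OF md(1) r(1) less_imp_le[OF r(2)] this]
    show ?thesis using ex unfolding md(2) by simp
  qed
qed simp

section \<open>The permutation of the push-down procedure\<close>

locale push_down =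
  fixes \<mu> :: "nat \<Rightarrow> nat" and S :: config and p :: nat
  assumes part: "is_partition \<mu>" and s: "ssyt (diagram \<mu>) S" and p: "p = col_len \<mu> 1"
begin

definition rows where "rows i = row_set (push_config S i)"

lemma le_p_iff: "1 \<le> r \<Longrightarrow> r \<le> p \<longleftrightarrow> 1 \<le> \<mu> r"
  using col_len_iff[OF part, of 1 r] p by simp

lemma pushable_S: "pushable p S"
  unfolding pushable_def
proof (intro conjI allI impI)
  fix r c c' x y assume "c < c' \<and> S (r, c) = Some x \<and> S (r, c') = Some y"
  then show "x \<le> y" using ssyt_row[OF s, of r c x c' y] by simp
next
  fix r r' c c' x y assume a: "r < r' \<and> c \<le> c' \<and> S (r, c) = Some x \<and> S (r', c') = Some y"
  then have "(r', c') \<in> diagram \<mu>" "(r, c) \<in> diagram \<mu>" using ssyt_dom[OF s] by blast+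
  then have "(r, c') \<in> diagram \<mu>"
    using diagram_mono[OF part, of r' c' r c'] a by (simp add: diagram_iff)
  then obtain z where z: "S (r, c') = Some z" using ssyt_dom[OF s] by blast
  then have "x \<le> z" using ssyt_row[OF s, of r c x c' z] a by simp
  also have "z < y" using ssyt_col[OF s z, of r' y] a by simp
  finally show "x < y" .
next
  show "finite (dom S)" using ssyt_dom[OF s] finite_diagram[OF part] by simp
  fix r c assume "(r, c) \<in> dom S"
  then have "(r, c) \<in> diagram \<mu>" using ssyt_dom[OF s] by simp
  then show "1 \<le> r" "1 \<le> c" by (simp_all add: diagram_iff)
next
  fix r assume "1 \<le> r \<and> r \<le> p"
  then have "(r, 1) \<in> diagram \<mu>" using le_p_iff[of r] by (simp add: diagram_iff)
  then show "(r, 1) \<in> dom S" using ssyt_dom[OF s] by simp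
qed

lemma push_step:
  assumes "i < p" "pushable p (push_config S i)"
  obtains r' where "pushable p (push_config S (Suc i))"
    "push_rows (rows i) (Suc i) = (rows (Suc i), r')" "1 \<le> r'" "r' \<le> Suc i"
    "exposed_value S (Suc i) = Max (rows (Suc i) r')"
proof -
  obtain T' r' k' where e: "push_row (push_config S i) (Suc i) = (T', r', k')"
    by (metis prod_cases3)
  then have T': "push_config S (Suc i) = T'" by simp
  have "push (push_config S i) (Suc i) (Max (row_columns (push_config S i) (Suc i))) = (T', r', k')"
    using e by (simp add: push_row_def)
  from push_push_rows[OF assms(2) _ _ this] assms(1)
  have 1: "pushable p T'" "push_rows (row_set (push_config S i)) (Suc i) = (row_set T', r')"
    "k' = Max (row_columns T' r')" by simp_all
  have 2: "1 \<le> r'" "r' \<le> Suc i"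
    using push_rows_props[OF pushable_stacked[OF assms(2)] _ _ 1(2)] assms(1) by simp_all
  have "T' (r', k') = Some (Max (row_set T' r'))"
    unfolding 1(3) by (rule pushable_last[OF 1(1) 2(1)]) (use 2 assms(1) in simp)
  then have "exposed_value S (Suc i) = Max (row_set T' r')"
    unfolding exposed_value_def using e T' by simp
  then show ?thesis using that[of r'] 1 2 T' by (simp add: rows_def)
qed

lemma pushable_push_config: "i \<le> p \<Longrightarrow> pushable p (push_config S i)"
proof (induction i)
  case 0
  then show ?case using pushable_S by simp
next
  case (Suc i)
  then show ?case using push_step[of i] by auto
qed

lemma stacked_rows: "i \<le> p \<Longrightarrow> stacked p (rows i)"
  unfolding rows_def by (rule pushable_stacked[OF pushable_push_config])

lemma rows_0: "rows 0 = row_set S"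
  by (simp add: rows_def)

lemma
  assumes "i < p"
  shows rows_Suc: "\<exists>r'. push_rows (rows i) (Suc i) = (rows (Suc i), r') \<and> 1 \<le> r' \<and> r' \<le> Suc i \<and>
      exposed_value S (Suc i) = Max (rows (Suc i) r')"
    and exposed_push_value: "exposed_value S (Suc i) = push_value (rows i) (Suc i) (Max (rows i (Suc i)))"
    and rows_above: "Suc i < t \<Longrightarrow> rows (Suc i) t = rows i t"
    and rows_mono: "rows i (Suc i) \<subseteq> rows (Suc i) (Suc i)"
    and compose_preds_rows: "Suc i \<le> k \<Longrightarrow> compose_preds (rows (Suc i)) k A = compose_preds (rows i) k A"
proof -
  obtain r' where r': "push_rows (rows i) (Suc i) = (rows (Suc i), r')" "1 \<le> r'" "r' \<le> Suc i"
    "exposed_value S (Suc i) = Max (rows (Suc i) r')"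
    using push_step[OF assms pushable_push_config] assms by auto
  then show "\<exists>r'. push_rows (rows i) (Suc i) = (rows (Suc i), r') \<and> 1 \<le> r' \<and> r' \<le> Suc i \<and>
      exposed_value S (Suc i) = Max (rows (Suc i) r')" by blast
  have "stacked p (rows i)" using stacked_rows assms by simp
  from push_rows_props[OF this _ _ r'(1)] assms
  have P: "\<forall>t>Suc i. rows (Suc i) t = rows i t" "rows i (Suc i) \<subseteq> rows (Suc i) (Suc i)"
    "\<forall>k\<ge>Suc i. \<forall>A. compose_preds (rows (Suc i)) k A = compose_preds (rows i) k A"
    "Max (rows (Suc i) r') = push_value (rows i) (Suc i) (Max (rows i (Suc i)))"
    by simp_all
  show "exposed_value S (Suc i) = push_value (rows i) (Suc i) (Max (rows i (Suc i)))"
    using P(4) r'(4) by simp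
  show "rows (Suc i) t = rows i t" if "Suc i < t" using P(1) that by blast
  show "rows i (Suc i) \<subseteq> rows (Suc i) (Suc i)" by (rule P(2))
  show "compose_preds (rows (Suc i)) k A = compose_preds (rows i) k A" if "Suc i \<le> k"
    using P(3) that by blast
qed

lemma rows_untouched: "i \<le> p \<Longrightarrow> i < t \<Longrightarrow> rows i t = row_set S t"
proof (induction i)
  case (Suc i)
  then show ?case using rows_above[of i t] by simp
qed (simp add: rows_0)

lemma compose_preds_rows_eq: "i \<le> p \<Longrightarrow> i \<le> k \<Longrightarrow> compose_preds (rows i) k A = compose_preds (row_set S) k A"
proof (induction i)
  case (Suc i)
  then show ?case using compose_preds_rows[of i k A] by simp
qed (simp add: rows_0)

lemma row_ends:
  assumes "i \<le> p"
  shows "(\<forall>t t'. 1 \<le> t \<and> t < t' \<and> t' \<le> i \<longrightarrow> Max (rows i t) < Max (rows i t')) \<and>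
    (\<lambda>t. Max (rows i t)) ` {1..i} = exposed_value S ` {1..i}"
  using assms
proof (induction i)
  case (Suc i)
  then have i: "i < p" by simp
  have IH: "\<And>t t'. 1 \<le> t \<Longrightarrow> t < t' \<Longrightarrow> t' \<le> i \<Longrightarrow> Max (rows i t) < Max (rows i t')"
    "(\<lambda>t. Max (rows i t)) ` {1..i} = exposed_value S ` {1..i}" using Suc by simp_all
  obtain r' where r': "push_rows (rows i) (Suc i) = (rows (Suc i), r')"
      "exposed_value S (Suc i) = Max (rows (Suc i) r')" using rows_Suc[OF i] by blast
  have set: "{1..Suc i} - {Suc i} = {1..i}" "{1..Suc i} = insert (Suc i) {1..i}" by auto
  have "(\<forall>s s'. 1 \<le> s \<and> s < s' \<and> s' \<le> Suc i \<longrightarrow> Max (rows (Suc i) s) < Max (rows (Suc i) s')) \<and>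
    (\<lambda>s. Max (rows (Suc i) s)) ` {1..Suc i} =
      insert (Max (rows (Suc i) r')) ((\<lambda>s. Max (rows i s)) ` ({1..Suc i} - {Suc i}))"
    by (rule push_rows_ends[OF stacked_rows _ _ _ r'(1)]) (use i IH(1) in auto)
  then show ?case unfolding set(1) IH(2) r'(2)[symmetric] using set(2) by simp
qed simp

lemma exposed_compose_preds:
  assumes "i \<le> p"
  shows "exposed_value S ` {1..i} = compose_preds (row_set S) i {}"
proof -
  have "compose_preds (rows i) i {} = {} \<union> (\<lambda>t. Max (rows i t)) ` {1..i}"
    by (rule compose_preds_ends[OF stacked_rows[OF assms] assms]) (use row_ends[OF assms] in auto)
  then show ?thesis using row_ends[OF assms] compose_preds_rows_eq[OF assms order_refl] by simp
qed

text \<open>The exposed values form the set of the \<open>p\<close> strictly increasing row maxima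
  after the last stage, so there are \<open>p\<close> of them.\<close>

lemma inj_on_exposed: "inj_on (exposed_value S) {1..p}"
proof (rule eq_card_imp_inj_on)
  have "inj_on (\<lambda>t. Max (rows p t)) {1..p}"
  proof (rule inj_onI)
    fix t t' assume "t \<in> {1..p}" "t' \<in> {1..p}" "Max (rows p t) = Max (rows p t')"
    then show "t = t'" using row_ends[OF order_refl]
      by (metis atLeastAtMost_iff less_irrefl linorder_neqE_nat)
  qed
  then have "card ((\<lambda>t. Max (rows p t)) ` {1..p}) = p" by (simp add: card_image)
  then show "card (exposed_value S ` {1..p}) = card {1..p}" using row_ends[OF order_refl] by simp
qed simp

lemma exposed_in_ran: "exposed_value S ` {1..p} \<subseteq> ran S"
proof -
  have "compose_preds (row_set S) p {} \<subseteq> (\<Union>t\<in>{1..p}. row_set S t)"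
    using compose_preds_subset[of "row_set S" p "{}"] by simp
  also have "\<dots> \<subseteq> ran S" by (auto simp: row_set_def ran_def)
  finally show ?thesis unfolding exposed_compose_preds[OF order_refl] .
qed

text \<open>Rows of equal length end in the same column, and each is still as in \<open>S\<close>
  when its stage begins, so the starting values satisfy \<open>?e < ?f\<close>. Then
  \<open>push_value_mono\<close> gives the weak inequality, or else a run stops at once; injectivity
  makes it strict.\<close>

lemma exposed_increasing:
  assumes i: "1 \<le> i" "i < p" and eq: "\<mu> i = \<mu> (Suc i)"
  shows "exposed_value S i < exposed_value S (Suc i)"
proof -
  obtain i0 where i0: "i = Suc i0" using i by (cases i) auto
  have i0p: "i0 < p" using i i0 by simp
  let ?e = "Max (rows i0 i)" and ?f = "Max (rows i (Suc i))"
  have last: "S (r, \<mu> r) = Some (Max (row_set S r))" if "1 \<le> r" "r \<le> p" for r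
  proof -
    have "1 \<le> \<mu> r" using le_p_iff that by simp
    then have "Max (row_columns S r) = \<mu> r"
      unfolding row_columns_straight[OF s that(1)] by (intro Max_eqI) auto
    then show ?thesis using pushable_last[OF pushable_S that] by simp
  qed
  have e: "?e = Max (row_set S i)" and f: "?f = Max (row_set S (Suc i))"
    using rows_untouched[of i0 i] rows_untouched[of i "Suc i"] i i0 by simp_all
  have ef: "?e < ?f"
    using ssyt_col[OF s last[of i], of "Suc i" "Max (row_set S (Suc i))"] last[of "Suc i"] i eq
    unfolding e f by simp
  have st: "stacked p (rows i0)" "stacked p (rows i)" using stacked_rows i i0 by simp_all
  have "?e \<in> rows i0 i" using stackedD(2,3)[OF st(1), of i] i by simp
  then have ei: "?e \<in> rows i i" using rows_mono[OF i0p] i0 by auto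
  have fst: "rows i = fst (push_rows (rows i0) i)" using rows_Suc[OF i0p] unfolding i0 by (metis fst_conv)
  have mono: "exposed_value S i \<le> push_value (rows i) i f" if "?e \<le> f" for f
    using push_value_mono[OF st(1) i(1) _ that] i exposed_push_value[OF i0p] fst i0 by simp
  have "exposed_value S i \<le> exposed_value S (Suc i)"
  proof (cases "\<exists>q\<in>rows i i. ?f \<le> q")
    case True
    have "?e \<le> Max {q \<in> rows i i. q < ?f}"
      using ei ef stackedD(2)[OF st(2)] by (intro Max_ge) auto
    then show ?thesis using mono True exposed_push_value[OF i(2)] by simp
  next
    case False
    have "exposed_value S i \<le> ?e"
      unfolding exposed_push_value[OF i0p, folded i0]
      by (rule push_value_le[OF st(1) _ \<open>?e \<in> rows i0 i\<close>]) (use i in simp_all)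
    then show ?thesis using False exposed_push_value[OF i(2)] ef by simp
  qed
  moreover have "exposed_value S i \<noteq> exposed_value S (Suc i)"
    using inj_on_exposed i by (auto dest: inj_onD)
  ultimately show ?thesis by simp
qed

lemma right_key_exposed:
  assumes "1 \<le> j" "j \<le> \<mu> 1"
  shows "right_key S (r, j) = (if 1 \<le> r \<and> r \<le> col_len \<mu> j
    then Some (sorted_list_of_set (exposed_value S ` {1..col_len \<mu> j}) ! (r - 1)) else None)"
proof -
  interpret right_key_column \<mu> S j using part s assms by unfold_locales
  have "k \<le> p"
    using le_p_iff[OF k1] le_k_iff[OF k1] j by simp
  have "set_mset (R r) = row_set S r" if "1 \<le> r" for r
  proof -
    have "(r, c) \<in> diagram \<mu>" if "S (r, c) = Some v" for c v using that ssyt_dom[OF s] by blast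
    then show ?thesis
      using in_row_mset_straight[OF s that] unfolding R_def row_set_def by blast
  qed
  then have "C 0 = compose_preds (row_set S) k {}"
    unfolding C_def diff_zero compose_preds_ejected by (intro compose_preds_cong) simp
  also have "\<dots> = exposed_value S ` {1..k}" using exposed_compose_preds[OF \<open>k \<le> p\<close>] by simp
  finally show ?thesis using right_key_column[of r] by (simp add: k_def)
qed

end

section \<open>Key tableaux and cosets of the stabiliser\<close>

lemma sorted_list_of_set_nth_antimono:
  fixes A B :: "nat set"
  assumes "finite A" "B \<subseteq> A" "i < card B"
  shows "sorted_list_of_set A ! i \<le> sorted_list_of_set B ! i"
proof (rule ccontr)
  let ?x = "sorted_list_of_set A ! i"
  assume "\<not> ?thesis"
  then have "i < card {b \<in> B. b < ?x}"
    using sorted_list_of_set_nth_less_iff[OF finite_subset[OF assms(2,1)] assms(3), of ?x] by simp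
  also have "\<dots> \<le> card {a \<in> A. a < ?x}" using assms by (intro card_mono) auto
  finally have "?x < ?x"
    using sorted_list_of_set_nth_less_iff[OF assms(1), of i ?x] assms card_mono[OF assms(1,2)] by simp
  then show False by simp
qed

lemma key_tableau_is_key:
  assumes p: "is_partition \<mu>" and inj: "inj \<sigma>"
  shows "is_key_tableau \<mu> (key_tableau \<mu> \<sigma>)"
proof -
  let ?A = "\<lambda>c. \<sigma> ` {1..col_len \<mu> c}"
  have K: "key_tableau \<mu> \<sigma> (r, c) = Some x \<longleftrightarrow>
      (r, c) \<in> diagram \<mu> \<and> x = sorted_list_of_set (?A c) ! (r - 1)" for r c x
    by (auto simp: key_tableau_def col_len_def)
  have card: "card (?A c) = col_len \<mu> c" for c
    using card_image[OF inj_on_subset[OF inj]] by simp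
  have r: "1 \<le> r \<and> 1 \<le> c \<and> r \<le> col_len \<mu> c" if "(r, c) \<in> diagram \<mu>" for r c
    using that col_len_iff[OF p, of c r] by (simp add: diagram_iff)
  have mono: "col_len \<mu> c' \<le> col_len \<mu> c" if "1 \<le> c" "c \<le> c'" for c c'
  proof (cases "col_len \<mu> c'")
    case (Suc b)
    then have "c' \<le> \<mu> (col_len \<mu> c')" using col_len_iff[OF p, of c' "col_len \<mu> c'"] that by simp
    then show ?thesis using col_len_iff[OF p that(1), of "col_len \<mu> c'"] that Suc by simp
  qed simp
  have "ssyt (diagram \<mu>) (key_tableau \<mu> \<sigma>)" unfolding ssyt_def K
  proof (intro conjI allI impI)
    show "dom (key_tableau \<mu> \<sigma>) = diagram \<mu>" by (auto simp: key_tableau_def split: if_splits)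
  next
    fix t c c' x y
    assume a: "c < c' \<and> ((t, c) \<in> diagram \<mu> \<and> x = sorted_list_of_set (?A c) ! (t - 1)) \<and>
      (t, c') \<in> diagram \<mu> \<and> y = sorted_list_of_set (?A c') ! (t - 1)"
    have "?A c' \<subseteq> ?A c" using mono[of c c'] r[of t c] a by (intro image_mono) auto
    then show "x \<le> y" using a r[of t c'] card[of c']
      by (simp only:) (rule sorted_list_of_set_nth_antimono, auto)
  next
    fix t t' c x y
    assume a: "t < t' \<and> ((t, c) \<in> diagram \<mu> \<and> x = sorted_list_of_set (?A c) ! (t - 1)) \<and>
      (t', c) \<in> diagram \<mu> \<and> y = sorted_list_of_set (?A c) ! (t' - 1)"
    have "t - 1 < t' - 1" "t' - 1 < length (sorted_list_of_set (?A c))"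
      using a r[of t c] r[of t' c] card[of c] by auto
    then show "x < y" using a sorted_wrt_nth_less[of "(<)" "sorted_list_of_set (?A c)"] by simp
  qed
  moreover have "column_entries (key_tableau \<mu> \<sigma>) c = ?A c" if "1 \<le> c" for c
  proof -
    have d: "(t, c) \<in> diagram \<mu> \<longleftrightarrow> 1 \<le> t \<and> t \<le> col_len \<mu> c" for t
      using col_len_iff[OF p that, of t] that by (auto simp: diagram_iff)
    have "column_entries (key_tableau \<mu> \<sigma>) c = set (sorted_list_of_set (?A c))"
      unfolding column_entries_def K d conj_assoc by (rule set_conv_nth_shift) (use card[of c] in simp)
    then show ?thesis by simp
  qed
  ultimately show ?thesis unfolding is_key_tableau_def
    using mono by (auto intro!: imageI elim!: order_trans)
qed

lemma mem_stab_iff: "t \<in> stab n \<mu> \<longleftrightarrow> t permutes {1..n} \<and> (\<forall>i. \<mu> (t i) = \<mu> i)"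
proof -
  have "comp_act t \<mu> = \<mu> \<longleftrightarrow> (\<forall>i. \<mu> (t i) = \<mu> i)" if t: "t permutes {1..n}"
  proof
    assume a: "comp_act t \<mu> = \<mu>"
    show "\<forall>i. \<mu> (t i) = \<mu> i"
    proof
      fix i
      have "\<mu> (inv' t (t i)) = \<mu> (t i)" using fun_cong[OF a, of "t i"] by (simp add: comp_act_def)
      then show "\<mu> (t i) = \<mu> i" using permutes_inverses(2)[OF t] by simp
    qed
  next
    assume a: "\<forall>i. \<mu> (t i) = \<mu> i"
    show "comp_act t \<mu> = \<mu>"
    proof
      fix i
      show "comp_act t \<mu> i = \<mu> i"
        unfolding comp_act_def using spec[OF a, of "inv' t i"] permutes_inverses(1)[OF t, of i] by simp
    qed
  qed
  then show ?thesis by (auto simp: stab_def stabilizer_def sym_group_carrier)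
qed

lemma mem_coset_iff: "w \<in> \<phi> <#\<^bsub>sym_group n\<^esub> stab n \<mu> \<longleftrightarrow> (\<exists>t\<in>stab n \<mu>. w = \<phi> \<circ> t)"
  unfolding l_coset_def sym_group_mult by blast

text \<open>The permutation \<open>t\<close> preserves the set of positions whose part is at least
  \<open>c\<close>, and for a partition this is the initial segment whose image fills column
  \<open>c\<close>.\<close>

lemma key_tableau_coset:
  assumes p: "is_partition \<mu>" and t: "t \<in> stab n \<mu>"
  shows "key_tableau \<mu> (\<phi> \<circ> t) = key_tableau \<mu> \<phi>"
proof -
  have h: "t ` {i. 1 \<le> i \<and> c \<le> \<mu> i} = {i. 1 \<le> i \<and> c \<le> \<mu> i}" if "1 \<le> c" for c
  proof (rule endo_inj_surj)
    show "finite {i. 1 \<le> i \<and> c \<le> \<mu> i}" unfolding col_len_set[OF p that] by simp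
    have tp: "t permutes {1..n}" "\<And>i. \<mu> (t i) = \<mu> i" using t mem_stab_iff by blast+
    show "inj_on t {i. 1 \<le> i \<and> c \<le> \<mu> i}" using permutes_inj[OF tp(1)] inj_on_subset by blast
    have "1 \<le> t i" if "1 \<le> i" for i
      using permutes_in_image[OF tp(1), of i] permutes_not_in[OF tp(1), of i] that
      by (cases "i \<in> {1..n}") auto
    then show "t ` {i. 1 \<le> i \<and> c \<le> \<mu> i} \<subseteq> {i. 1 \<le> i \<and> c \<le> \<mu> i}" using tp(2) by auto
  qed
  have t: "t ` {1..col_len \<mu> c} = {1..col_len \<mu> c}" if "1 \<le> c" for c
    using h[OF that] unfolding col_len_set[OF p that] .
  have im: "(\<phi> \<circ> t) ` {1..col_len \<mu> c} = \<phi> ` {1..col_len \<mu> c}" if "1 \<le> c" for c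
    unfolding image_comp[symmetric] t[OF that] ..
  show ?thesis
  proof
    fix b :: "nat \<times> nat"
    obtain r c where b: "b = (r, c)" by fastforce
    show "key_tableau \<mu> (\<phi> \<circ> t) b = key_tableau \<mu> \<phi> b"
    proof (cases "(r, c) \<in> diagram \<mu>")
      case True
      then have "1 \<le> c" by (simp add: diagram_iff)
      from im[OF this] show ?thesis unfolding b key_tableau_def col_len_def[symmetric] by simp
    qed (simp add: b key_tableau_def)
  qed
qed

text \<open>Equal parts of a partition occupy an interval, so comparing neighbours suffices. The
  positions after the last nonzero part form one block with part zero; it carries the values missing
  from the exposed ones.\<close>

definition block_increasing :: "nat \<Rightarrow> (nat \<Rightarrow> nat) \<Rightarrow> (nat \<Rightarrow> nat) \<Rightarrow> bool" where
  "block_increasing n \<mu> w \<longleftrightarrow> (\<forall>i. 1 \<le> i \<and> i < n \<and> \<mu> i = \<mu> (Suc i) \<longrightarrow> w i < w (Suc i))"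

lemma block_increasing_less:
  assumes p: "is_partition \<mu>" and w: "block_increasing n \<mu> w"
    and "1 \<le> i" "i < l" "l \<le> n" "\<mu> i = \<mu> l"
  shows "w i < w l"
  using assms(4-)
proof (induction l)
  case (Suc l)
  show ?case
  proof (cases "i = l")
    case True
    then show ?thesis using Suc.prems assms(3) w by (simp add: block_increasing_def)
  next
    case False
    then have il: "i < l" using Suc.prems by simp
    then have "\<mu> l = \<mu> (Suc l)"
      using is_partition_mono[OF p, of i l] is_partition_mono[OF p, of l "Suc l"] Suc.prems assms(3) by simp
    then have "w l < w (Suc l)" using w Suc.prems il assms(3) by (simp add: block_increasing_def)
    moreover have "w i < w l" using Suc il \<open>\<mu> l = \<mu> (Suc l)\<close> by simp
    ultimately show ?thesis by simp
  qed
qed simp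

text \<open>At the least moved position \<open>i\<close>, both \<open>t i\<close> and the preimage
  \<open>l\<close> of \<open>i\<close> lie beyond \<open>i\<close> in its block. Then
  \<open>\<phi>\<close> gives \<open>\<phi> i < \<phi> (t i)\<close>, while
  \<open>\<phi> \<circ> t\<close>, compared at \<open>i\<close> and \<open>l\<close>, gives the
  opposite.\<close>

lemma block_increasing_unique:
  assumes p: "is_partition \<mu>" and f: "block_increasing n \<mu> \<phi>" and w: "block_increasing n \<mu> (\<phi> \<circ> t)"
    and t: "t \<in> stab n \<mu>"
  shows "t = id"
proof (rule ccontr)
  assume "t \<noteq> id"
  have tp: "t permutes {1..n}" "\<And>i. \<mu> (t i) = \<mu> i" using t mem_stab_iff by blast+
  define i where "i = (LEAST i. t i \<noteq> i)"
  have "\<exists>i. t i \<noteq> i" using \<open>t \<noteq> id\<close> by (auto simp: fun_eq_iff)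
  then have i: "t i \<noteq> i" unfolding i_def by (rule LeastI_ex)
  have fixed: "t j = j" if "j < i" for j using not_less_Least[of j "\<lambda>i. t i \<noteq> i"] that unfolding i_def by blast
  have i1: "i \<in> {1..n}" using permutes_not_in[OF tp(1)] i by blast
  have inj: "t a = t b \<Longrightarrow> a = b" for a b using permutes_inj[OF tp(1)] by (auto dest: injD)
  have "\<not> t i < i" using fixed[of "t i"] inj[of "t i" i] i by auto
  then have ti: "i < t i" using i by simp
  obtain l where l: "t l = i" using permutes_surj[OF tp(1)] by (metis surjD)
  have "\<not> l < i" using fixed[of l] l by auto
  moreover have "l \<noteq> i" using l i by auto
  ultimately have il: "i < l" by simp
  have ln: "l \<in> {1..n}" "t i \<in> {1..n}"
    using permutes_in_image[OF tp(1)] l i1 by auto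
  have "\<phi> i < \<phi> (t i)"
    by (rule block_increasing_less[OF p f _ ti]) (use i1 ln tp(2)[of i] in auto)
  moreover have "(\<phi> \<circ> t) i < (\<phi> \<circ> t) l"
    by (rule block_increasing_less[OF p w _ il]) (use i1 ln tp(2)[of l] l in auto)
  ultimately show False using l by simp
qed

section \<open>Inversions and the Bruhat order on a coset\<close>

lemma perm_length_transpose:
  assumes i: "1 \<le> i" "i < n" and w: "w (Suc i) < w i"
  shows "perm_length n (w \<circ> transpose i (Suc i)) < perm_length n w"
proof -
  let ?t = "transpose i (Suc i)"
  let ?I = "\<lambda>w. {(a, b). 1 \<le> a \<and> a < b \<and> b \<le> n \<and> w b < (w a :: nat)}"
  have fin: "finite (?I w)" by (rule finite_subset[of _ "{1..n} \<times> {1..n}"]) auto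
  have t: "?t a = (if a = i then Suc i else if a = Suc i then i else a)" for a
    by (simp add: transpose_def)
  \<comment> \<open>Exchanging the two positions injects the inversions of
    \<open>w \<circ> ?t\<close> into those of \<open>w\<close>, and the inversion
    \<open>(i, Suc i)\<close> is missed.\<close>
  have "card (?I (w \<circ> ?t)) \<le> card (?I w - {(i, Suc i)})"
  proof (rule card_inj_on_le)
    show "inj_on (map_prod ?t ?t) (?I (w \<circ> ?t))"
      by (rule inj_on_subset[of _ UNIV]) (auto intro!: map_prod_inj_on[of ?t UNIV ?t UNIV, simplified] inj_transpose)
    show "map_prod ?t ?t ` ?I (w \<circ> ?t) \<subseteq> ?I w - {(i, Suc i)}"
    proof
      fix x assume "x \<in> map_prod ?t ?t ` ?I (w \<circ> ?t)"
      then obtain a b where x: "x = (?t a, ?t b)" and ab: "1 \<le> a" "a < b" "b \<le> n" "w (?t b) < w (?t a)"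
        by auto
      have "\<not> (a = i \<and> b = Suc i)" using ab(4) w by (auto simp: t)
      then have "?t a < ?t b" using ab(2) unfolding t by (auto split: if_splits)
      moreover have "1 \<le> ?t a" "?t b \<le> n" using ab i unfolding t by auto
      moreover have "\<not> (?t a = i \<and> ?t b = Suc i)" using ab(2) unfolding t by (auto split: if_splits)
      ultimately show "x \<in> ?I w - {(i, Suc i)}" using x ab(4) by auto
    qed
    show "finite (?I w - {(i, Suc i)})" using fin by simp
  qed
  also have "\<dots> < card (?I w)" by (rule card_Diff1_less[OF fin]) (use i w in auto)
  finally show ?thesis by (simp add: perm_length_def)
qed

lemma bruhat_le_length: "bruhat_le n v w \<Longrightarrow> v = w \<or> perm_length n v < perm_length n w"
  unfolding bruhat_le_def
proof (induction rule: rtranclp_induct)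
  case (step y z)
  then show ?case unfolding bruhat_step_def by auto
qed simp

text \<open>Any other element of the coset has a descent at neighbouring positions with equal parts.
  Exchanging them stays in the coset and is a Bruhat step downwards, so that element is not minimal.
  Repeating this shows that \<open>\<phi>\<close> has least length, and as Bruhat steps raise
  length, nothing else in the coset lies below it.\<close>

lemma bruhat_minimal_block_increasing:
  assumes p: "is_partition \<mu>" and perm: "\<phi> permutes {1..n}" and inc: "block_increasing n \<mu> \<phi>"
  shows "bruhat_minimal n (\<phi> <#\<^bsub>sym_group n\<^esub> stab n \<mu>) = {\<phi>}"
proof -
  let ?C = "\<phi> <#\<^bsub>sym_group n\<^esub> stab n \<mu>"
  have \<phi>: "\<phi> \<in> ?C" unfolding mem_coset_iff
    by (rule bexI[of _ id]) (simp_all add: mem_stab_iff permutes_id)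
  have down: "\<exists>v\<in>?C. bruhat_step n v w \<and> perm_length n v < perm_length n w" if w: "w \<in> ?C" "w \<noteq> \<phi>" for w
  proof -
    obtain t where t: "t \<in> stab n \<mu>" "w = \<phi> \<circ> t" using w(1) unfolding mem_coset_iff by blast
    have "\<not> block_increasing n \<mu> w"
    proof
      assume "block_increasing n \<mu> w"
      then have "t = id" unfolding t(2) by (rule block_increasing_unique[OF p inc _ t(1)])
      then show False using t(2) w(2) by simp
    qed
    then obtain i where i: "1 \<le> i" "i < n" "\<mu> i = \<mu> (Suc i)" "\<not> w i < w (Suc i)"
      unfolding block_increasing_def by blast
    have wp: "w permutes {1..n}"
      unfolding t(2) using t(1) perm by (simp add: mem_stab_iff permutes_compose)
    have "w i \<noteq> w (Suc i)" using inj_eq[OF permutes_inj[OF wp]] by simp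
    then have lt: "w (Suc i) < w i" using i by simp
    let ?s = "transpose i (Suc i)"
    have sp: "?s permutes {1..n}" by (rule permutes_swap_id) (use i in auto)
    have "\<mu> (?s a) = \<mu> a" for a using i(3) by (cases "a = i"; cases "a = Suc i") simp_all
    then have ts: "t \<circ> ?s \<in> stab n \<mu>"
      using t(1) permutes_compose[OF sp, of t] unfolding mem_stab_iff by simp
    let ?v = "w \<circ> ?s"
    have v: "?v \<in> ?C" unfolding mem_coset_iff t(2) by (rule bexI[OF _ ts]) (rule comp_assoc)
    have len: "perm_length n ?v < perm_length n w" by (rule perm_length_transpose[OF i(1,2) lt])
    have vp: "?v permutes {1..n}" using permutes_compose[OF sp wp] .
    have wv: "w = ?v \<circ> ?s" by (simp add: comp_assoc)
    have "i \<in> {1..n}" "Suc i \<in> {1..n}" "i \<noteq> Suc i" using i by auto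
    then have "\<exists>a\<in>{1..n}. \<exists>b\<in>{1..n}. a \<noteq> b \<and> w = ?v \<circ> transpose a b" using wv by blast
    then have "bruhat_step n ?v w"
      unfolding bruhat_step_def sym_group_carrier using vp len by blast
    then show ?thesis using v len by blast
  qed
  have least: "perm_length n \<phi> \<le> perm_length n w" if "w \<in> ?C" for w
    using that
  proof (induction "perm_length n w" arbitrary: w rule: less_induct)
    case less
    show ?case
    proof (cases "w = \<phi>")
      case False
      then obtain v where "v \<in> ?C" "perm_length n v < perm_length n w" using down less.prems by blast
      then show ?thesis using less.hyps[of v] by simp
    qed simp
  qed
  show ?thesis
  proof (intro equalityI subsetI)
    fix w assume "w \<in> bruhat_minimal n ?C"
    then have w: "w \<in> ?C" "\<And>v. v \<in> ?C \<Longrightarrow> bruhat_le n v w \<Longrightarrow> v = w"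
      by (simp_all add: bruhat_minimal_def)
    show "w \<in> {\<phi>}"
    proof (rule ccontr)
      assume "w \<notin> {\<phi>}"
      then obtain v where v: "v \<in> ?C" "bruhat_step n v w" "perm_length n v < perm_length n w"
        using down[OF w(1)] by auto
      have "bruhat_le n v w" unfolding bruhat_le_def
        using r_into_rtranclp[of "bruhat_step n" v w] v(2) by simp
      then show False using w(2)[OF v(1)] v(3) by simp
    qed
  next
    fix w assume "w \<in> {\<phi>}"
    moreover have "v = \<phi>" if "v \<in> ?C" "bruhat_le n v \<phi>" for v
      using bruhat_le_length[OF that(2)] least[OF that(1)] by auto
    ultimately show "w \<in> bruhat_minimal n ?C" using \<phi> by (simp add: bruhat_minimal_def)
  qed
qed

section \<open>The permutation as a whole and its key tableau\<close>

context push_down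
begin

lemma
  assumes n: "p \<le> n" and ran: "ran S \<subseteq> {1..n}"
  shows push_down_perm_permutes: "push_down_perm n p S permutes {1..n}"
    and push_down_perm_block_increasing: "block_increasing n \<mu> (push_down_perm n p S)"
proof -
  let ?\<phi> = "push_down_perm n p S"
  let ?X = "exposed_value S ` {1..p}"
  let ?xs = "sorted_list_of_set ({1..n} - ?X)"
  have low: "?\<phi> i = exposed_value S i" if "1 \<le> i" "i \<le> p" for i
    using that by (simp add: push_down_perm_def)
  have high: "?\<phi> i = ?xs ! (i - p - 1)" if "p < i" "i \<le> n" for i
    using that by (simp add: push_down_perm_def)
  have X: "?X \<subseteq> {1..n}" using exposed_in_ran ran by blast
  have len: "length ?xs = n - p" using X card_image[OF inj_on_exposed] by (simp add: card_Diff_subset)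
  have "?\<phi> ` {1..n} = {1..n}"
  proof -
    have "{1..n} = {1..p} \<union> {p<..n}" using n by auto
    moreover have "?\<phi> ` {1..p} = ?X" using low by (intro image_cong) auto
    moreover have "?\<phi> ` {p<..n} = {1..n} - ?X"
    proof -
      have "?\<phi> ` {p<..n} = (\<lambda>i. ?xs ! (i - p - 1)) ` {p<..n}" using high by (intro image_cong) auto
      also have "\<dots> = (!) ?xs ` {..<n - p}"
      proof -
        have "(\<lambda>i. i - p - 1) ` {p<..n} = {..<n - p}"
        proof (intro equalityI subsetI)
          fix i assume "i \<in> {..<n - p}"
          then show "i \<in> (\<lambda>i. i - p - 1) ` {p<..n}" by (intro image_eqI[of _ _ "i + p + 1"]) auto
        qed auto
        then show ?thesis by (metis image_image)
      qed
      also have "\<dots> = set ?xs" using len by (auto simp: set_conv_nth image_iff simp del: set_sorted_list_of_set)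
      finally show ?thesis by simp
    qed
    ultimately show ?thesis using X by (metis Un_Diff_cancel Un_absorb1 image_Un)
  qed
  then have "bij_betw ?\<phi> {1..n} {1..n}"
    by (simp add: bij_betw_def finite_surj_inj)
  moreover have "?\<phi> i = i" if "i \<notin> {1..n}" for i
    using that n by (auto simp: push_down_perm_def)
  ultimately show "?\<phi> permutes {1..n}" by (rule bij_imp_permutes)
  show "block_increasing n \<mu> ?\<phi>" unfolding block_increasing_def
  proof (intro allI impI)
    fix i assume i: "1 \<le> i \<and> i < n \<and> \<mu> i = \<mu> (Suc i)"
    \<comment> \<open>The case \<open>i = p\<close> is excluded: \<open>\<mu> p\<close> is nonzero
      and \<open>\<mu> (Suc p)\<close> is zero, so these parts differ.\<close>
    consider "i < p" | "p < i" using le_p_iff[of i] le_p_iff[of "Suc i"] i by fastforce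
    then show "?\<phi> i < ?\<phi> (Suc i)"
    proof cases
      case 1
      then show ?thesis using exposed_increasing[of i] low[of i] low[of "Suc i"] i by simp
    next
      case 2
      have "?xs ! (i - p - 1) < ?xs ! (Suc i - p - 1)"
        by (rule sorted_wrt_nth_less[of "(<)"]) (use 2 i len in auto)
      then show ?thesis using high[of i] high[of "Suc i"] 2 i by simp
    qed
  qed
qed

lemma right_key_push_down:
  assumes n: "p \<le> n"
  shows "right_key S = key_tableau \<mu> (push_down_perm n p S)"
proof
  fix b :: "nat \<times> nat"
  obtain r j where b: "b = (r, j)" by fastforce
  let ?\<phi> = "push_down_perm n p S"
  show "right_key S b = key_tableau \<mu> ?\<phi> b"
  proof (cases "1 \<le> j \<and> j \<le> \<mu> 1")
    case True
    have d: "(r, j) \<in> diagram \<mu> \<longleftrightarrow> 1 \<le> r \<and> r \<le> col_len \<mu> j"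
      using col_len_iff[OF part, of j r] True by (auto simp: diagram_iff)
    \<comment> \<open>No column is longer than the first, so the key tableau involves only exposed
      values.\<close>
    have "col_len \<mu> j \<le> p"
    proof (cases "col_len \<mu> j")
      case (Suc k)
      then have "j \<le> \<mu> (col_len \<mu> j)" using col_len_iff[OF part, of j "col_len \<mu> j"] True by simp
      then show ?thesis using le_p_iff[of "col_len \<mu> j"] Suc True by simp
    qed simp
    then have "?\<phi> ` {1..col_len \<mu> j} = exposed_value S ` {1..col_len \<mu> j}"
      by (intro image_cong) (auto simp: push_down_perm_def)
    then show ?thesis
      using right_key_exposed[of j r] True d unfolding b key_tableau_def col_len_def[symmetric]
      by (simp del: One_nat_def)
  next
    case False
    then have "(r, j) \<notin> diagram \<mu>" using is_partition_mono[OF part, of 1 r] by (auto simp: diagram_iff)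
    moreover have "num_columns S = \<mu> 1" by (rule num_columns_straight[OF part s])
    ultimately show ?thesis using False unfolding b by (simp add: right_key_def key_tableau_def) auto
  qed
qed

end

theorem theorem3p1:
  fixes n p :: nat and \<mu> \<phi> :: "nat \<Rightarrow> nat" and S :: config
  assumes "1 \<le> n"
    and "is_partition \<mu>"
    and "card {i. 1 \<le> i \<and> \<mu> i \<noteq> 0} = p"
    and "p \<le> n"
    and "ssyt (diagram \<mu>) S"
    and "ran S \<subseteq> {1..n}"
    and "\<phi> = push_down_perm n p S"
  shows "\<phi> \<in> carrier (sym_group n) \<and>
    (is_key_tableau \<mu> (right_key S) \<and>
     key_tableau \<mu> ` (\<phi> <#\<^bsub>sym_group n\<^esub> stab n \<mu>) = {right_key S}) \<and>
    bruhat_minimal n (\<phi> <#\<^bsub>sym_group n\<^esub> stab n \<mu>) = {\<phi>}"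
proof -
  have "{i. 1 \<le> i \<and> 1 \<le> \<mu> i} = {i. 1 \<le> i \<and> \<mu> i \<noteq> 0}" by auto
  then have "p = col_len \<mu> 1" using assms(3) by (simp add: col_len_def)
  then interpret push_down \<mu> S p by (intro push_down.intro assms)
  have perm: "\<phi> permutes {1..n}" and inc: "block_increasing n \<mu> \<phi>"
    unfolding assms(7)
    by (rule push_down_perm_permutes[OF assms(4,6)], rule push_down_perm_block_increasing[OF assms(4,6)])
  have rk: "right_key S = key_tableau \<mu> \<phi>" unfolding assms(7) by (rule right_key_push_down[OF assms(4)])
  have "key_tableau \<mu> w = key_tableau \<mu> \<phi>" if "w \<in> \<phi> <#\<^bsub>sym_group n\<^esub> stab n \<mu>" for w
  proof -
    obtain t where "t \<in> stab n \<mu>" "w = \<phi> \<circ> t" using \<open>w \<in> _\<close> unfolding mem_coset_iff by blast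
    then show ?thesis using key_tableau_coset[OF assms(2)] by simp
  qed
  then have "key_tableau \<mu> ` (\<phi> <#\<^bsub>sym_group n\<^esub> stab n \<mu>) =
      (\<lambda>_. key_tableau \<mu> \<phi>) ` (\<phi> <#\<^bsub>sym_group n\<^esub> stab n \<mu>)"
    by (intro image_cong HOL.refl)
  moreover have "\<phi> \<in> \<phi> <#\<^bsub>sym_group n\<^esub> stab n \<mu>" unfolding mem_coset_iff
    by (rule bexI[of _ id]) (simp_all add: mem_stab_iff permutes_id)
  ultimately have "key_tableau \<mu> ` (\<phi> <#\<^bsub>sym_group n\<^esub> stab n \<mu>) = {right_key S}"
    unfolding rk image_constant_conv by auto
  moreover have "is_key_tableau \<mu> (right_key S)"
    unfolding rk by (rule key_tableau_is_key[OF assms(2) permutes_inj[OF perm]])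
  ultimately show ?thesis
    using perm bruhat_minimal_block_increasing[OF assms(2) perm inc] by (simp add: sym_group_carrier)
qed

end
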